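(* Let $\mathrm{H}$ be a homology functor with field coefficients and let $\mathbb{X}=(X,f)$ be an $\mathbb{R}$-space of Morse type with critical values $a_1<a_2<\dots<a_n$, all of whose levelsets and interlevelsets have finite-dimensional homology. Set $a_{n+1}=+\infty$. Then the levelset zigzag persistence diagram $\mathrm{Dgm}^{\mathrm{ZZ}}(\mathrm{H}\mathbb{X})$ contains the same information as the four decorated diagrams $\mathrm{Dgm}^{/\backslash}(\mathrm{H}\mathbb{X})$, $\mathrm{Dgm}^{\backslash\backslash}(\mathrm{H}\mathbb{X})$, $\mathrm{Dgm}^{//}(\mathrm{H}\mathbb{X})$, $\mathrm{Dgm}^{\backslash/}(\mathrm{H}\mathbb{X})$, in the following precise sense (as multisets, i.e. with equal multiplicities): - for $1\le i<j\le n+1$: $(a_i^+,a_j^-)\in\mathrm{Dgm}^{/\backslash}(\mathrm{H}\mathbb{X})$ if and only if $(a_i,a_j)\in\mathrm{Dgm}^{\mathrm{ZZ}}(\mathrm{H}\mathbb{X})$ (open interval); - for $1\le i<j\le n+1$: $(a_i^-,a_j^-)\in\mathrm{Dgm}^{\backslash\backslash}(\mathrm{H}\mathbb{X})$ if and only if $[a_i,a_j)\in\mathrm{Dgm}^{\mathrm{ZZ}}(\mathrm{H}\mathbb{X})$; - for $1\le i<j\le n$: $(a_i^+,a_j^+)\in\mathrm{Dgm}^{//}(\mathrm{H}\mathbb{X})$ if and only if $(a_i,a_j]\in\mathrm{Dgm}^{\mathrm{ZZ}}(\mathrm{H}\mathbb{X})$; - for $1\le i<j\le n$: $(a_i^-,a_j^+)\in\mathrm{Dgm}^{\backslash/}(\mathrm{H}\mathbb{X})$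 if and only if $[a_i,a_j]\in\mathrm{Dgm}^{\mathrm{ZZ}}(\mathrm{H}\mathbb{X})$. Moreover the four diagrams $\mathrm{Dgm}^{/\backslash}(\mathrm{H}\mathbb{X}),\mathrm{Dgm}^{\backslash\backslash}(\mathrm{H}\mathbb{X}),\mathrm{Dgm}^{//}(\mathrm{H}\mathbb{X}),\mathrm{Dgm}^{\backslash/}(\mathrm{H}\mathbb{X})$ contain no decorated points of nonzero multiplicity other than those just specified.
   Context: An $\mathbb{R}$-space is a pair $\mathbb{X}=(X,f)$ with $X$ a topological space and $f:X\to\mathbb{R}$ continuous. For $-\infty\le a\le b\le+\infty$ put $\mathbb{X}_a^b=f^{-1}([a,b])$, with $\mathbb{X}_{-\infty}^{-\infty}=\mathbb{X}_{+\infty}^{+\infty}=\emptyset$; the $\mathbb{X}_a^a$ are levelsets and the $\mathbb{X}_a^b$ interlevelsets. A homology functor with field coefficients means $\mathrm{H}=\mathrm{H}_k(-;\mathbf{k})$, a fixed degree of a homology theory (Eilenberg–Steenrod axioms) with coefficients in a field $\mathbf{k}$. Morse type: there are reals $a_1<\dots<a_n$ (the critical values), locally path-connected compact spaces $V_i$ ($1\le i\le n$) and $E_i$ ($1\le i\le n-1$), and continuous maps $l_i:E_i\to V_i$, $r_i:E_i\to V_{i+1}$, such that $X$ is the quotient of the disjoint union of the $V_i\times\{a_i\}$ and $E_i\times[a_i,a_{i+1}]$ by $(l_i(x),a_i)\sim(x,a_i)$ and $(r_i(x),a_{i+1})\sim(x,a_{i+1})$ for all $i$ and $x\in E_i$,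 and $f$ is the projection onto the second factor. A zigzag module $\mathbb{V}$ of length $n$ is a sequence of $\mathbf{k}$-vector spaces $V_1,\dots,V_n$ with, for each $i$, one linear map between $V_i$ and $V_{i+1}$ (either direction). The interval module on $[V_p,V_q]$ has $\mathbf{k}$ at positions $p,\dots,q$, zero elsewhere, and identity maps between consecutive copies of $\mathbf{k}$. Every zigzag module is a direct sum of interval modules, uniquely up to reordering; $\langle[V_p,V_q]\mid\mathbb{V}\rangle\in\{0,1,\dots,\infty\}$ is the number of copies. Levelset zigzag diagram: choose $s_0<a_1<s_1<a_2<\dots<a_n<s_n$ and let $\mathrm{H}\mathbb{X}_{\{s_0,\dots,s_n\}}$ be the zigzag module $\mathrm{H}(\mathbb{X}_{s_0}^{s_0})\to\mathrm{H}(\mathbb{X}_{s_0}^{s_1})\leftarrow\mathrm{H}(\mathbb{X}_{s_1}^{s_1})\to\mathrm{H}(\mathbb{X}_{s_1}^{s_2})\leftarrow\cdots\to\mathrm{H}(\mathbb{X}_{s_{n-1}}^{s_n})\leftarrow\mathrm{H}(\mathbb{X}_{s_n}^{s_n})$. $\mathrm{Dgm}^{\mathrm{ZZ}}(\mathrm{H}\mathbb{X})$ is the multiset of real intervals obtained from its interval summands by the translation: $[\mathrm{H}(\mathbb{X}_{s_{i-1}}^{s_i}),\mathrm{H}(\mathbb{X}_{s_{j-1}}^{s_j})]\mapsto[a_i,a_j]$ ($1\le i\le j\le n$); $[\mathrm{H}(\mathbb{X}_{s_{i-1}}^{s_i}),\mathrm{H}(\mathbb{X}_{s_{j-1}}^{s_{j-1}})]\mapsto[a_i,a_j)$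 ($1\le i<j\le n+1$); $[\mathrm{H}(\mathbb{X}_{s_i}^{s_i}),\mathrm{H}(\mathbb{X}_{s_{j-1}}^{s_j})]\mapsto(a_i,a_j]$ ($1\le i<j\le n$); $[\mathrm{H}(\mathbb{X}_{s_i}^{s_i}),\mathrm{H}(\mathbb{X}_{s_{j-1}}^{s_{j-1}})]\mapsto(a_i,a_j)$ ($1\le i<j\le n+1$). The four measures: for $R=[a,b]\times[c,d]$, $-\infty\le a<b<c<d\le+\infty$, let $\mathrm{H}\mathbb{X}_{\{a,b,c,d\}}$ be $\mathrm{H}(\mathbb{X}_a^a)\to\mathrm{H}(\mathbb{X}_a^b)\leftarrow\mathrm{H}(\mathbb{X}_b^b)\to\mathrm{H}(\mathbb{X}_b^c)\leftarrow\mathrm{H}(\mathbb{X}_c^c)\to\mathrm{H}(\mathbb{X}_c^d)\leftarrow\mathrm{H}(\mathbb{X}_d^d)$ (maps induced by inclusions). The following are multiplicities in it: $\mu^{/\backslash}_{\mathrm{H}\mathbb{X}}(R)=\langle[\mathrm{H}(\mathbb{X}_b^b),\mathrm{H}(\mathbb{X}_c^c)]\rangle$, $\mu^{\backslash\backslash}_{\mathrm{H}\mathbb{X}}(R)=\langle[\mathrm{H}(\mathbb{X}_a^b),\mathrm{H}(\mathbb{X}_c^c)]\rangle$, $\mu^{//}_{\mathrm{H}\mathbb{X}}(R)=\langle[\mathrm{H}(\mathbb{X}_b^b),\mathrm{H}(\mathbb{X}_c^d)]\rangle$, $\mu^{\backslash/}_{\mathrm{H}\mathbb{X}}(R)=\langle[\mathrm{H}(\mathbb{X}_a^b),\mathrm{H}(\mathbb{X}_c^d)]\rangle$.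 Under the hypotheses these are finite and additive under horizontal and vertical splitting of rectangles (finite r-measures). Decorated diagrams: let $\mathcal{H}=\{(p,q)\mid-\infty\le p<q\le+\infty\}$. A decorated point $(p^*,q^* )$ is $(p,q)\in\mathcal{H}$ with a sign $+$ or $-$ on each coordinate (only $-\infty^+$ and $+\infty^-$ at infinity); $(p^+,q^-),(p^+,q^+),(p^-,q^-),(p^-,q^+)$ encode the intervals $(p,q),(p,q],[p,q),[p,q]$. A decorated point belongs to $R=[a,b]\times[c,d]$ if $(p,q)\in R$ and, whenever a coordinate is an endpoint of the corresponding side, its sign points into the side ($p=a$ requires $+$, $p=b$ requires $-$, $q=c$ requires $+$, $q=d$ requires $-$). For a finite r-measure $\mu$, $\mathrm{Dgm}(\mu)$ is the multiset of decorated points with multiplicity $\mathrm{m}(p^*,q^* )=\min\{\mu(R)\mid(p^*,q^* )\in R\}$. $\mathrm{Dgm}^{\ast}(\mathrm{H}\mathbb{X})$ is $\mathrm{Dgm}(\mu^{\ast}_{\mathrm{H}\mathbb{X}})$ for each of the four types $\ast$. *)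

theory Defs
  imports "HOL-Analysis.Analysis" "HOL-Library.Extended_Nat" "HOL-Library.Function_Algebras"
begin

section \<open>Linear algebra on subspaces of an ambient vector space\<close>

text \<open>
  A family of vector spaces over the field \<open>'k\<close> is rendered as a family of subspaces of one
  ambient vector space on the type \<open>'v\<close>. This loses nothing: a set-indexed family embeds in
  its direct sum, and \<open>'v\<close> stays a type variable.
\<close>

definition linear_between ::
  "('k \<Rightarrow> 'v \<Rightarrow> 'v) \<Rightarrow> ('k \<Rightarrow> 'w \<Rightarrow> 'w) \<Rightarrow> 'v::ab_group_add set \<Rightarrow> 'w::ab_group_add set \<Rightarrow> ('v \<Rightarrow> 'w) \<Rightarrow> bool"
  where
  "linear_between s1 s2 V W g \<longleftrightarrow>
     g \<in> V \<rightarrow> W \<and>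
     (\<forall>x\<in>V. \<forall>y\<in>V. g (x + y) = g x + g y) \<and>
     (\<forall>c. \<forall>x\<in>V. g (s1 c x) = s2 c (g x))"

definition finite_dimensional_subspace ::
  "('k::field \<Rightarrow> 'v \<Rightarrow> 'v) \<Rightarrow> 'v::ab_group_add set \<Rightarrow> bool" where
  "finite_dimensional_subspace sc V \<longleftrightarrow> (\<exists>B. finite B \<and> B \<subseteq> V \<and> V = module.span sc B)"


section \<open>Homology theories with field coefficients\<close>

text \<open>
  \<open>hgrp T p X A\<close> is the vector space $H_p(X,A)$, \<open>hind T p X A Y B g\<close> is the map
  $H_p(X,A) \to H_p(Y,B)$ induced by \<open>g\<close>, and \<open>hbd T p X A\<close> is the connecting map
  $H_p(X,A) \to H_{p-1}(A)$. Absolute homology is the case \<open>A = {}\<close>, and degrees are integers.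
  The category of pairs is that of all pairs of spaces whose points come from the type \<open>'a\<close>.
  Maps between homology spaces only matter on the carriers.
\<close>

record ('k, 'a, 'v) homology_data =
  hscale :: "'k \<Rightarrow> 'v \<Rightarrow> 'v"
  hgrp :: "int \<Rightarrow> 'a topology \<Rightarrow> 'a set \<Rightarrow> 'v set"
  hind :: "int \<Rightarrow> 'a topology \<Rightarrow> 'a set \<Rightarrow> 'a topology \<Rightarrow> 'a set \<Rightarrow> ('a \<Rightarrow> 'a) \<Rightarrow> 'v \<Rightarrow> 'v"
  hbd :: "int \<Rightarrow> 'a topology \<Rightarrow> 'a set \<Rightarrow> 'v \<Rightarrow> 'v"

definition pair_map :: "'a topology \<Rightarrow> 'a set \<Rightarrow> 'a topology \<Rightarrow> 'a set \<Rightarrow> ('a \<Rightarrow> 'a) \<Rightarrow> bool" where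
  "pair_map X A Y B g \<longleftrightarrow>
     A \<subseteq> topspace X \<and> B \<subseteq> topspace Y \<and> continuous_map X Y g \<and> g \<in> A \<rightarrow> B"

text \<open>The Eilenberg--Steenrod axioms, including the dimension axiom.\<close>

locale homology_theory =
  fixes T :: "('k::field, 'a, 'v::ab_group_add) homology_data"
  assumes vector_space_hscale: "vector_space (hscale T)"
    and subspace_hgrp:
      "A \<subseteq> topspace X \<Longrightarrow> module.subspace (hscale T) (hgrp T p X A)"
    and linear_hind:
      "pair_map X A Y B g \<Longrightarrow>
         linear_between (hscale T) (hscale T) (hgrp T p X A) (hgrp T p Y B) (hind T p X A Y B g)"
    and linear_hbd:
      "A \<subseteq> topspace X \<Longrightarrow>
         linear_between (hscale T) (hscale T)
           (hgrp T p X A) (hgrp T (p - 1) (subtopology X A) {}) (hbd T p X A)"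
    and hind_id:
      "A \<subseteq> topspace X \<Longrightarrow> x \<in> hgrp T p X A \<Longrightarrow> hind T p X A X A id x = x"
    and hind_compose:
      "pair_map X A Y B g \<Longrightarrow> pair_map Y B Z C h \<Longrightarrow> x \<in> hgrp T p X A \<Longrightarrow>
         hind T p X A Z C (h \<circ> g) x = hind T p Y B Z C h (hind T p X A Y B g x)"
    and hbd_natural:
      "pair_map X A Y B g \<Longrightarrow> x \<in> hgrp T p X A \<Longrightarrow>
         hbd T p Y B (hind T p X A Y B g x) =
         hind T (p - 1) (subtopology X A) {} (subtopology Y B) {} g (hbd T p X A x)"
    and exact_at_pair:
      "A \<subseteq> topspace X \<Longrightarrow>
         hind T p X {} X A id ` hgrp T p X {} = {x \<in> hgrp T p X A. hbd T p X A x = 0}"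
    and exact_at_subspace:
      "A \<subseteq> topspace X \<Longrightarrow>
         hbd T p X A ` hgrp T p X A =
         {x \<in> hgrp T (p - 1) (subtopology X A) {}.
            hind T (p - 1) (subtopology X A) {} X {} id x = 0}"
    and exact_at_space:
      "A \<subseteq> topspace X \<Longrightarrow>
         hind T p (subtopology X A) {} X {} id ` hgrp T p (subtopology X A) {} =
         {x \<in> hgrp T p X {}. hind T p X {} X A id x = 0}"
    and homotopy_axiom:
      "A \<subseteq> topspace X \<Longrightarrow> B \<subseteq> topspace Y \<Longrightarrow>
         homotopic_with (\<lambda>u. u \<in> A \<rightarrow> B) X Y g h \<Longrightarrow> x \<in> hgrp T p X A \<Longrightarrow>
         hind T p X A Y B g x = hind T p X A Y B h x"
    and excision_axiom:
      "A \<subseteq> topspace X \<Longrightarrow> openin X U \<Longrightarrow> X closure_of U \<subseteq> X interior_of A \<Longrightarrow>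
         bij_betw (hind T p (subtopology X (topspace X - U)) (A - U) X A id)
           (hgrp T p (subtopology X (topspace X - U)) (A - U)) (hgrp T p X A)"
    and dimension_axiom:
      "topspace X = {pt} \<Longrightarrow> p \<noteq> 0 \<Longrightarrow> hgrp T p X {} = {0}"
    and coefficients:
      "topspace X = {pt} \<Longrightarrow>
         \<exists>\<phi>. linear_between (*) (hscale T) (UNIV :: 'k set) (hgrp T 0 X {}) \<phi> \<and>
             bij_betw \<phi> UNIV (hgrp T 0 X {})"


section \<open>$\mathbb{R}$-spaces and Morse type\<close>

definition R_space :: "'a topology \<Rightarrow> ('a \<Rightarrow> real) \<Rightarrow> bool" where
  "R_space X f \<longleftrightarrow> continuous_map X euclideanreal f"

definition interlevelset :: "'a topology \<Rightarrow> ('a \<Rightarrow> real) \<Rightarrow> ereal \<Rightarrow> ereal \<Rightarrow> 'a topology" where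
  "interlevelset X f a b = subtopology X {x. a \<le> ereal (f x) \<and> ereal (f x) \<le> b}"

text \<open>
  In the disjoint union, \<open>Inl i\<close> tags \<open>V i \<times> {a i}\<close> for $1 \le i \le n$ and \<open>Inr i\<close> tags
  \<open>E i \<times> [a i, a (i+1)]\<close> for $1 \le i \le n-1$. All \<open>V i\<close> and \<open>E i\<close> have their points in one
  type \<open>'b\<close>, which is no restriction as \<open>'b\<close> is a type variable.
\<close>

definition morse_pieces ::
  "nat \<Rightarrow> (nat \<Rightarrow> real) \<Rightarrow> (nat \<Rightarrow> 'b topology) \<Rightarrow> (nat \<Rightarrow> 'b topology) \<Rightarrow>
   ((nat + nat) \<times> ('b \<times> real)) topology" where
  "morse_pieces n a V E =
     sum_topology
       (case_sum (\<lambda>i. prod_topology (V i) (top_of_set {a i}))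
                 (\<lambda>i. prod_topology (E i) (top_of_set {a i..a (Suc i)})))
       ({1..n} <+> {1..<n})"

definition morse_glue ::
  "nat \<Rightarrow> (nat \<Rightarrow> real) \<Rightarrow> (nat \<Rightarrow> 'b topology) \<Rightarrow> (nat \<Rightarrow> 'b \<Rightarrow> 'b) \<Rightarrow> (nat \<Rightarrow> 'b \<Rightarrow> 'b) \<Rightarrow>
   (nat + nat) \<times> ('b \<times> real) \<Rightarrow> (nat + nat) \<times> ('b \<times> real) \<Rightarrow> bool" where
  "morse_glue n a E l r u v \<longleftrightarrow>
     (\<exists>i\<in>{1..<n}. \<exists>x\<in>topspace (E i).
        (u = (Inl i, (l i x, a i)) \<and> v = (Inr i, (x, a i))) \<or>
        (u = (Inl (Suc i), (r i x, a (Suc i))) \<and> v = (Inr i, (x, a (Suc i)))))"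

definition morse_type ::
  "'a topology \<Rightarrow> ('a \<Rightarrow> real) \<Rightarrow> nat \<Rightarrow> (nat \<Rightarrow> real) \<Rightarrow>
   (nat \<Rightarrow> 'b topology) \<Rightarrow> (nat \<Rightarrow> 'b topology) \<Rightarrow> (nat \<Rightarrow> 'b \<Rightarrow> 'b) \<Rightarrow> (nat \<Rightarrow> 'b \<Rightarrow> 'b) \<Rightarrow> bool" where
  "morse_type X f n a V E l r \<longleftrightarrow>
     strict_mono_on {1..n} a \<and>
     (\<forall>i\<in>{1..n}. compact_space (V i) \<and> locally_path_connected_space (V i)) \<and>
     (\<forall>i\<in>{1..<n}. compact_space (E i) \<and> locally_path_connected_space (E i)) \<and>
     (\<forall>i\<in>{1..<n}. continuous_map (E i) (V i) (l i) \<and> continuous_map (E i) (V (Suc i)) (r i)) \<and>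
     (\<exists>\<pi>. quotient_map (morse_pieces n a V E) X \<pi> \<and>
          (\<forall>u\<in>topspace (morse_pieces n a V E). \<forall>v\<in>topspace (morse_pieces n a V E).
             \<pi> u = \<pi> v \<longleftrightarrow> equivclp (morse_glue n a E l r) u v) \<and>
          (\<forall>u\<in>topspace (morse_pieces n a V E). f (\<pi> u) = snd (snd u)))"


section \<open>Zigzag modules\<close>

text \<open>
  Positions are numbered \<open>0, \<dots>, zlen - 1\<close>. For \<open>Suc j < zlen\<close>, \<open>zmap j\<close> is the map between positions
  \<open>j\<close> and \<open>Suc j\<close>; it goes from \<open>j\<close> to \<open>Suc j\<close> if \<open>zfwd j\<close>, and from \<open>Suc j\<close> to \<open>j\<close> otherwise.
\<close>

record 'v zigzag =
  zlen :: nat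
  zfwd :: "nat \<Rightarrow> bool"
  zspace :: "nat \<Rightarrow> 'v set"
  zmap :: "nat \<Rightarrow> 'v \<Rightarrow> 'v"

definition zigzag_iso ::
  "('k \<Rightarrow> 'v \<Rightarrow> 'v) \<Rightarrow> ('k \<Rightarrow> 'w \<Rightarrow> 'w) \<Rightarrow> 'v::ab_group_add zigzag \<Rightarrow> 'w::ab_group_add zigzag \<Rightarrow> bool" where
  "zigzag_iso s1 s2 A B \<longleftrightarrow>
     zlen A = zlen B \<and> (\<forall>j. Suc j < zlen A \<longrightarrow> zfwd A j = zfwd B j) \<and>
     (\<exists>\<phi>. (\<forall>j < zlen A.
              linear_between s1 s2 (zspace A j) (zspace B j) (\<phi> j) \<and>
              bij_betw (\<phi> j) (zspace A j) (zspace B j)) \<and>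
          (\<forall>j. Suc j < zlen A \<longrightarrow>
             (if zfwd A j
              then \<forall>x \<in> zspace A j. \<phi> (Suc j) (zmap A j x) = zmap B j (\<phi> j x)
              else \<forall>x \<in> zspace A (Suc j). \<phi> j (zmap A j x) = zmap B j (\<phi> (Suc j) x))))"

definition interval_module :: "nat \<Rightarrow> (nat \<Rightarrow> bool) \<Rightarrow> nat \<Rightarrow> nat \<Rightarrow> 'k::field zigzag" where
  "interval_module m d p q =
     \<lparr>zlen = m, zfwd = d,
      zspace = (\<lambda>j. if p \<le> j \<and> j \<le> q then UNIV else {0}),
      zmap = (\<lambda>j. if p \<le> j \<and> Suc j \<le> q then id else (\<lambda>_. 0))\<rparr>"

text \<open>Elements of a direct sum are finitely supported families, extended by 0 outside the index set.\<close>

definition zigzag_direct_sum ::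
  "nat \<Rightarrow> (nat \<Rightarrow> bool) \<Rightarrow> 'i set \<Rightarrow> ('i \<Rightarrow> 'v zigzag) \<Rightarrow> ('i \<Rightarrow> 'v::ab_group_add) zigzag" where
  "zigzag_direct_sum m d I M =
     \<lparr>zlen = m, zfwd = d,
      zspace = (\<lambda>j. {x. finite {i. x i \<noteq> 0} \<and> (\<forall>i\<in>I. x i \<in> zspace (M i) j) \<and> (\<forall>i. i \<notin> I \<longrightarrow> x i = 0)}),
      zmap = (\<lambda>j x i. if i \<in> I then zmap (M i) j (x i) else 0)\<rparr>"

definition interval_decomposition ::
  "('k::field \<Rightarrow> 'v \<Rightarrow> 'v) \<Rightarrow> 'v::ab_group_add zigzag \<Rightarrow> 'i set \<Rightarrow> ('i \<Rightarrow> nat) \<Rightarrow> ('i \<Rightarrow> nat) \<Rightarrow> bool" where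
  "interval_decomposition sc Z I lo hi \<longleftrightarrow>
     (\<forall>i\<in>I. lo i \<le> hi i \<and> hi i < zlen Z) \<and>
     zigzag_iso (\<lambda>c (x :: 'i \<Rightarrow> 'k) i. c * x i) sc
       (zigzag_direct_sum (zlen Z) (zfwd Z) I
          (\<lambda>i. interval_module (zlen Z) (zfwd Z) (lo i) (hi i)))
       Z"

text \<open>
  The multiplicity of the interval module on positions \<open>p, \<dots>, q\<close>. The index type \<open>nat \<times> 'v\<close> is
  large enough for every decomposition: a summand can be named by its first position and the
  image there of $1 \in k$.
\<close>

definition interval_mult ::
  "('k::field \<Rightarrow> 'v \<Rightarrow> 'v) \<Rightarrow> 'v::ab_group_add zigzag \<Rightarrow> nat \<Rightarrow> nat \<Rightarrow> enat" where
  "interval_mult sc Z p q =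
     (THE N. \<exists>(I :: (nat \<times> 'v) set) lo hi.
        interval_decomposition sc Z I lo hi \<and>
        N = (let S = {i\<in>I. lo i = p \<and> hi i = q} in if finite S then enat (card S) else \<infinity>))"


section \<open>Levelset zigzags\<close>

text \<open>
  The zigzag on the list \<open>s\<close> of levels. The position \<open>2 * i\<close> holds the levelset at \<open>s ! i\<close>, and the
  position \<open>2 * i + 1\<close> holds the interlevelset between \<open>s ! i\<close> and \<open>s ! (i + 1)\<close>.
\<close>

definition level_space :: "'a topology \<Rightarrow> ('a \<Rightarrow> real) \<Rightarrow> ereal list \<Rightarrow> nat \<Rightarrow> 'a topology" where
  "level_space X f s j = interlevelset X f (s ! (j div 2)) (s ! (Suc j div 2))"

definition levelset_zigzag ::
  "('k, 'a, 'v) homology_data \<Rightarrow> int \<Rightarrow> 'a topology \<Rightarrow> ('a \<Rightarrow> real) \<Rightarrow> ereal list \<Rightarrow> 'v zigzag" where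
  "levelset_zigzag T k X f s =
     \<lparr>zlen = 2 * length s - 1, zfwd = even,
      zspace = (\<lambda>j. hgrp T k (level_space X f s j) {}),
      zmap = (\<lambda>j. if even j
                   then hind T k (level_space X f s j) {} (level_space X f s (Suc j)) {} id
                   else hind T k (level_space X f s (Suc j)) {} (level_space X f s j) {} id)\<rparr>"

text \<open>The critical values as extended reals, with $a_{n+1} = +\infty$.\<close>

definition crit :: "nat \<Rightarrow> (nat \<Rightarrow> real) \<Rightarrow> nat \<Rightarrow> ereal" where
  "crit n a i = (if i \<le> n then ereal (a i) else \<infinity>)"

text \<open>
  The translation of pairs of positions in the zigzag on \<open>s 0, \<dots>, s n\<close> to real intervals. The levelset
  at \<open>s i\<close> has position \<open>2 * i\<close>, and the interlevelset between \<open>s (i - 1)\<close> and \<open>s i\<close> has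
  position \<open>2 * i - 1\<close>.
\<close>

definition zz_translation :: "nat \<Rightarrow> (nat \<Rightarrow> real) \<Rightarrow> ((nat \<times> nat) \<times> real set) set" where
  "zz_translation n a =
     {((2 * i - 1, 2 * j - 1), ereal -` {crit n a i..crit n a j}) | i j. 1 \<le> i \<and> i \<le> j \<and> j \<le> n} \<union>
     {((2 * i - 1, 2 * (j - 1)), ereal -` {crit n a i..<crit n a j}) | i j. 1 \<le> i \<and> i < j \<and> j \<le> n + 1} \<union>
     {((2 * i, 2 * j - 1), ereal -` {crit n a i<..crit n a j}) | i j. 1 \<le> i \<and> i < j \<and> j \<le> n} \<union>
     {((2 * i, 2 * (j - 1)), ereal -` {crit n a i<..<crit n a j}) | i j. 1 \<le> i \<and> i < j \<and> j \<le> n + 1}"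

text \<open>Multisets are represented by their multiplicity functions, with values in \<open>enat\<close>.\<close>

definition dgm_ZZ ::
  "('k::field, 'a, 'v::ab_group_add) homology_data \<Rightarrow> int \<Rightarrow> 'a topology \<Rightarrow> ('a \<Rightarrow> real) \<Rightarrow>
   nat \<Rightarrow> (nat \<Rightarrow> real) \<Rightarrow> (nat \<Rightarrow> real) \<Rightarrow> real set \<Rightarrow> enat" where
  "dgm_ZZ T k X f n a s J =
     (\<Sum>(p, q) \<in> {pq. (pq, J) \<in> zz_translation n a}.
        interval_mult (hscale T) (levelset_zigzag T k X f (map (\<lambda>i. ereal (s i)) [0..<Suc n])) p q)"


section \<open>The four measures\<close>

text \<open>
  \<open>mu T k X f p q a b c d\<close> is the multiplicity of the interval on positions \<open>p, \<dots>, q\<close> in the zigzag on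
  \<open>a, b, c, d\<close>, whose positions are
  0: $X_a^a$, 1: $X_a^b$, 2: $X_b^b$, 3: $X_b^c$, 4: $X_c^c$, 5: $X_c^d$, 6: $X_d^d$.
  In the names of the measures and diagrams, \<open>s\<close> is a slash and \<open>b\<close> a backslash.
\<close>

definition mu ::
  "('k::field, 'a, 'v::ab_group_add) homology_data \<Rightarrow> int \<Rightarrow> 'a topology \<Rightarrow> ('a \<Rightarrow> real) \<Rightarrow>
   nat \<Rightarrow> nat \<Rightarrow> ereal \<Rightarrow> ereal \<Rightarrow> ereal \<Rightarrow> ereal \<Rightarrow> enat" where
  "mu T k X f p q a b c d =
     interval_mult (hscale T) (levelset_zigzag T k X f [a, b, c, d]) p q"

definition "mu_sb T k X f = mu T k X f 2 4"
definition "mu_bb T k X f = mu T k X f 1 4"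
definition "mu_ss T k X f = mu T k X f 2 5"
definition "mu_bs T k X f = mu T k X f 1 5"


section \<open>Decorated diagrams\<close>

datatype decoration = Plus | Minus

type_synonym dpoint = "(ereal \<times> decoration) \<times> (ereal \<times> decoration)"

definition decorated_point :: "dpoint \<Rightarrow> bool" where
  "decorated_point = (\<lambda>((p, u), (q, v)).
     p < q \<and> (p = -\<infinity> \<longrightarrow> u = Plus) \<and> (q = \<infinity> \<longrightarrow> v = Minus))"

definition in_rectangle :: "dpoint \<Rightarrow> ereal \<Rightarrow> ereal \<Rightarrow> ereal \<Rightarrow> ereal \<Rightarrow> bool" where
  "in_rectangle = (\<lambda>((p, u), (q, v)) a b c d.
     a \<le> p \<and> p \<le> b \<and> c \<le> q \<and> q \<le> d \<and>
     (p = a \<longrightarrow> u = Plus) \<and> (p = b \<longrightarrow> u = Minus) \<and>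
     (q = c \<longrightarrow> v = Plus) \<and> (q = d \<longrightarrow> v = Minus))"

text \<open>
  The infimum is a minimum: \<open>enat\<close> is well-ordered, and every decorated point lies in some
  rectangle.
\<close>

definition dgm :: "(ereal \<Rightarrow> ereal \<Rightarrow> ereal \<Rightarrow> ereal \<Rightarrow> enat) \<Rightarrow> dpoint \<Rightarrow> enat" where
  "dgm \<mu> P =
     (if decorated_point P
      then Inf {\<mu> a b c d | a b c d. a < b \<and> b < c \<and> c < d \<and> in_rectangle P a b c d}
      else 0)"

definition "dgm_sb T k X f = dgm (mu_sb T k X f)"
definition "dgm_bb T k X f = dgm (mu_bb T k X f)"
definition "dgm_ss T k X f = dgm (mu_ss T k X f)"
definition "dgm_bs T k X f = dgm (mu_bs T k X f)"

end

theory Submission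
  imports Defs
begin

text \<open>
  In a zigzag, the sections over the positions from \<open>p\<close> to \<open>q\<close> form a linear relation between the spaces at
  \<open>p\<close> and \<open>q\<close>, and its rank is the number of bars over \<open>p, \<dots>, q\<close> in any interval decomposition;
  multiplicities are alternating sums of such ranks. For levelset zigzags, Mayer--Vietoris says that this relation
  is the one of becoming equal in the interlevelset from \<open>p\<close> to \<open>q\<close>, so that its rank depends only on the
  levels involved and not on the rest of the zigzag.

  Transported to the homology of a levelset \<open>m\<close> between the two sides of a rectangle, each of the four measures becomes
  \<open>dim (P' \<inter> Q') - dim (P \<inter> Q') - dim (P' \<inter> Q) + dim (P \<inter> Q)\<close>, where the pair \<open>P \<subseteq> P'\<close> depends only on the
  left side and \<open>Q \<subseteq> Q'\<close> only on the right side. Hence the measures are monotone in the rectangle. Morse type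
  gives deformation retractions which make \<open>P\<close>, \<open>P'\<close>, \<open>Q\<close>, \<open>Q'\<close> locally constant away from one-sided jumps at the
  critical values. So a measure is constant on the small rectangles around a decorated
  point, where it is the multiplicity in the zigzag on \<open>s 0, \<dots>, s n\<close>, and it vanishes there
  unless both sides of the rectangle see the jump at a critical value.
\<close>

section \<open>Subspaces of an ambient vector space\<close>

text \<open>\<open>interval_mult\<close> is a definite description, so it says nothing until a
  decomposition is known to exist and all decompositions are known to have equal counts; hence the
  structure theorem for zigzags with arrows of either direction. The infimum in \<open>dgm\<close>
  runs over arbitrarily large rectangles, which may see many critical values; monotonicity reduces
  it to rectangles inside \<open>[s (i - 1), s i]\<close> times \<open>[s (j - 1), s j]\<close>,
  where only \<open>a i\<close> and \<open>a j\<close> occur. The obstacle is the intermediate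
  level: all subspaces must live in one levelset, but a rectangle \<open>[a,b]\<close> times
  \<open>[c,d]\<close> offers only levels in \<open>[b,c]\<close>, and the rectangle of the zigzag
  only levels in \<open>[s i, s (j - 1)]\<close>. These ranges can be disjoint, so the comparison
  passes through the intersection of the two rectangles, whose range contains both. Two flags
  \<open>sl\<close> and \<open>sr\<close> carry the four types at once, and right sides are left
  sides for \<open>-f\<close>. At the end \<open>+\<infinity>\<close> both multiplicities are 0,
  because the space lies between the first and the last critical value.\<close>

lemma linear_betweenD:
  assumes "linear_between s1 s2 V W g"
  shows "x \<in> V \<Longrightarrow> g x \<in> W" "x \<in> V \<Longrightarrow> y \<in> V \<Longrightarrow> g (x + y) = g x + g y"
    "x \<in> V \<Longrightarrow> g (s1 c x) = s2 c (g x)"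
  using assms unfolding linear_between_def by auto

lemma linear_between_compose:
  assumes "linear_between s1 s2 U V f" "linear_between s2 s3 V W g"
  shows "linear_between s1 s3 U W (\<lambda>x. g (f x))"
  using assms unfolding linear_between_def by (auto simp: Pi_iff)

context vector_space
begin

lemma linear_between_zero:
  assumes "subspace V" "vector_space s2" "linear_between scale s2 V W g"
  shows "g 0 = 0"
proof -
  interpret V2: vector_space s2 by fact
  show ?thesis
    using linear_betweenD(3)[OF assms(3) subspace_0[OF assms(1)], of 0] by simp
qed

text \<open>\<open>linear_between\<close> constrains \<open>g\<close> only on \<open>V\<close>.
  Replacing \<open>g\<close> by a linear map of the ambient space, prescribed on a basis of
  \<open>V\<close>, gives access to the theory of globally linear maps.\<close>

lemma linear_between_extend:
  assumes "subspace V" "vector_space s2" "linear_between scale s2 V W g"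
  obtains g' where "Vector_Spaces.linear scale s2 g'" "\<And>v. v \<in> V \<Longrightarrow> g' v = g v"
proof -
  interpret V2: vector_space s2 by fact
  interpret vector_space_pair scale s2 ..
  obtain B where B: "B \<subseteq> V" "independent B" "V \<subseteq> span B"
    using maximal_independent_subset by blast
  obtain g' where g': "Vector_Spaces.linear scale s2 g'" "\<And>x. x \<in> B \<Longrightarrow> g' x = g x"
    using linear_independent_extend[OF B(2)] by blast
  interpret g': Vector_Spaces.linear scale s2 g' by fact
  have "v \<in> V \<and> g' v = g v" if "v \<in> span B" for v
    using that
  proof (induction rule: span_induct_alt)
    case base
    then show ?case
      using assms linear_between_zero by (simp add: subspace_0 g'.zero)
  next
    case (step c x y)
    then show ?case
      using assms(1) B(1) linear_betweenD[OF assms(3)] g'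
      by (auto simp: g'.add g'.scale subspace_add subspace_scale subset_iff)
  qed
  then show ?thesis
    using that g' B(3) by blast
qed

lemma subspace_linear_between_image:
  assumes "subspace V" "vector_space s2" "linear_between scale s2 V W g" "subspace U" "U \<subseteq> V"
  shows "module.subspace s2 (g ` U)"
proof -
  interpret V2: vector_space s2 by fact
  obtain g' where g': "Vector_Spaces.linear scale s2 g'" "\<And>v. v \<in> V \<Longrightarrow> g' v = g v"
    using linear_between_extend[OF assms(1-3)] by blast
  interpret g': Vector_Spaces.linear scale s2 g' by fact
  have "g ` U = g' ` U"
    using g'(2) assms(5) by (auto simp: image_iff) (metis subsetD)
  then show ?thesis
    using g'.subspace_image[OF assms(4)] by simp
qed

lemma subspace_linear_between_vimage:
  assumes "subspace V" "vector_space s2" "linear_between scale s2 V W g" "module.subspace s2 U"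
  shows "subspace {v \<in> V. g v \<in> U}"
proof -
  interpret V2: vector_space s2 by fact
  show ?thesis
    unfolding subspace_def
    using assms linear_between_zero[OF assms(1-3)]
    by (auto simp: subspace_0 subspace_add subspace_scale V2.subspace_0 V2.subspace_add V2.subspace_scale
         linear_betweenD[OF assms(3)])
qed

lemma subspace_linear_between_kernel:
  assumes "subspace V" "vector_space s2" "linear_between scale s2 V W g"
  shows "subspace {v \<in> V. g v = 0}"
proof -
  interpret V2: vector_space s2 by fact
  show ?thesis
    using subspace_linear_between_vimage[OF assms, of "{0}"] by (simp add: V2.subspace_single_0)
qed

lemma linear_between_diff:
  assumes "subspace V" "vector_space s2" "linear_between scale s2 V W g" "x \<in> V" "y \<in> V"
  shows "g (x - y) = g x - g y"
proof -
  have "g (x - y + y) = g (x - y) + g y"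
    using assms by (intro linear_betweenD(2)[OF assms(3)] subspace_diff)
  then show ?thesis by (simp add: algebra_simps)
qed


section \<open>Dimension formulas for finite-dimensional subspaces of an arbitrary ambient
  space\<close>

lemma fin_dim_subspace: "finite_dimensional_subspace scale V \<Longrightarrow> subspace V"
  unfolding finite_dimensional_subspace_def by auto

lemma fin_dim_basis:
  assumes "finite_dimensional_subspace scale V"
  obtains B where "finite B" "independent B" "span B = V" "card B = dim V"
proof -
  obtain C where C: "finite C" "C \<subseteq> V" "V = span C"
    using assms unfolding finite_dimensional_subspace_def by auto
  obtain B where B: "B \<subseteq> V" "independent B" "V \<subseteq> span B" "card B = dim V"
    using basis_exists by blast
  have "finite B"
    using independent_span_bound[OF C(1) B(2)] B(1) C(3) by simp
  moreover have "span B = V"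
    using B(1,3) span_minimal[OF B(1)] C(3) by (metis subset_antisym subspace_span)
  ultimately show ?thesis using that B by blast
qed

lemma fin_dim_mono:
  assumes "finite_dimensional_subspace scale V" "subspace U" "U \<subseteq> V"
  shows "finite_dimensional_subspace scale U"
proof -
  obtain C where C: "finite C" "independent C" "span C = V"
    using fin_dim_basis[OF assms(1)] by metis
  obtain B where B: "B \<subseteq> U" "independent B" "U \<subseteq> span B"
    using maximal_independent_subset by blast
  have "finite B"
    using independent_span_bound[OF C(1) B(2)] B(1) C(3) assms(3) by auto
  moreover have "span B = U"
    using B(1,3) span_minimal[OF B(1) assms(2)] by simp
  ultimately show ?thesis
    using B(1) unfolding finite_dimensional_subspace_def by blast
qed

lemma dim_mono_fin_dim:
  assumes "finite_dimensional_subspace scale V" "U \<subseteq> V"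
  shows "dim U \<le> dim V"
proof -
  obtain C where "finite C" "independent C" "span C = V" "card C = dim V"
    using fin_dim_basis[OF assms(1)] by metis
  then show ?thesis
    using dim_le_card[of U C] assms(2) by simp
qed

text \<open>Makes the total dimension drop when a bar is split off, which drives the induction in
  \<open>interval_decomposition_exists\<close>.\<close>

lemma dim_strict_mono_fin_dim:
  assumes "finite_dimensional_subspace scale V" "subspace U" "U \<subset> V"
  shows "dim U < dim V"
proof -
  obtain B where B: "finite B" "independent B" "span B = U" "card B = dim U"
    using fin_dim_basis[OF fin_dim_mono[OF assms(1,2)]] assms(3) by auto
  obtain v where v: "v \<in> V" "v \<notin> U" using assms(3) by blast
  have v': "independent (insert v B)" "v \<notin> B"
    using B(2,3) v independent_insertI span_base by blast+
  have "insert v B \<subseteq> V"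
    using B(3) v(1) assms(3) span_superset[of B] by auto
  then have "dim (insert v B) \<le> dim V"
    using dim_mono_fin_dim[OF assms(1)] by blast
  then show ?thesis
    using dim_eq_card_independent[OF v'(1)] v'(2) B(1,4) by simp
qed

text \<open>Stands in for the quotient map modulo \<open>T\<close> without leaving the type: a basis
  of \<open>T\<close> is extended to the whole space, its vectors are sent to 0 and the new ones are
  fixed.\<close>

lemma linear_projection_with_kernel:
  assumes "subspace T"
  obtains P where "Vector_Spaces.linear scale scale P" "\<And>v. P v = 0 \<longleftrightarrow> v \<in> T"
proof -
  interpret vector_space_pair scale scale ..
  obtain B where B: "B \<subseteq> T" "independent B" "T \<subseteq> span B"
    using maximal_independent_subset by blast
  define C where "C = extend_basis B"
  have C: "B \<subseteq> C" "independent C" "span C = UNIV"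
    unfolding C_def using extend_basis_superset independent_extend_basis B(2) by auto
  obtain P where P: "Vector_Spaces.linear scale scale P"
    "\<And>x. x \<in> C \<Longrightarrow> P x = (if x \<in> B then 0 else x)"
    using linear_independent_extend[OF C(2), of "\<lambda>x. if x \<in> B then 0 else x"] by blast
  interpret P: Vector_Spaces.linear scale scale P by fact
  have "P x = 0" if "x \<in> B" for x
    using P(2)[of x] C(1) that by auto
  then have PT: "P v = 0" if "v \<in> span B" for v
    using P.eq_0_on_span that by blast
  have Pid: "P v = v" if "v \<in> span (C - B)" for v
    using linear_eq_on[OF P(1) linear_id that] P(2) by auto
  have spanB: "span B = T"
    using B(1,3) span_minimal[OF B(1) assms] by simp
  have "v \<in> T" if "P v = 0" for v
  proof -
    have "v \<in> span (B \<union> (C - B))" using C(1,3) by (simp add: Un_absorb1)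
    then obtain x y where xy: "v = x + y" "x \<in> span B" "y \<in> span (C - B)"
      unfolding span_Un by auto
    then have "y = 0" using that PT[OF xy(2)] Pid[OF xy(3)] by (simp add: P.add)
    then show ?thesis using xy spanB by simp
  qed
  then show ?thesis using that P(1) PT spanB by blast
qed

text \<open>A basis \<open>B\<close> of the kernel is extended to a basis \<open>C\<close> of
  \<open>V\<close>, and \<open>C - B\<close> maps to a basis of the image.\<close>

theorem rank_nullity:
  assumes "finite_dimensional_subspace scale V" "linear_between scale scale V W g"
  shows "dim V = dim (g ` V) + dim {v \<in> V. g v = 0}"
proof -
  interpret vector_space_pair scale scale ..
  note V = fin_dim_subspace[OF assms(1)]
  obtain g' where g': "Vector_Spaces.linear scale scale g'" "\<And>v. v \<in> V \<Longrightarrow> g' v = g v"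
    using linear_between_extend[OF V vector_space_axioms assms(2)] by blast
  interpret g': Vector_Spaces.linear scale scale g' by fact
  let ?K = "{v \<in> V. g v = 0}"
  have K: "finite_dimensional_subspace scale ?K"
    using subspace_linear_between_kernel[OF V vector_space_axioms assms(2)]
    by (intro fin_dim_mono[OF assms(1)]) auto
  obtain B where B: "finite B" "independent B" "span B = ?K" "card B = dim ?K"
    using fin_dim_basis[OF K] by metis
  have BV: "B \<subseteq> V" using B(3) span_superset[of B] by auto
  obtain C where C: "B \<subseteq> C" "C \<subseteq> V" "independent C" "V \<subseteq> span C"
    using maximal_independent_subset_extend[OF BV B(2)] by blast
  have Cs: "span C = V" using C span_minimal[OF C(2) V] by simp
  obtain D where "finite D" "V = span D"
    using assms(1) unfolding finite_dimensional_subspace_def by auto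
  then have fC: "finite C" using independent_span_bound[of D C] C by auto
  have card: "card C = dim V" using basis_card_eq_dim C by blast
  have "inj_on g' (span (C - B))"
  proof -
    have "x = 0" if x: "x \<in> span (C - B)" "g' x = 0" for x
    proof -
      have "x \<in> V" using x(1) Cs span_mono[of "C - B" C] by auto
      then have "x \<in> span B" using x(2) g'(2) B(3) by auto
      \<comment> \<open>A vector in both spans has its coordinates over \<open>C\<close> supported
        both in \<open>B\<close> and off \<open>B\<close>.\<close>
      moreover have "span B \<inter> span (C - B) = {0}"
      proof -
        have eq: "C = B \<union> (C - B)" using C(1) by auto
        show ?thesis
        proof (intro equalityI subsetI)
          fix z assume z: "z \<in> span B \<inter> span (C - B)"
          have "representation C z = representation B z"
            using representation_extend[OF C(3) _ C(1)] z by blast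
          moreover have "representation C z = representation (C - B) z"
            using representation_extend[OF C(3), of z "C - B"] z by blast
          ultimately have "representation C z b = 0" for b
            using representation_ne_zero[of B z b] representation_ne_zero[of "C - B" z b]
            by (metis DiffD2)
          moreover have "z \<in> span C" using z span_mono[OF C(1)] by auto
          ultimately show "z \<in> {0}"
            using sum_nonzero_representation_eq[OF C(3), of z] by simp
        qed (auto simp: span_zero)
      qed
      ultimately show "x = 0" using x(1) by blast
    qed
    then show ?thesis
      using g'.inj_on_iff_eq_0[OF subspace_span] by blast
  qed
  then have inj: "inj_on g' (span (C - B))" .
  have ind: "independent (g' ` (C - B))"
    using g'.independent_injective_image[of "C - B"] inj independent_mono[OF C(3)] by auto
  have "g' ` V = span (g' ` (C - B))"
  proof -
    have "g' ` V = span (g' ` C)" using g'.span_image[of C] Cs by simp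
    also have "\<dots> = span (g' ` (C - B))"
    proof -
      have "g' b = 0" if "b \<in> B" for b using that B(3) span_base[OF that] g'(2) by auto
      then have "g' ` C \<subseteq> span (g' ` (C - B))"
        by (metis DiffI image_eqI image_subsetI span_base span_zero)
      then show ?thesis
        by (intro equalityI span_minimal) (auto intro: span_base subspace_span)
    qed
    finally show ?thesis .
  qed
  moreover have "g ` V = g' ` V" using g'(2) by force
  ultimately have "dim (g ` V) = card (g' ` (C - B))"
    using dim_span_eq_card_independent[OF ind] by simp
  also have "\<dots> = card (C - B)"
    using inj_on_subset[OF inj span_superset] by (rule card_image)
  finally show ?thesis
    using B(1,4) card C(1) fC card_Diff_subset[OF B(1) C(1)] card_mono[OF fC C(1)] by simp
qed

lemma fin_dim_sums:
  assumes "finite_dimensional_subspace scale S" "finite_dimensional_subspace scale T"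
  shows "finite_dimensional_subspace scale {x + y | x y. x \<in> S \<and> y \<in> T}"
proof -
  obtain B C where "finite B" "span B = S" "finite C" "span C = T"
    using fin_dim_basis assms by metis
  then show ?thesis
    unfolding finite_dimensional_subspace_def
    by (intro exI[of _ "B \<union> C"]) (use span_Un[of B C] span_superset[of "B \<union> C"] in auto)
qed

text \<open>The projection with kernel \<open>T\<close> has the same image on the sum and on
  \<open>S\<close>, while its kernels there are \<open>T\<close> and the intersection; rank-nullity
  is applied twice.\<close>

theorem dim_sums_Int_fin_dim:
  assumes "finite_dimensional_subspace scale S" "finite_dimensional_subspace scale T"
  shows "dim {x + y | x y. x \<in> S \<and> y \<in> T} + dim (S \<inter> T) = dim S + dim T"
proof -
  note sub = fin_dim_subspace[OF assms(1)] fin_dim_subspace[OF assms(2)]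
  obtain P where P: "Vector_Spaces.linear scale scale P" "\<And>v. P v = 0 \<longleftrightarrow> v \<in> T"
    using linear_projection_with_kernel[OF sub(2)] by blast
  interpret P: Vector_Spaces.linear scale scale P by fact
  have lin: "linear_between scale scale U UNIV P" for U
    unfolding linear_between_def by (auto simp: P.add P.scale)
  let ?U = "{x + y | x y. x \<in> S \<and> y \<in> T}"
  have "{v \<in> ?U. P v = 0} = T"
    using P(2) subspace_0[OF sub(1)] by force
  moreover have "P ` ?U = P ` S"
  proof (intro equalityI subsetI)
    fix w assume "w \<in> P ` S"
    then obtain x where "x \<in> S" "w = P x" by blast
    moreover have "x + 0 \<in> ?U" using \<open>x \<in> S\<close> subspace_0[OF sub(2)] by blast
    ultimately show "w \<in> P ` ?U" by auto
  qed (use P(2) in \<open>force simp: P.add\<close>)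
  moreover have "{v \<in> S. P v = 0} = S \<inter> T" using P(2) by auto
  ultimately show ?thesis
    using rank_nullity[OF fin_dim_sums[OF assms] lin] rank_nullity[OF assms(1) lin] by simp
qed

text \<open>\<open>\<theta>'\<close> depends only on \<open>g y\<close> modulo \<open>N\<close>, so
  it is a functional on the image of \<open>V\<close> modulo \<open>N\<close>. With \<open>P\<close>
  the projection with kernel \<open>N\<close> and \<open>s\<close> a linear section of
  \<open>h\<close> over that image, \<theta> is \<theta>' after \<open>s\<close> after
  \<open>P\<close>.\<close>

lemma functional_extend:
  assumes "subspace V" "subspace N" "linear_between scale scale V UNIV g"
    "linear_between scale (*) V UNIV \<theta>'" "\<And>y. y \<in> V \<Longrightarrow> g y \<in> N \<Longrightarrow> \<theta>' y = 0"
  obtains \<theta> where "Vector_Spaces.linear scale (*) \<theta>" "\<And>n. n \<in> N \<Longrightarrow> \<theta> n = 0"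
    "\<And>y. y \<in> V \<Longrightarrow> \<theta> (g y) = \<theta>' y"
proof -
  have K: "vector_space ((*) :: 'a \<Rightarrow> 'a \<Rightarrow> 'a)"
    by unfold_locales (auto simp: algebra_simps)
  interpret vector_space_pair scale scale ..
  obtain P where P: "Vector_Spaces.linear scale scale P" "\<And>v. P v = 0 \<longleftrightarrow> v \<in> N"
    using linear_projection_with_kernel[OF assms(2)] by blast
  interpret P: Vector_Spaces.linear scale scale P by fact
  obtain g' where g': "Vector_Spaces.linear scale scale g'" "\<And>v. v \<in> V \<Longrightarrow> g' v = g v"
    using linear_between_extend[OF assms(1) vector_space_axioms assms(3)] by blast
  obtain t where t: "Vector_Spaces.linear scale (*) t" "\<And>v. v \<in> V \<Longrightarrow> t v = \<theta>' v"
    using linear_between_extend[OF assms(1) K assms(4)] by blast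
  interpret t: Vector_Spaces.linear scale "(*)" t by fact
  define h where "h = (\<lambda>v. P (g' v))"
  have h: "Vector_Spaces.linear scale scale h"
    unfolding h_def using Vector_Spaces.linear_compose[OF g'(1) P(1)] by (simp add: comp_def)
  interpret h: Vector_Spaces.linear scale scale h by fact
  obtain C where C: "C \<subseteq> h ` V" "independent C" "h ` V \<subseteq> span C"
    using maximal_independent_subset by blast
  have "\<forall>c\<in>C. \<exists>y. y \<in> V \<and> h y = c" using C(1) by blast
  then obtain y where y: "\<And>c. c \<in> C \<Longrightarrow> y c \<in> V \<and> h (y c) = c" by metis
  obtain s where s: "Vector_Spaces.linear scale scale s" "\<And>c. c \<in> C \<Longrightarrow> s c = y c"
    using linear_independent_extend[OF C(2), of y] by blast
  interpret s: Vector_Spaces.linear scale scale s by fact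
  have sV: "s w \<in> V" if "w \<in> span C" for w
  proof -
    have "s w \<in> span (s ` C)" using s.span_image[of C] that by auto
    moreover have "span (s ` C) \<subseteq> V" using s(2) y by (intro span_minimal assms(1)) auto
    ultimately show ?thesis by blast
  qed
  have hs: "h (s w) = w" if "w \<in> span C" for w
    using linear_eq_on[OF Vector_Spaces.linear_compose[OF s(1) h] linear_id that] s(2) y by auto
  have 1: "t (s (h v)) = \<theta>' v" if v: "v \<in> V" for v
  proof -
    have hv: "h v \<in> span C" using C(3) v by blast
    \<comment> \<open>\<open>v\<close> and \<open>s (h v)\<close> have the same image under
      \<open>h\<close>, so \<open>g\<close> maps their difference into \<open>N\<close> and
      \<open>\<theta>'\<close> vanishes on it by hypothesis.\<close>
    let ?d = "v - s (h v)"
    have d: "?d \<in> V" using v sV[OF hv] assms(1) by (simp add: subspace_diff)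
    have "h ?d = 0" using hs[OF hv] by (simp add: h.diff)
    then have "g ?d \<in> N" using P(2) g'(2)[OF d] by (simp add: h_def)
    then have "t ?d = 0" using assms(5)[OF d] t(2)[OF d] by simp
    then show ?thesis using t(2)[OF v] by (simp add: t.diff)
  qed
  show ?thesis
  proof (rule that[of "\<lambda>v. t (s (P v))"])
    show "Vector_Spaces.linear scale (*) (\<lambda>v. t (s (P v)))"
      using Vector_Spaces.linear_compose[OF Vector_Spaces.linear_compose[OF P(1) s(1)] t(1)] by (simp add: comp_def)
    show "t (s (P n)) = 0" if "n \<in> N" for n
      using P(2)[of n] that s.zero t.zero by simp
    show "t (s (P (g v))) = \<theta>' v" if "v \<in> V" for v
      using 1[OF that] g'(2)[OF that] by (simp add: h_def)
  qed
qed

end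

section \<open>Interval decompositions of zigzag modules\<close>

text \<open>The space at position \<open>j\<close> of the direct sum with one interval module for
  each \<open>i\<close> in \<open>I\<close>. Describing it by supports avoids the records of
  \<open>zigzag_direct_sum\<close>.\<close>

definition bar_coords :: "'i set \<Rightarrow> ('i \<Rightarrow> nat) \<Rightarrow> ('i \<Rightarrow> nat) \<Rightarrow> nat \<Rightarrow> ('i \<Rightarrow> 'k::zero) set" where
  "bar_coords I lo hi j = {x. finite {i. x i \<noteq> 0} \<and> (\<forall>i. x i \<noteq> 0 \<longrightarrow> i \<in> I \<and> lo i \<le> j \<and> j \<le> hi i)}"

text \<open>One formula serves both orientations: a coordinate crosses the arrow between
  \<open>j\<close> and \<open>Suc j\<close>, whichever way it points, if its bar contains both
  positions.\<close>

definition bar_map :: "('i \<Rightarrow> nat) \<Rightarrow> ('i \<Rightarrow> nat) \<Rightarrow> nat \<Rightarrow> ('i \<Rightarrow> 'k::zero) \<Rightarrow> 'i \<Rightarrow> 'k" where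
  "bar_map lo hi j x = (\<lambda>i. if lo i \<le> j \<and> Suc j \<le> hi i then x i else 0)"

definition bar_iso ::
  "('k::field \<Rightarrow> 'v \<Rightarrow> 'v) \<Rightarrow> 'v::ab_group_add zigzag \<Rightarrow> 'i set \<Rightarrow> ('i \<Rightarrow> nat) \<Rightarrow> ('i \<Rightarrow> nat) \<Rightarrow>
   (nat \<Rightarrow> ('i \<Rightarrow> 'k) \<Rightarrow> 'v) \<Rightarrow> bool" where
  "bar_iso sc Z I lo hi \<phi> \<longleftrightarrow>
     (\<forall>j < zlen Z.
        linear_between (\<lambda>c x i. c * x i) sc (bar_coords I lo hi j) (zspace Z j) (\<phi> j) \<and>
        bij_betw (\<phi> j) (bar_coords I lo hi j) (zspace Z j)) \<and>
     (\<forall>j. Suc j < zlen Z \<longrightarrow>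
       (if zfwd Z j
        then \<forall>x \<in> bar_coords I lo hi j. \<phi> (Suc j) (bar_map lo hi j x) = zmap Z j (\<phi> j x)
        else \<forall>x \<in> bar_coords I lo hi (Suc j). \<phi> j (bar_map lo hi j x) = zmap Z j (\<phi> (Suc j) x)))"

lemma bar_coordsI:
  assumes "finite {i. x i \<noteq> 0}" "\<And>i. x i \<noteq> 0 \<Longrightarrow> i \<in> I \<and> lo i \<le> j \<and> j \<le> hi i"
  shows "x \<in> bar_coords I lo hi j"
  using assms by (simp add: bar_coords_def)

lemma bar_coordsD:
  assumes "x \<in> bar_coords I lo hi j"
  shows "finite {i. x i \<noteq> 0}" "x i \<noteq> 0 \<Longrightarrow> i \<in> I \<and> lo i \<le> j \<and> j \<le> hi i"
  using assms by (simp_all add: bar_coords_def)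

lemma bar_isoD:
  assumes "bar_iso sc Z I lo hi \<phi>"
  shows "j < zlen Z \<Longrightarrow> linear_between (\<lambda>c x i. c * x i) sc (bar_coords I lo hi j) (zspace Z j) (\<phi> j)"
    "j < zlen Z \<Longrightarrow> bij_betw (\<phi> j) (bar_coords I lo hi j) (zspace Z j)"
    "Suc j < zlen Z \<Longrightarrow> zfwd Z j \<Longrightarrow> x \<in> bar_coords I lo hi j \<Longrightarrow>
       \<phi> (Suc j) (bar_map lo hi j x) = zmap Z j (\<phi> j x)"
    "Suc j < zlen Z \<Longrightarrow> \<not> zfwd Z j \<Longrightarrow> x \<in> bar_coords I lo hi (Suc j) \<Longrightarrow>
       \<phi> j (bar_map lo hi j x) = zmap Z j (\<phi> (Suc j) x)"
  using assms unfolding bar_iso_def by auto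

lemma interval_decomposition_iff:
  fixes sc :: "'k::field \<Rightarrow> 'v::ab_group_add \<Rightarrow> 'v" and I :: "'i set"
  shows "interval_decomposition sc Z I lo hi \<longleftrightarrow>
     (\<forall>i\<in>I. lo i \<le> hi i \<and> hi i < zlen Z) \<and> (\<exists>\<phi>. bar_iso sc Z I lo hi \<phi>)"
proof -
  let ?D = "zigzag_direct_sum (zlen Z) (zfwd Z) I (\<lambda>i. interval_module (zlen Z) (zfwd Z) (lo i) (hi i))
    :: ('i \<Rightarrow> 'k) zigzag"
  have space: "zspace ?D j = bar_coords I lo hi j" for j
    by (auto simp: zigzag_direct_sum_def interval_module_def bar_coords_def split: if_splits)
  have zm: "zmap ?D j x = bar_map lo hi j x" if "x \<in> bar_coords I lo hi j'" for j j' x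
    using that by (auto simp: zigzag_direct_sum_def interval_module_def bar_coords_def bar_map_def fun_eq_iff)
  have [simp]: "zlen ?D = zlen Z" "zfwd ?D = zfwd Z"
    by (auto simp: zigzag_direct_sum_def)
  show ?thesis
    unfolding interval_decomposition_def zigzag_iso_def bar_iso_def
    by (simp add: space zm cong: conj_cong)
qed

section \<open>Sections of a zigzag as relations between their ends\<close>

definition zstep :: "'v zigzag \<Rightarrow> nat \<Rightarrow> 'v \<Rightarrow> 'v \<Rightarrow> bool" where
  "zstep Z j u v \<longleftrightarrow> (if zfwd Z j then v = zmap Z j u else u = zmap Z j v)"

text \<open>Relates the two ends of a section, that is of a compatible choice of elements at all
  positions from \<open>p\<close> on. Only the ends are kept, so that adding one position is one
  induction step; \<open>zrel_section\<close> recovers the section.\<close>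

inductive zrel :: "'v zigzag \<Rightarrow> nat \<Rightarrow> 'v \<Rightarrow> nat \<Rightarrow> 'v \<Rightarrow> bool" for Z p u where
  base: "u \<in> zspace Z p \<Longrightarrow> zrel Z p u p u"
| step: "zrel Z p u q w \<Longrightarrow> v \<in> zspace Z (Suc q) \<Longrightarrow> zstep Z q w v \<Longrightarrow> zrel Z p u (Suc q) v"

lemma zrel_le: "zrel Z p u q v \<Longrightarrow> p \<le> q"
  by (induction rule: zrel.induct) auto

lemma zrel_refl_iff: "zrel Z p u p v \<longleftrightarrow> u = v \<and> u \<in> zspace Z p"
proof
  assume "zrel Z p u p v"
  then show "u = v \<and> u \<in> zspace Z p"
    by cases (auto dest: zrel_le)
qed (auto intro: zrel.base)

lemma zrel_Suc_iff:
  assumes "p \<le> q"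
  shows "zrel Z p u (Suc q) v \<longleftrightarrow> v \<in> zspace Z (Suc q) \<and> (\<exists>w. zrel Z p u q w \<and> zstep Z q w v)"
proof
  assume "zrel Z p u (Suc q) v"
  then show "v \<in> zspace Z (Suc q) \<and> (\<exists>w. zrel Z p u q w \<and> zstep Z q w v)"
    using assms by cases auto
qed (auto intro: zrel.step)

lemma zrel_mem: "zrel Z p u q v \<Longrightarrow> u \<in> zspace Z p \<and> v \<in> zspace Z q"
  by (induction rule: zrel.induct) auto

lemma zrel_section:
  assumes "zrel Z p u q v"
  shows "\<exists>x. x p = u \<and> x q = v \<and> (\<forall>j. p \<le> j \<and> j \<le> q \<longrightarrow> x j \<in> zspace Z j) \<and>
     (\<forall>j. p \<le> j \<and> j < q \<longrightarrow> zstep Z j (x j) (x (Suc j)))"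
    using assms
  proof (induction rule: zrel.induct)
    case base
    then show ?case by (intro exI[of _ "\<lambda>_. u"]) auto
  next
    case (step q w v)
    from step.IH obtain x where x: "x p = u \<and> x q = w \<and> (\<forall>j. p \<le> j \<and> j \<le> q \<longrightarrow> x j \<in> zspace Z j) \<and>
      (\<forall>j. p \<le> j \<and> j < q \<longrightarrow> zstep Z j (x j) (x (Suc j)))" ..
    have pq: "p \<le> q" by (rule zrel_le[OF step.hyps(1)])
    let ?y = "x(Suc q := v)"
    have "?y j \<in> zspace Z j" if "p \<le> j" "j \<le> Suc q" for j
      using that x step.hyps(2) by (cases "j = Suc q") auto
    moreover have "zstep Z j (?y j) (?y (Suc j))" if "p \<le> j" "j < Suc q" for j
      using that x step.hyps(3) by (cases "j = q") auto
    ultimately show ?case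
      using pq x by (intro exI[of _ ?y]) auto
qed

section \<open>Functionals and the splitting off of bars\<close>

lemma vector_space_field: "vector_space ((*) :: 'k::field \<Rightarrow> 'k \<Rightarrow> 'k)"
  by unfold_locales (auto simp: algebra_simps)

text \<open>A functional with value 1 at the image of \<open>v\<close>, which is nonzero modulo
  \<open>N\<close>, composed with the projection that kills \<open>N\<close>.\<close>

lemma (in vector_space) separating_functional:
  assumes "subspace N" "v \<notin> N"
  obtains t where "Vector_Spaces.linear scale (*) t" "\<And>n. n \<in> N \<Longrightarrow> t n = 0" "t v = 1"
proof -
  interpret vector_space_pair scale "(*) :: 'a \<Rightarrow> 'a \<Rightarrow> 'a"
    by (intro vector_space_pair.intro vector_space_axioms vector_space_field)
  obtain P where P: "Vector_Spaces.linear scale scale P" "\<And>v. P v = 0 \<longleftrightarrow> v \<in> N"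
    using linear_projection_with_kernel[OF assms(1)] by blast
  have "independent {P v}" using P(2)[of v] assms(2) by simp
  then obtain g where g: "Vector_Spaces.linear scale (*) g" "g (P v) = 1"
    using linear_independent_extend[of "{P v}" "\<lambda>_. 1"] by auto
  have "g (P n) = 0" if "n \<in> N" for n
    using P(2)[of n] that linear_0[OF g(1)] by simp
  then show ?thesis
    using that[of "g \<circ> P"] Vector_Spaces.linear_compose[OF P(1) g(1)] g(2) by simp
qed

locale fin_dim_zigzag = vector_space scale
  for scale :: "'k::field \<Rightarrow> 'v::ab_group_add \<Rightarrow> 'v" +
  fixes Z :: "'v zigzag"
  assumes fin_dim: "j < zlen Z \<Longrightarrow> finite_dimensional_subspace scale (zspace Z j)"
    and linear_fwd: "Suc j < zlen Z \<Longrightarrow> zfwd Z j \<Longrightarrow>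
      linear_between scale scale (zspace Z j) (zspace Z (Suc j)) (zmap Z j)"
    and linear_bwd: "Suc j < zlen Z \<Longrightarrow> \<not> zfwd Z j \<Longrightarrow>
      linear_between scale scale (zspace Z (Suc j)) (zspace Z j) (zmap Z j)"
begin

lemma subspace_zspace: "j < zlen Z \<Longrightarrow> subspace (zspace Z j)"
  using fin_dim fin_dim_subspace by blast

lemma zmap_zero:
  assumes "Suc j < zlen Z"
  shows "zmap Z j 0 = 0"
proof (cases "zfwd Z j")
  case True
  then show ?thesis
    using linear_between_zero[OF subspace_zspace vector_space_axioms linear_fwd] assms by simp
next
  case False
  then show ?thesis
    using linear_between_zero[OF subspace_zspace vector_space_axioms linear_bwd] assms by simp
qed

lemma zrel_zero:
  assumes "p \<le> q" "q < zlen Z"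
  shows "zrel Z p 0 q 0"
  using assms
proof (induction q rule: nat_induct_at_least)
  case base
  then show ?case using subspace_zspace subspace_0 by (auto intro: zrel.base)
next
  case (Suc q)
  then show ?case
    using subspace_zspace[of "Suc q"] subspace_0 zmap_zero[of q]
    by (auto simp: zrel_Suc_iff zstep_def intro!: exI[of _ 0])
qed

lemma zrel_add:
  assumes "zrel Z p u q v" "zrel Z p u' q v'" "q < zlen Z"
  shows "zrel Z p (u + u') q (v + v')"
  using assms
proof (induction arbitrary: v' rule: zrel.induct)
  case base
  then show ?case using subspace_zspace subspace_add by (auto simp: zrel_refl_iff)
next
  case (step q w v)
  have le: "p \<le> q" by (rule zrel_le[OF step.hyps(1)])
  obtain w' where w': "zrel Z p u' q w'" "zstep Z q w' v'" "v' \<in> zspace Z (Suc q)"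
    using step.prems(1) le by (auto simp: zrel_Suc_iff)
  have "zrel Z p (u + u') q (w + w')" using step w' by simp
  moreover have "zstep Z q (w + w') (v + v')"
    using step.hyps w' step.prems(2) zrel_mem[OF step.hyps(1)] zrel_mem[OF w'(1)]
      linear_betweenD(2)[OF linear_fwd, of q] linear_betweenD(2)[OF linear_bwd, of q]
    by (auto simp: zstep_def split: if_splits)
  moreover have "v + v' \<in> zspace Z (Suc q)"
    using step w' subspace_zspace subspace_add by blast
  ultimately show ?case using le by (auto simp: zrel_Suc_iff)
qed

lemma zrel_scale:
  assumes "zrel Z p u q v" "q < zlen Z"
  shows "zrel Z p (scale c u) q (scale c v)"
  using assms
proof (induction rule: zrel.induct)
  case base
  then show ?case using subspace_zspace subspace_scale by (auto simp: zrel_refl_iff)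
next
  case (step q w v)
  have "zstep Z q (scale c w) (scale c v)"
    using step.hyps step.prems zrel_mem[OF step.hyps(1)]
      linear_betweenD(3)[OF linear_fwd, of q] linear_betweenD(3)[OF linear_bwd, of q]
    by (auto simp: zstep_def split: if_splits)
  moreover have "scale c v \<in> zspace Z (Suc q)"
    using step subspace_zspace subspace_scale by blast
  ultimately show ?case using step by (auto intro: zrel.step)
qed

lemma zrel_diff:
  assumes "zrel Z p u q v" "zrel Z p u' q v'" "q < zlen Z"
  shows "zrel Z p (u - u') q (v - v')"
  using zrel_add[OF assms(1) zrel_scale[OF assms(2,3), of "-1"] assms(3)] by simp

lemma subspace_zrel:
  assumes "p \<le> q" "q < zlen Z"
  shows "subspace {v. zrel Z p 0 q v}"
  unfolding subspace_def
  using zrel_zero[OF assms] zrel_add[of p 0 q _ 0] zrel_scale[of p 0 q] assms by fastforce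

text \<open>
  A functional at position \<open>q\<close> extends to a compatible family on \<open>p, \<dots>, q\<close> exactly if it vanishes
  on the indeterminacy at \<open>q\<close> of the linear relation \<open>zrel\<close> between the spaces at \<open>p\<close> and \<open>q\<close>.
\<close>

lemma functional_chain:
  assumes "p \<le> q" "q < zlen Z" "linear_between scale (*) (zspace Z q) UNIV \<theta>q"
    "\<And>y. zrel Z p 0 q y \<Longrightarrow> \<theta>q y = 0"
  shows "\<exists>\<theta>. \<theta> q = \<theta>q \<and>
      (\<forall>j. p \<le> j \<and> j \<le> q \<longrightarrow> linear_between scale (*) (zspace Z j) UNIV (\<theta> j)) \<and>
      (\<forall>j y. p \<le> j \<and> j < q \<and> zfwd Z j \<and> y \<in> zspace Z j \<longrightarrow> \<theta> (Suc j) (zmap Z j y) = \<theta> j y) \<and>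
      (\<forall>j y. p \<le> j \<and> j < q \<and> \<not> zfwd Z j \<and> y \<in> zspace Z (Suc j) \<longrightarrow> \<theta> j (zmap Z j y) = \<theta> (Suc j) y)"
    using assms
  proof (induction q arbitrary: \<theta>q rule: nat_induct_at_least)
    case base
    then show ?case by (intro exI[of _ "\<lambda>_. \<theta>q"]) auto
  next
    case (Suc q)
    \<comment> \<open>The functional at \<open>q\<close>. A forward map pulls
      \<open>\<theta>q\<close> back. Along a backward map it has to be found on the target, where
      \<open>functional_extend\<close> provides one that also kills the indeterminacy at
      \<open>q\<close>.\<close>
    have "\<exists>t. linear_between scale (*) (zspace Z q) UNIV t \<and> (\<forall>y. zrel Z p 0 q y \<longrightarrow> t y = 0) \<and>
      (zfwd Z q \<longrightarrow> (\<forall>y\<in>zspace Z q. \<theta>q (zmap Z q y) = t y)) \<and>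
      (\<not> zfwd Z q \<longrightarrow> (\<forall>y\<in>zspace Z (Suc q). t (zmap Z q y) = \<theta>q y))"
    proof (cases "zfwd Z q")
      case True
      have "\<theta>q (zmap Z q y) = 0" if "zrel Z p 0 q y" for y
        using that True zrel_mem[OF that] linear_betweenD(1)[OF linear_fwd[OF Suc.prems(1) True]]
        by (intro Suc.prems(3) zrel.step[of _ _ _ q y]) (auto simp: zstep_def)
      then show ?thesis
        using True linear_between_compose[OF linear_fwd[OF Suc.prems(1) True] Suc.prems(2)]
        by (intro exI[of _ "\<lambda>y. \<theta>q (zmap Z q y)"]) auto
    next
      case False
      have lin: "linear_between scale scale (zspace Z (Suc q)) UNIV (zmap Z q)"
        using linear_bwd[OF Suc.prems(1) False] by (auto simp: linear_between_def)
      have "\<theta>q y = 0" if "y \<in> zspace Z (Suc q)" "zmap Z q y \<in> {v. zrel Z p 0 q v}" for y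
        using that False by (intro Suc.prems(3) zrel.step[of _ _ _ q "zmap Z q y"]) (auto simp: zstep_def)
      then obtain t where t: "Vector_Spaces.linear scale (*) t" "\<And>n. zrel Z p 0 q n \<Longrightarrow> t n = 0"
        "\<And>y. y \<in> zspace Z (Suc q) \<Longrightarrow> t (zmap Z q y) = \<theta>q y"
        using functional_extend[OF subspace_zspace[OF Suc.prems(1)]
            subspace_zrel[OF Suc.hyps Suc_lessD[OF Suc.prems(1)]] lin Suc.prems(2)] by auto
      then have "linear_between scale (*) (zspace Z q) UNIV t"
        by (auto simp: linear_between_def Vector_Spaces.linear_iff)
      then show ?thesis using t False by blast
    qed
    then obtain t where t: "linear_between scale (*) (zspace Z q) UNIV t" "\<And>y. zrel Z p 0 q y \<Longrightarrow> t y = 0"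
      "zfwd Z q \<Longrightarrow> (\<forall>y\<in>zspace Z q. \<theta>q (zmap Z q y) = t y)"
      "\<not> zfwd Z q \<Longrightarrow> (\<forall>y\<in>zspace Z (Suc q). t (zmap Z q y) = \<theta>q y)"
      by blast
    from Suc.IH[OF Suc_lessD[OF Suc.prems(1)] t(1,2)]
    obtain \<theta> where \<theta>: "\<theta> q = t \<and>
      (\<forall>j. p \<le> j \<and> j \<le> q \<longrightarrow> linear_between scale (*) (zspace Z j) UNIV (\<theta> j)) \<and>
      (\<forall>j y. p \<le> j \<and> j < q \<and> zfwd Z j \<and> y \<in> zspace Z j \<longrightarrow> \<theta> (Suc j) (zmap Z j y) = \<theta> j y) \<and>
      (\<forall>j y. p \<le> j \<and> j < q \<and> \<not> zfwd Z j \<and> y \<in> zspace Z (Suc j) \<longrightarrow> \<theta> j (zmap Z j y) = \<theta> (Suc j) y)" ..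
    let ?\<theta> = "\<theta>(Suc q := \<theta>q)"
    have "linear_between scale (*) (zspace Z j) UNIV (?\<theta> j)" if "p \<le> j" "j \<le> Suc q" for j
      using that \<theta> Suc.prems(2) by (cases "j = Suc q") auto
    moreover have "?\<theta> (Suc j) (zmap Z j y) = ?\<theta> j y"
      if "p \<le> j" "j < Suc q" "zfwd Z j" "y \<in> zspace Z j" for j y
      using that \<theta> t(3) by (cases "j = q") auto
    moreover have "?\<theta> j (zmap Z j y) = ?\<theta> (Suc j) y"
      if "p \<le> j" "j < Suc q" "\<not> zfwd Z j" "y \<in> zspace Z (Suc j)" for j y
      using that \<theta> t(4) by (cases "j = q") auto
    ultimately show ?case
      by (intro exI[of _ ?\<theta>]) auto
  qed

text \<open>
  A bar can be split off if a section \<open>x\<close> over its support and a family of functionals \<open>\<theta>\<close> pair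
  to 1, where both respect the maps leaving and entering the support. It starts at the first
  nonzero position; it is chosen to die by the first available kernel, or else to live as long as possible.
\<close>

lemma splitting_bar_exists:
  assumes "j0 < zlen Z" "zspace Z j0 \<noteq> {0}"
  obtains p q x \<theta> where "p \<le> q" "q < zlen Z"
    "\<And>j. p \<le> j \<Longrightarrow> j \<le> q \<Longrightarrow> x j \<in> zspace Z j \<and> \<theta> j (x j) = 1"
    "\<And>j. j < p \<or> q < j \<Longrightarrow> x j = 0 \<and> \<theta> j = (\<lambda>_. 0)"
    "\<And>j. j < zlen Z \<Longrightarrow> linear_between scale (*) (zspace Z j) UNIV (\<theta> j)"
    "\<And>j. Suc j < zlen Z \<Longrightarrow> zfwd Z j \<Longrightarrow> p \<le> j \<Longrightarrow> j \<le> q \<Longrightarrow> zmap Z j (x j) = x (Suc j)"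
    "\<And>j y. Suc j < zlen Z \<Longrightarrow> zfwd Z j \<Longrightarrow> p \<le> Suc j \<Longrightarrow> Suc j \<le> q \<Longrightarrow> y \<in> zspace Z j \<Longrightarrow>
       \<theta> (Suc j) (zmap Z j y) = \<theta> j y"
    "\<And>j. Suc j < zlen Z \<Longrightarrow> \<not> zfwd Z j \<Longrightarrow> p \<le> Suc j \<Longrightarrow> Suc j \<le> q \<Longrightarrow> zmap Z j (x (Suc j)) = x j"
    "\<And>j y. Suc j < zlen Z \<Longrightarrow> \<not> zfwd Z j \<Longrightarrow> p \<le> j \<Longrightarrow> j \<le> q \<Longrightarrow> y \<in> zspace Z (Suc j) \<Longrightarrow>
       \<theta> j (zmap Z j y) = \<theta> (Suc j) y"
proof -
  have V0: "0 \<in> zspace Z j" if "j < zlen Z" for j using subspace_zspace[OF that] subspace_0 by blast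
  \<comment> \<open>With \<open>p\<close> the first nonzero position, the conditions on the arrow at
    the left end of the bar hold trivially.\<close>
  define p where "p = (LEAST j. zspace Z j \<noteq> {0})"
  have p: "zspace Z p \<noteq> {0}" "p \<le> j0"
    unfolding p_def using LeastI[of "\<lambda>j. zspace Z j \<noteq> {0}", OF assms(2)]
      Least_le[of "\<lambda>j. zspace Z j \<noteq> {0}", OF assms(2)] by auto
  have below: "zspace Z j = {0}" if "j < p" for j
    using not_less_Least[of j "\<lambda>j. zspace Z j \<noteq> {0}"] that unfolding p_def by blast
  have "p < zlen Z" using p(2) assms(1) by simp
  define K where "K = (\<lambda>q. \<exists>u. u \<noteq> 0 \<and> zrel Z p u q 0)"
  \<comment> \<open>\<open>q\<close> is an admissible end. Nothing nonzero at \<open>p\<close> is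
    related to 0 at \<open>q\<close>; an outgoing map kills \<open>v\<close>, so the section stops;
    an incoming map brings in nothing related to a nonzero element at \<open>p\<close>, so the
    functional can be made to vanish on its image.\<close>
  have "\<exists>q u v. q < zlen Z \<and> u \<noteq> 0 \<and> zrel Z p u q v \<and> \<not> K q \<and>
      (Suc q < zlen Z \<and> zfwd Z q \<longrightarrow> zmap Z q v = 0) \<and>
      (Suc q < zlen Z \<and> \<not> zfwd Z q \<longrightarrow> (\<forall>u w. zrel Z p u (Suc q) w \<longrightarrow> u = 0))"
  proof (cases "\<exists>q < zlen Z. K q")
    case True
    \<comment> \<open>The bar ends just before the first kernel. The arrow there is forward, since a
      backward one would give a kernel already at \<open>q\<close>.\<close>
    define q' where "q' = (LEAST q. K q)"
    have q': "K q'" "q' < zlen Z"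
      unfolding q'_def using True LeastI_ex[of K] Least_le[of K] by (auto intro: le_less_trans)
    have less: "\<not> K q" if "q < q'" for q
      using not_less_Least that unfolding q'_def by blast
    have nKp: "\<not> K p" by (auto simp: K_def zrel_refl_iff)
    obtain u where u: "u \<noteq> 0" "zrel Z p u q' 0" using q' K_def by blast
    have "p < q'" using zrel_le[OF u(2)] nKp q'(1) by (cases "p = q'") auto
    then obtain q where q: "q' = Suc q" "p \<le> q" by (metis less_eq_Suc_le Suc_le_D Suc_le_mono)
    obtain v where v: "zrel Z p u q v" "zstep Z q v 0" using u(2) q by (auto simp: zrel_Suc_iff)
    have "zfwd Z q"
    proof (rule ccontr)
      assume "\<not> zfwd Z q"
      then have "v = 0" using v(2) zmap_zero[of q] q'(2) q(1) by (simp add: zstep_def)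
      then show False using v(1) u(1) less[of q] q(1) by (auto simp: K_def)
    qed
    then show ?thesis
      using v u(1) less[of q] q q'(2) by (intro exI[of _ q] exI[of _ u] exI[of _ v]) (auto simp: zstep_def)
  next
    case False
    \<comment> \<open>No kernel ever appears, so the bar runs to the last position that a nonzero
      element at \<open>p\<close> reaches; a forward map would carry it one further.\<close>
    define Q where "Q = {q. q < zlen Z \<and> (\<exists>u v. u \<noteq> 0 \<and> zrel Z p u q v)}"
    have fin: "finite Q" by (auto simp: Q_def)
    obtain u0 where "u0 \<in> zspace Z p" "u0 \<noteq> 0" using p(1) V0[OF \<open>p < zlen Z\<close>] by blast
    then have "p \<in> Q" using \<open>p < zlen Z\<close> zrel.base[of u0 Z p] by (auto simp: Q_def)
    then have "Max Q \<in> Q" using Max_in fin by blast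
    then obtain u v where uv: "Max Q < zlen Z" "u \<noteq> 0" "zrel Z p u (Max Q) v" by (auto simp: Q_def)
    have notin: "Suc (Max Q) \<notin> Q" using Max_ge[OF fin] by (meson Suc_n_not_le_n)
    have "\<not> (Suc (Max Q) < zlen Z \<and> zfwd Z (Max Q))"
    proof
      assume A: "Suc (Max Q) < zlen Z \<and> zfwd Z (Max Q)"
      then have "zrel Z p u (Suc (Max Q)) (zmap Z (Max Q) v)"
        using uv(3) zrel_mem[OF uv(3)] linear_betweenD(1)[OF linear_fwd]
        by (intro zrel.step[OF uv(3)]) (auto simp: zstep_def)
      then show False using notin A uv(2) by (auto simp: Q_def)
    qed
    then show ?thesis
      using uv notin False by (intro exI[of _ "Max Q"] exI[of _ u] exI[of _ v]) (auto simp: Q_def)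
  qed
  then obtain q u v where quv: "q < zlen Z \<and> u \<noteq> 0 \<and> zrel Z p u q v \<and> \<not> K q \<and>
      (Suc q < zlen Z \<and> zfwd Z q \<longrightarrow> zmap Z q v = 0) \<and>
      (Suc q < zlen Z \<and> \<not> zfwd Z q \<longrightarrow> (\<forall>u w. zrel Z p u (Suc q) w \<longrightarrow> u = 0))"
    by (elim exE)
  have q: "q < zlen Z" "u \<noteq> 0" "zrel Z p u q v" "\<not> K q"
    and vq0: "Suc q < zlen Z \<Longrightarrow> zfwd Z q \<Longrightarrow> zmap Z q v = 0"
    and max: "Suc q < zlen Z \<Longrightarrow> \<not> zfwd Z q \<Longrightarrow> zrel Z p u' (Suc q) w \<Longrightarrow> u' = 0" for u' w
    using quv by (simp, simp, simp, simp, simp, blast)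
  have pq: "p \<le> q" by (rule zrel_le[OF q(3)])
  \<comment> \<open>The functional at \<open>q\<close> has to vanish on \<open>S\<close> to be
    compatible with an incoming map, and on the indeterminacy at \<open>q\<close> to extend back to
    \<open>p\<close>. The choice of \<open>q\<close> keeps \<open>v\<close> outside the sum of
    both.\<close>
  define S where "S = (if Suc q < zlen Z \<and> \<not> zfwd Z q then zmap Z q ` zspace Z (Suc q) else {0})"
  have subS: "subspace S"
    unfolding S_def
    using subspace_linear_between_image[OF subspace_zspace vector_space_axioms linear_bwd subspace_zspace order_refl]
    by (auto simp: subspace_single_0)
  let ?N = "{x + y | x y. x \<in> {y. zrel Z p 0 q y} \<and> y \<in> S}"
  have subN: "subspace ?N" using subspace_sums[OF subspace_zrel[OF pq q(1)] subS] .
  have vN: "v \<notin> ?N"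
  proof
    assume "v \<in> ?N"
    then obtain y z where yz: "v = y + z" "zrel Z p 0 q y" "z \<in> S" by blast
    have rel: "zrel Z p u q z" using zrel_diff[OF q(3) yz(2) q(1)] yz(1) by simp
    show False
    proof (cases "Suc q < zlen Z \<and> \<not> zfwd Z q")
      case True
      then obtain w where "w \<in> zspace Z (Suc q)" "z = zmap Z q w" using yz(3) by (auto simp: S_def)
      then have "zrel Z p u (Suc q) w" using rel True by (auto intro: zrel.step simp: zstep_def)
      then show False using max[of u w] q(2) True by blast
    next
      case False
      then have "z = 0" using yz(3) by (auto simp: S_def)
      then show False using rel q(2,4) by (auto simp: K_def)
    qed
  qed
  obtain t where t: "Vector_Spaces.linear scale (*) t" "\<And>n. n \<in> ?N \<Longrightarrow> t n = 0" "t v = 1"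
    using separating_functional[OF subN vN] by blast
  have tlin: "linear_between scale (*) (zspace Z q) UNIV t"
    using t(1) by (auto simp: linear_between_def Vector_Spaces.linear_iff)
  have tI: "t y = 0" if "zrel Z p 0 q y" for y
    using that subspace_0[OF subS] by (intro t(2)) force
  have tS: "t y = 0" if "y \<in> S" for y
    using that zrel_zero[OF pq q(1)] by (intro t(2)) force
  from functional_chain[OF pq q(1) tlin tI]
  obtain \<theta> where \<theta>': "\<theta> q = t \<and>
      (\<forall>j. p \<le> j \<and> j \<le> q \<longrightarrow> linear_between scale (*) (zspace Z j) UNIV (\<theta> j)) \<and>
      (\<forall>j y. p \<le> j \<and> j < q \<and> zfwd Z j \<and> y \<in> zspace Z j \<longrightarrow> \<theta> (Suc j) (zmap Z j y) = \<theta> j y) \<and>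
      (\<forall>j y. p \<le> j \<and> j < q \<and> \<not> zfwd Z j \<and> y \<in> zspace Z (Suc j) \<longrightarrow> \<theta> j (zmap Z j y) = \<theta> (Suc j) y)" ..
  have \<theta>: "\<theta> q = t"
    "\<And>j. p \<le> j \<Longrightarrow> j \<le> q \<Longrightarrow> linear_between scale (*) (zspace Z j) UNIV (\<theta> j)"
    "\<And>j y. p \<le> j \<Longrightarrow> j < q \<Longrightarrow> zfwd Z j \<Longrightarrow> y \<in> zspace Z j \<Longrightarrow> \<theta> (Suc j) (zmap Z j y) = \<theta> j y"
    "\<And>j y. p \<le> j \<Longrightarrow> j < q \<Longrightarrow> \<not> zfwd Z j \<Longrightarrow> y \<in> zspace Z (Suc j) \<Longrightarrow> \<theta> j (zmap Z j y) = \<theta> (Suc j) y"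
    using \<theta>' by simp_all
  from zrel_section[OF q(3)] obtain x where x': "x p = u \<and> x q = v \<and> (\<forall>j. p \<le> j \<and> j \<le> q \<longrightarrow> x j \<in> zspace Z j) \<and>
     (\<forall>j. p \<le> j \<and> j < q \<longrightarrow> zstep Z j (x j) (x (Suc j)))" ..
  have x: "x p = u" "x q = v" "\<And>j. p \<le> j \<Longrightarrow> j \<le> q \<Longrightarrow> x j \<in> zspace Z j"
    "\<And>j. p \<le> j \<Longrightarrow> j < q \<Longrightarrow> zstep Z j (x j) (x (Suc j))"
    using x' by simp_all
  \<comment> \<open>At \<open>q\<close> the pairing is \<open>t v = 1\<close>; compatibility of
    section and functionals carries it back along arrows of either direction.\<close>
  have pair: "\<theta> j (x j) = 1" if "p \<le> j" "j \<le> q" for j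
    using that(2,1)
  proof (induction j rule: inc_induct)
    case base
    then show ?case using x(2) \<theta>(1) t(3) by simp
  next
    case (step j)
    then show ?case
      using x(3)[of j] x(3)[of "Suc j"] x(4)[of j] \<theta>(3)[of j "x j"] \<theta>(4)[of j "x (Suc j)"]
      by (auto simp: zstep_def split: if_splits)
  qed
  let ?x = "\<lambda>j. if p \<le> j \<and> j \<le> q then x j else 0"
  let ?t = "\<lambda>j. if p \<le> j \<and> j \<le> q then \<theta> j else (\<lambda>_. 0)"
  show ?thesis
  proof (rule that[OF pq q(1), of ?x ?t])
    fix j assume j: "Suc j < zlen Z" "zfwd Z j"
    show "zmap Z j (?x j) = ?x (Suc j)" if "p \<le> j" "j \<le> q"
      using that x(2) x(4)[of j] vq0 j by (cases "j = q") (auto simp: zstep_def)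
    show "?t (Suc j) (zmap Z j y) = ?t j y" if "p \<le> Suc j" "Suc j \<le> q" "y \<in> zspace Z j" for y
    proof (cases "p = Suc j")
      case True
      then have "y = 0" using below[of j] that by auto
      then have "zmap Z j y = 0" using zmap_zero j by simp
      moreover have "\<theta> p 0 = 0"
        using linear_between_zero[OF subspace_zspace vector_space_field \<theta>(2), of p] pq q(1) by simp
      ultimately show ?thesis using True that by auto
    next
      case False
      then show ?thesis using that \<theta>(3)[of j y] j by auto
    qed
  next
    fix j assume j: "Suc j < zlen Z" "\<not> zfwd Z j"
    show "zmap Z j (?x (Suc j)) = ?x j" if "p \<le> Suc j" "Suc j \<le> q"
    proof (cases "p = Suc j")
      case True
      then have "x p \<in> zspace Z p" using x(3) that by auto
      then have "zmap Z j (x p) \<in> zspace Z j" using linear_betweenD(1)[OF linear_bwd[OF j]] True by simp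
      then show ?thesis using below[of j] True that by auto
    next
      case False
      then show ?thesis using that x(4)[of j] j by (auto simp: zstep_def)
    qed
    show "?t j (zmap Z j y) = ?t (Suc j) y" if "p \<le> j" "j \<le> q" "y \<in> zspace Z (Suc j)" for y
    proof (cases "j = q")
      case True
      then show ?thesis using tS[of "zmap Z j y"] that \<theta>(1) j by (auto simp: S_def)
    next
      case False
      then show ?thesis using that \<theta>(4)[of j y] j by auto
    qed
  qed (use x(3) pair \<theta>(2) in \<open>auto simp: linear_between_def\<close>)
qed

end

lemma fin_dim_zigzag_subspaces:
  fixes sc :: "'k::field \<Rightarrow> 'v::ab_group_add \<Rightarrow> 'v"
  assumes "fin_dim_zigzag sc Z" "\<And>j. j < zlen Z \<Longrightarrow> module.subspace sc (W j)"
    "\<And>j. j < zlen Z \<Longrightarrow> W j \<subseteq> zspace Z j"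
    "\<And>j y. Suc j < zlen Z \<Longrightarrow> zfwd Z j \<Longrightarrow> y \<in> W j \<Longrightarrow> zmap Z j y \<in> W (Suc j)"
    "\<And>j y. Suc j < zlen Z \<Longrightarrow> \<not> zfwd Z j \<Longrightarrow> y \<in> W (Suc j) \<Longrightarrow> zmap Z j y \<in> W j"
  shows "fin_dim_zigzag sc (Z\<lparr>zspace := W\<rparr>)"
proof -
  interpret fin_dim_zigzag sc Z by fact
  have sub: "y \<in> W j \<Longrightarrow> y \<in> zspace Z j" if "j < zlen Z" for j y
    using assms(3)[OF that] by blast
  show ?thesis
  proof
    show "finite_dimensional_subspace sc (zspace (Z\<lparr>zspace := W\<rparr>) j)"
      if "j < zlen (Z\<lparr>zspace := W\<rparr>)" for j
      using that assms(2,3) fin_dim_mono[OF fin_dim] by simp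
  next
    fix j assume j: "Suc j < zlen (Z\<lparr>zspace := W\<rparr>)"
    show "linear_between sc sc (zspace (Z\<lparr>zspace := W\<rparr>) j) (zspace (Z\<lparr>zspace := W\<rparr>) (Suc j))
        (zmap (Z\<lparr>zspace := W\<rparr>) j)" if "zfwd (Z\<lparr>zspace := W\<rparr>) j"
      using j that assms(4)[of j] sub[of j] linear_fwd[of j] by (auto simp: linear_between_def)
    show "linear_between sc sc (zspace (Z\<lparr>zspace := W\<rparr>) (Suc j)) (zspace (Z\<lparr>zspace := W\<rparr>) j)
        (zmap (Z\<lparr>zspace := W\<rparr>) j)" if "\<not> zfwd (Z\<lparr>zspace := W\<rparr>) j"
      using j that assms(5)[of j] sub[of "Suc j"] linear_bwd[of j] by (auto simp: linear_between_def)
  qed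
qed

text \<open>Induction on the total dimension: \<open>splitting_bar_exists\<close> gives a bar and a
  complementary submodule, which is decomposed by induction. The index type is infinite so that a
  fresh index is always available.\<close>

theorem interval_decomposition_exists:
  fixes scale :: "'k::field \<Rightarrow> 'v::ab_group_add \<Rightarrow> 'v"
  assumes "fin_dim_zigzag scale Z" "infinite (UNIV :: 'i set)"
  obtains I :: "'i set" and lo hi where "finite I" "interval_decomposition scale Z I lo hi"
proof -
  interpret vector_space scale using assms(1) unfolding fin_dim_zigzag_def by blast
  have "\<exists>(I :: 'i set) lo hi. finite I \<and> interval_decomposition scale Z I lo hi"
    using assms(1)
  proof (induction "\<Sum>j<zlen Z. dim (zspace Z j)" arbitrary: Z rule: less_induct)
    case less
    interpret fin_dim_zigzag scale Z by fact
    show ?case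
    proof (cases "\<exists>j < zlen Z. zspace Z j \<noteq> {0}")
      case False
      then have zero: "zspace Z j = {0}" if "j < zlen Z" for j using that by blast
      have bc: "bar_coords ({} :: 'i set) (\<lambda>_. 0) (\<lambda>_. 0) j = {0 :: 'i \<Rightarrow> 'k}" for j
        by (auto simp: bar_coords_def zero_fun_def fun_eq_iff)
      have "interval_decomposition scale Z ({} :: 'i set) (\<lambda>_. 0) (\<lambda>_. 0)"
        unfolding interval_decomposition_iff bar_iso_def
        by (intro conjI exI[of _ "\<lambda>_ _. 0"])
          (auto simp: zero bc linear_between_def zmap_zero bij_betw_def)
      then show ?thesis by blast
    next
      case True
      then obtain j0 where j0: "j0 < zlen Z" "zspace Z j0 \<noteq> {0}" by blast
      show ?thesis
      proof (rule splitting_bar_exists[OF j0])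
        fix p q x \<theta> assume pq: "p \<le> q" "q < zlen Z"
          and on: "\<And>j. p \<le> j \<Longrightarrow> j \<le> q \<Longrightarrow> x j \<in> zspace Z j \<and> \<theta> j (x j) = 1"
          and off: "\<And>j. j < p \<or> q < j \<Longrightarrow> x j = 0 \<and> \<theta> j = (\<lambda>_. 0)"
          and lin: "\<And>j. j < zlen Z \<Longrightarrow> linear_between scale (*) (zspace Z j) UNIV (\<theta> j)"
          and xf: "\<And>j. Suc j < zlen Z \<Longrightarrow> zfwd Z j \<Longrightarrow> p \<le> j \<Longrightarrow> j \<le> q \<Longrightarrow> zmap Z j (x j) = x (Suc j)"
          and tf: "\<And>j y. Suc j < zlen Z \<Longrightarrow> zfwd Z j \<Longrightarrow> p \<le> Suc j \<Longrightarrow> Suc j \<le> q \<Longrightarrow> y \<in> zspace Z j \<Longrightarrow>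
            \<theta> (Suc j) (zmap Z j y) = \<theta> j y"
          and xb: "\<And>j. Suc j < zlen Z \<Longrightarrow> \<not> zfwd Z j \<Longrightarrow> p \<le> Suc j \<Longrightarrow> Suc j \<le> q \<Longrightarrow> zmap Z j (x (Suc j)) = x j"
          and tb: "\<And>j y. Suc j < zlen Z \<Longrightarrow> \<not> zfwd Z j \<Longrightarrow> p \<le> j \<Longrightarrow> j \<le> q \<Longrightarrow> y \<in> zspace Z (Suc j) \<Longrightarrow>
            \<theta> j (zmap Z j y) = \<theta> (Suc j) y"
        \<comment> \<open>The complement of the bar. The arrows preserve it because the functionals
          are compatible inside the bar and zero outside.\<close>
        define W where "W = (\<lambda>j. {v \<in> zspace Z j. \<theta> j v = 0})"
        let ?Z = "Z\<lparr>zspace := W\<rparr>"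
        have Wsub: "subspace (W j)" if "j < zlen Z" for j
          unfolding W_def using subspace_linear_between_kernel[OF subspace_zspace[OF that] vector_space_field lin[OF that]] .
        have Wle: "W j \<subseteq> zspace Z j" for j by (auto simp: W_def)
        have Wf: "zmap Z j y \<in> W (Suc j)" if "Suc j < zlen Z" "zfwd Z j" "y \<in> W j" for j y
          using that tf[of j y] off[of "Suc j"] linear_betweenD(1)[OF linear_fwd, of j y]
          by (cases "p \<le> Suc j \<and> Suc j \<le> q") (auto simp: W_def)
        have Wb: "zmap Z j y \<in> W j" if "Suc j < zlen Z" "\<not> zfwd Z j" "y \<in> W (Suc j)" for j y
          using that tb[of j y] off[of j] linear_betweenD(1)[OF linear_bwd, of j y]
          by (cases "p \<le> j \<and> j \<le> q") (auto simp: W_def)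
        have "fin_dim_zigzag scale ?Z"
          using fin_dim_zigzag_subspaces[OF less.prems Wsub Wle Wf Wb] .
        moreover have "(\<Sum>j<zlen ?Z. dim (zspace ?Z j)) < (\<Sum>j<zlen Z. dim (zspace Z j))"
        proof -
          have "dim (W p) < dim (zspace Z p)"
          proof (intro dim_strict_mono_fin_dim fin_dim Wsub)
            have "x p \<in> zspace Z p" "x p \<notin> W p" using on[of p] pq by (auto simp: W_def)
            then show "W p \<subset> zspace Z p" using Wle[of p] by blast
          qed (use pq in auto)
          moreover have "dim (W j) \<le> dim (zspace Z j)" if "j < zlen Z" for j
            using dim_mono_fin_dim[OF fin_dim[OF that] Wle] .
          ultimately show ?thesis
            using pq by (auto intro!: sum_strict_mono_ex1)
        qed
        ultimately obtain I :: "'i set" and lo hi where I: "finite I" "interval_decomposition scale ?Z I lo hi"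
          using less.hyps by blast
        let ?S = "bar_coords I lo hi :: nat \<Rightarrow> ('i \<Rightarrow> 'k) set"
        have lohi: "\<And>i. i \<in> I \<Longrightarrow> lo i \<le> hi i \<and> hi i < zlen Z"
          using I(2) unfolding interval_decomposition_iff by simp
        obtain \<phi> where iso: "bar_iso scale ?Z I lo hi \<phi>"
          using I(2) unfolding interval_decomposition_iff by blast
        note bar_isoD[OF iso, simplified]
        note lin\<phi> = this(1) and bij = this(2) and phf = this(3) and phb = this(4)
        obtain i0 where i0: "i0 \<notin> I" using ex_new_if_finite[OF assms(2) I(1)] by blast
        let ?lo = "lo(i0 := p)" and ?hi = "hi(i0 := q)"
        let ?T = "bar_coords (insert i0 I) ?lo ?hi :: nat \<Rightarrow> ('i \<Rightarrow> 'k) set"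
        \<comment> \<open>The new coordinate \<open>y i0\<close> multiplies the section
          \<open>x\<close>, and the others go into the complement; \<theta> reads
          \<open>y i0\<close> off again.\<close>
        define \<psi> where "\<psi> = (\<lambda>j y. \<phi> j (y(i0 := 0)) + scale (y i0) (x j))"
        have TS: "y(i0 := 0) \<in> ?S j" if y: "y \<in> ?T j" for y j
        proof (rule bar_coordsI)
          have "{i. (y(i0 := 0)) i \<noteq> 0} \<subseteq> {i. y i \<noteq> 0}" by auto
          then show "finite {i. (y(i0 := 0)) i \<noteq> 0}" using bar_coordsD(1)[OF y] finite_subset by blast
          show "i \<in> I \<and> lo i \<le> j \<and> j \<le> hi i" if "(y(i0 := 0)) i \<noteq> 0" for i
            using that bar_coordsD(2)[OF y, of i] by (cases "i = i0") auto
        qed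
        have Ti0: "y i0 = 0" if "y \<in> ?T j" "\<not> (p \<le> j \<and> j \<le> q)" for y j
          using that(2) bar_coordsD(2)[OF that(1), of i0] by auto
        have ST: "y(i0 := c) \<in> ?T j" if y: "y \<in> ?S j" and c: "c = 0 \<or> p \<le> j \<and> j \<le> q" for y j c
        proof (rule bar_coordsI)
          have "{i. (y(i0 := c)) i \<noteq> 0} \<subseteq> insert i0 {i. y i \<noteq> 0}" by auto
          then show "finite {i. (y(i0 := c)) i \<noteq> 0}"
            using bar_coordsD(1)[OF y] by (meson finite.insertI finite_subset)
          show "i \<in> insert i0 I \<and> ?lo i \<le> j \<and> j \<le> ?hi i" if "(y(i0 := c)) i \<noteq> 0" for i
            using that bar_coordsD(2)[OF y, of i] c by (cases "i = i0") auto
        qed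
        have \<phi>W: "\<phi> j y \<in> zspace Z j" "\<theta> j (\<phi> j y) = 0" if "j < zlen Z" "y \<in> ?S j" for j y
          using linear_betweenD(1)[OF lin\<phi>] that by (auto simp: W_def)
        have xV: "x j \<in> zspace Z j" if "j < zlen Z" for j
          using on[of j] off[of j] subspace_0[OF subspace_zspace[OF that]] by (cases "p \<le> j \<and> j \<le> q") auto
        have \<psi>V: "\<psi> j y \<in> zspace Z j" if "j < zlen Z" "y \<in> ?T j" for j y
          unfolding \<psi>_def using subspace_zspace[OF that(1)] \<phi>W(1)[OF that(1) TS[OF that(2)]] xV[OF that(1)]
          by (intro subspace_add subspace_scale)
        have \<theta>\<psi>: "\<theta> j (\<psi> j y) = y i0" if "j < zlen Z" "y \<in> ?T j" for j y
        proof -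
          have "\<theta> j (\<psi> j y) = \<theta> j (\<phi> j (y(i0 := 0))) + y i0 * \<theta> j (x j)"
            unfolding \<psi>_def
            using linear_betweenD(2,3)[OF lin[OF that(1)]] \<phi>W(1)[OF that(1) TS[OF that(2)]] xV[OF that(1)]
              subspace_zspace[OF that(1)] by (simp add: subspace_scale)
          also have "\<dots> = y i0"
            using \<phi>W(2)[OF that(1) TS[OF that(2)]] on[of j] Ti0[OF that(2)]
            by (cases "p \<le> j \<and> j \<le> q") auto
          finally show ?thesis .
        qed
        have lin\<psi>: "linear_between (\<lambda>c x i. c * x i) scale (?T j) (zspace Z j) (\<psi> j)" if j: "j < zlen Z" for j
          unfolding linear_between_def
        proof (intro conjI ballI allI)
          show "\<psi> j \<in> ?T j \<rightarrow> zspace Z j" using \<psi>V[OF j] by auto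
        next
          fix y z assume yz: "y \<in> ?T j" "z \<in> ?T j"
          have "(y + z)(i0 := 0) = y(i0 := 0) + z(i0 := 0)" by (auto simp: plus_fun_def fun_eq_iff)
          then show "\<psi> j (y + z) = \<psi> j y + \<psi> j z"
            using linear_betweenD(2)[OF lin\<phi>[OF j] TS[OF yz(1)] TS[OF yz(2)]]
            by (simp add: \<psi>_def plus_fun_def scale_left_distrib)
        next
          fix c y assume y: "y \<in> ?T j"
          have "(\<lambda>i. c * y i)(i0 := 0) = (\<lambda>i. c * (y(i0 := 0)) i)" by (auto simp: fun_eq_iff)
          then show "\<psi> j (\<lambda>i. c * y i) = scale c (\<psi> j y)"
            using linear_betweenD(3)[OF lin\<phi>[OF j] TS[OF y]]
            by (simp add: \<psi>_def scale_right_distrib)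
        qed
        have bij\<psi>: "bij_betw (\<psi> j) (?T j) (zspace Z j)" if j: "j < zlen Z" for j
          unfolding bij_betw_def
        proof (intro conjI inj_onI equalityI subsetI)
          fix y z assume yz: "y \<in> ?T j" "z \<in> ?T j" "\<psi> j y = \<psi> j z"
          have 0: "y i0 = z i0" using \<theta>\<psi>[OF j] yz by metis
          then have "\<phi> j (y(i0 := 0)) = \<phi> j (z(i0 := 0))" using yz(3) by (simp add: \<psi>_def)
          then have "y(i0 := 0) = z(i0 := 0)"
            using bij_betw_imp_inj_on[OF bij[OF j]] TS yz(1,2) by (meson inj_onD)
          then show "y = z" using 0 by (metis fun_upd_triv fun_upd_upd)
        next
          fix v assume v: "v \<in> zspace Z j"
          \<comment> \<open>The component in the complement: \<open>\<theta> j (x j)\<close> is 1 on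
            the bar, and off the bar both \<open>x\<close> and \<theta> are 0.\<close>
          let ?w = "v - scale (\<theta> j v) (x j)"
          have "\<theta> j ?w = \<theta> j v - \<theta> j v * \<theta> j (x j)"
            using linear_between_diff[OF subspace_zspace[OF j] vector_space_field lin[OF j] v]
              linear_betweenD(3)[OF lin[OF j] xV[OF j]] subspace_scale[OF subspace_zspace[OF j] xV[OF j]] by simp
          then have "\<theta> j ?w = 0"
            using on[of j] off[of j] by (cases "p \<le> j \<and> j \<le> q") auto
          moreover have "?w \<in> zspace Z j"
            using v xV[OF j] subspace_zspace[OF j] by (simp add: subspace_diff subspace_scale)
          ultimately have "?w \<in> \<phi> j ` ?S j"
            using bij_betw_imp_surj_on[OF bij[OF j]] by (simp add: W_def)
          then obtain y where y: "y \<in> ?S j" "\<phi> j y = ?w" by auto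
          have "\<theta> j v = 0 \<or> p \<le> j \<and> j \<le> q"
            using off[of j] by (cases "p \<le> j \<and> j \<le> q") auto
          then have "y(i0 := \<theta> j v) \<in> ?T j" using ST y(1) by blast
          moreover have "(y(i0 := \<theta> j v))(i0 := 0) = y"
            using bar_coordsD(2)[OF y(1), of i0] i0 by (auto simp: fun_eq_iff)
          ultimately show "v \<in> \<psi> j ` ?T j"
            using y(2) by (intro image_eqI[of _ _ "y(i0 := \<theta> j v)"]) (auto simp: \<psi>_def)
        qed (use \<psi>V[OF j] in auto)
        have bm: "(bar_map ?lo ?hi j y)(i0 := 0) = bar_map lo hi j (y(i0 := 0))" for j and y :: "'i \<Rightarrow> 'k"
          by (auto simp: bar_map_def fun_eq_iff)
        have bm0: "bar_map ?lo ?hi j y i0 = (if p \<le> j \<and> Suc j \<le> q then y i0 else 0)" for j and y :: "'i \<Rightarrow> 'k"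
          by (auto simp: bar_map_def)
        have "\<psi> (Suc j) (bar_map ?lo ?hi j y) = zmap Z j (\<psi> j y)"
          if j: "Suc j < zlen Z" "zfwd Z j" and y: "y \<in> ?T j" for j y
        proof -
          have j': "j < zlen Z" using j by simp
          have "zmap Z j (\<psi> j y) = zmap Z j (\<phi> j (y(i0 := 0))) + scale (y i0) (zmap Z j (x j))"
            unfolding \<psi>_def using linear_betweenD(2,3)[OF linear_fwd[OF j]] \<phi>W(1)[OF j' TS[OF y]] xV[OF j']
              subspace_scale[OF subspace_zspace[OF j']] by simp
          moreover have "scale (bar_map ?lo ?hi j y i0) (x (Suc j)) = scale (y i0) (zmap Z j (x j))"
            using xf[OF j] off[of "Suc j"] Ti0[OF y] by (cases "p \<le> j \<and> j \<le> q") (auto simp: bm0)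
          ultimately show ?thesis
            unfolding \<psi>_def bm using phf[OF j TS[OF y]] by simp
        qed
        moreover have "\<psi> j (bar_map ?lo ?hi j y) = zmap Z j (\<psi> (Suc j) y)"
          if j: "Suc j < zlen Z" "\<not> zfwd Z j" and y: "y \<in> ?T (Suc j)" for j y
        proof -
          have "zmap Z j (\<psi> (Suc j) y) = zmap Z j (\<phi> (Suc j) (y(i0 := 0))) + scale (y i0) (zmap Z j (x (Suc j)))"
            unfolding \<psi>_def using linear_betweenD(2,3)[OF linear_bwd[OF j]] \<phi>W(1)[OF j(1) TS[OF y]] xV[OF j(1)]
              subspace_scale[OF subspace_zspace[OF j(1)]] by simp
          moreover have "scale (bar_map ?lo ?hi j y i0) (x j) = scale (y i0) (zmap Z j (x (Suc j)))"
            using xb[OF j] off[of j] Ti0[OF y] by (cases "p \<le> Suc j \<and> Suc j \<le> q") (auto simp: bm0)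
          ultimately show ?thesis
            unfolding \<psi>_def bm using phb[OF j TS[OF y]] by simp
        qed
        ultimately have "interval_decomposition scale Z (insert i0 I) ?lo ?hi"
          unfolding interval_decomposition_iff bar_iso_def
          using lohi pq lin\<psi> bij\<psi> i0 by (intro conjI exI[of _ \<psi>]) auto
        then show ?thesis using I(1) by blast
      qed
    qed
  qed
  then show ?thesis using that by blast
qed

section \<open>Multiplicities as ranks\<close>

text \<open>The unit vectors go to a basis of \<open>W\<close>. Finiteness of \<open>C\<close> is
  part of the conclusion: each finite subset gives independent vectors, so its size is bounded by
  the dimension of \<open>W\<close>.\<close>

lemma (in vector_space) card_eq_dim_coords:
  fixes C :: "'i set" and g :: "('i \<Rightarrow> 'a) \<Rightarrow> 'b"
  defines "S \<equiv> {x. finite {i. x i \<noteq> 0} \<and> {i. x i \<noteq> 0} \<subseteq> C}"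
  assumes lin: "linear_between (\<lambda>c x i. c * x i) scale S W g" and bij: "bij_betw g S W"
    and fd: "finite_dimensional_subspace scale W"
  shows "finite C \<and> card C = dim W"
proof -
  define e where "e = (\<lambda>(i :: 'i) j. if j = i then 1 else 0 :: 'a)"
  have S0: "0 \<in> S" by (simp add: S_def)
  have g0: "g 0 = 0"
  proof -
    have "g (0 + 0) = g 0 + g 0" using linear_betweenD(2)[OF lin S0 S0] .
    then show ?thesis by simp
  qed
  have inS: "(\<lambda>i. if i \<in> F then c i else 0) \<in> S" if "finite F" "F \<subseteq> C" for F c
    using that by (auto simp: S_def intro: finite_subset[OF _ that(1)])
  have eS: "e i \<in> S" if "i \<in> C" for i
    using inS[of "{i}" "\<lambda>_. 1"] that by (simp add: e_def)
  have sum: "g (\<lambda>i. if i \<in> F then c i else 0) = (\<Sum>i\<in>F. scale (c i) (g (e i)))"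
    if "finite F" "F \<subseteq> C" for F and c :: "'i \<Rightarrow> 'a"
    using that
  proof (induction F)
    case empty
    then show ?case using g0 by (simp add: zero_fun_def)
  next
    case (insert k F)
    have ce: "(\<lambda>i. c k * e k i) \<in> S"
      using inS[of "{k}" c] insert.prems by (auto simp: e_def S_def)
    have "(\<lambda>i. if i \<in> insert k F then c i else 0) = (\<lambda>i. c k * e k i) + (\<lambda>i. if i \<in> F then c i else 0)"
      using insert.hyps by (auto simp: e_def plus_fun_def fun_eq_iff)
    then have "g (\<lambda>i. if i \<in> insert k F then c i else 0) =
        g (\<lambda>i. c k * e k i) + g (\<lambda>i. if i \<in> F then c i else 0)"
      using linear_betweenD(2)[OF lin ce inS[OF insert.hyps(1)]] insert.prems by simp
    then show ?case
      using insert linear_betweenD(3)[OF lin eS[of k]] by simp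
  qed
  have inj: "inj_on g S" using bij by (rule bij_betw_imp_inj_on)
  have inj_e: "inj_on (\<lambda>i. g (e i)) C"
  proof (rule inj_onI)
    fix i j assume "i \<in> C" "j \<in> C" "g (e i) = g (e j)"
    then have "e i = e j" using inj eS by (meson inj_onD)
    then have "e i i = e j i" by simp
    then show "i = j" by (simp add: e_def split: if_splits)
  qed
  have ind: "independent ((\<lambda>i. g (e i)) ` F)" if F: "finite F" "F \<subseteq> C" for F
  proof (rule independent_if_scalars_zero)
    fix c x assume c: "(\<Sum>x\<in>(\<lambda>i. g (e i)) ` F. scale (c x) x) = 0" and x: "x \<in> (\<lambda>i. g (e i)) ` F"
    let ?c = "\<lambda>i. if i \<in> F then c (g (e i)) else 0"
    have "(\<Sum>i\<in>F. scale (c (g (e i))) (g (e i))) = 0"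
      using c by (simp add: sum.reindex[OF inj_on_subset[OF inj_e F(2)]])
    then have "g ?c = 0"
      using sum[OF F, of "\<lambda>i. c (g (e i))"] by simp
    then have "g ?c = g 0" using g0 by simp
    then have "?c = 0" by (rule inj_onD[OF inj _ inS[OF F] S0])
    then have c0: "?c i = 0" for i by (rule fun_cong[THEN trans]) simp
    obtain i where "i \<in> F" "x = g (e i)" using x by blast
    then show "c x = 0" using c0[of i] by simp
  qed (use F in simp)
  have sub: "(\<lambda>i. g (e i)) ` F \<subseteq> W" if "F \<subseteq> C" for F
    using linear_betweenD(1)[OF lin eS] that by blast
  have "card F \<le> dim W" if F: "finite F" "F \<subseteq> C" for F
  proof -
    have "card F = card ((\<lambda>i. g (e i)) ` F)"
      using card_image[OF inj_on_subset[OF inj_e F(2)]] by simp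
    also have "\<dots> = dim ((\<lambda>i. g (e i)) ` F)"
      using dim_eq_card_independent[OF ind[OF F]] by simp
    also have "\<dots> \<le> dim W" using dim_mono_fin_dim[OF fd sub[OF F(2)]] .
    finally show ?thesis .
  qed
  then have finC: "finite C"
    using finite_if_finite_subsets_card_bdd[of C "dim W"] by blast
  have "W \<subseteq> span ((\<lambda>i. g (e i)) ` C)"
  proof
    fix w assume "w \<in> W"
    then obtain x where x: "x \<in> S" "w = g x" using bij unfolding bij_betw_def by blast
    have "x = (\<lambda>i. if i \<in> C then x i else 0)" using x(1) by (auto simp: S_def fun_eq_iff)
    then have "w = (\<Sum>i\<in>C. scale (x i) (g (e i)))" using sum[OF finC, of x] x(2) by simp
    then show "w \<in> span ((\<lambda>i. g (e i)) ` C)"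
      by (auto intro!: span_sum span_scale intro: span_base)
  qed
  then have "card ((\<lambda>i. g (e i)) ` C) = dim W"
    using basis_card_eq_dim[OF sub[OF order_refl]] ind[OF finC] by blast
  then show ?thesis using finC card_image[OF inj_e] by simp
qed

lemma (in vector_space) fin_dim_image:
  assumes "finite_dimensional_subspace scale V" "linear_between scale scale V W g"
  shows "finite_dimensional_subspace scale (g ` V)"
proof -
  obtain B where B: "finite B" "span B = V"
    using fin_dim_basis[OF assms(1)] by metis
  obtain g' where g': "Vector_Spaces.linear scale scale g'" "\<And>v. v \<in> V \<Longrightarrow> g' v = g v"
    using linear_between_extend[OF fin_dim_subspace[OF assms(1)] vector_space_axioms assms(2)] by blast
  interpret g': Vector_Spaces.linear scale scale g' by fact
  have "g ` V = span (g' ` B)"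
    using g'.span_image[of B] B(2) g'(2) by force
  then show ?thesis
    unfolding finite_dimensional_subspace_def using B(1) span_superset[of "g' ` B"]
    by (intro exI[of _ "g' ` B"]) simp
qed

lemma bar_coords_mask:
  assumes x: "x \<in> bar_coords I lo hi p" and Q: "\<And>i. lo i \<le> p \<Longrightarrow> p \<le> hi i \<Longrightarrow> Q i \<Longrightarrow> lo i \<le> q \<and> q \<le> hi i"
  shows "(\<lambda>i. if Q i then x i else 0) \<in> bar_coords I lo hi q"
proof (rule bar_coordsI)
  have "{i. (if Q i then x i else 0) \<noteq> 0} \<subseteq> {i. x i \<noteq> 0}" by auto
  then show "finite {i. (if Q i then x i else 0) \<noteq> 0}"
    using bar_coordsD(1)[OF x] finite_subset by blast
  show "i \<in> I \<and> lo i \<le> q \<and> q \<le> hi i" if "(if Q i then x i else 0) \<noteq> 0" for i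
    using that bar_coordsD(2)[OF x, of i] Q[of i] by (auto split: if_splits)
qed

lemma bar_map_mem_fwd: "x \<in> bar_coords I lo hi j \<Longrightarrow> bar_map lo hi j x \<in> bar_coords I lo hi (Suc j)"
  unfolding bar_map_def by (erule bar_coords_mask) simp

lemma bar_map_mem_bwd: "x \<in> bar_coords I lo hi (Suc j) \<Longrightarrow> bar_map lo hi j x \<in> bar_coords I lo hi j"
  unfolding bar_map_def by (erule bar_coords_mask) simp

lemma bar_coords_restrict:
  "x \<in> bar_coords I lo hi p \<Longrightarrow> p \<le> q \<Longrightarrow> (\<lambda>i. if q \<le> hi i then x i else 0) \<in> bar_coords I lo hi q"
  by (erule bar_coords_mask) simp

context fin_dim_zigzag
begin

text \<open>
  In the coordinates of an interval decomposition, a section over \<open>p, \<dots>, q\<close> consists of the full bars over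
  \<open>p, \<dots>, q\<close>, of bars which end earlier by being mapped forward to 0, and of parts which vanish at \<open>p\<close>.
\<close>

lemma zrel_coords:
  assumes iso: "bar_iso scale Z I lo hi \<phi>" and "p \<le> q" "q < zlen Z"
    and x: "x \<in> bar_coords I lo hi p" and "y \<in> bar_coords I lo hi q"
    and "zrel Z p (\<phi> p x) q (\<phi> q y)"
  shows "(lo i \<le> p \<and> q \<le> hi i \<longrightarrow> y i = x i) \<and> (x i \<noteq> 0 \<longrightarrow> q \<le> hi i \<or> hi i < q \<and> zfwd Z (hi i))"
  using assms(2,3,5,6)
proof (induction q arbitrary: y rule: nat_induct_at_least)
  case base
  have "x = y"
    using base bij_betw_imp_inj_on[OF bar_isoD(2)[OF iso base(1)]] x
    by (auto simp: zrel_refl_iff dest: inj_onD)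
  then show ?case using bar_coordsD(2)[OF x, of i] by auto
next
  case (Suc q)
  have q: "q < zlen Z" using Suc.prems(1) by simp
  obtain w where w: "zrel Z p (\<phi> p x) q w" "zstep Z q w (\<phi> (Suc q) y)"
    using Suc.prems(3) Suc.hyps by (auto simp: zrel_Suc_iff)
  obtain z where z: "z \<in> bar_coords I lo hi q" "w = \<phi> q z"
    using zrel_mem[OF w(1)] bij_betw_imp_surj_on[OF bar_isoD(2)[OF iso q]] by blast
  have IH: "(lo i \<le> p \<and> q \<le> hi i \<longrightarrow> z i = x i) \<and> (x i \<noteq> 0 \<longrightarrow> q \<le> hi i \<or> hi i < q \<and> zfwd Z (hi i))"
    using Suc.IH[OF q z(1)] w(1) z(2) by simp
  show ?case
  proof (cases "zfwd Z q")
    case True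
    then have "\<phi> (Suc q) y = \<phi> (Suc q) (bar_map lo hi q z)"
      using w(2) z bar_isoD(3)[OF iso Suc.prems(1) True z(1)] by (simp add: zstep_def)
    then have "y = bar_map lo hi q z"
      using bij_betw_imp_inj_on[OF bar_isoD(2)[OF iso Suc.prems(1)]] Suc.prems(2) bar_map_mem_fwd[OF z(1)]
      by (meson inj_onD)
    then have "y i = (if lo i \<le> q \<and> Suc q \<le> hi i then z i else 0)" by (simp add: bar_map_def)
    then show ?thesis using IH True Suc.hyps by (auto simp: less_Suc_eq not_less_eq_eq le_Suc_eq)
  next
    case False
    then have "\<phi> q z = \<phi> q (bar_map lo hi q y)"
      using w(2) z bar_isoD(4)[OF iso Suc.prems(1) False Suc.prems(2)] by (simp add: zstep_def)
    then have "z = bar_map lo hi q y"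
      using bij_betw_imp_inj_on[OF bar_isoD(2)[OF iso q]] z(1) bar_map_mem_bwd[OF Suc.prems(2)]
      by (meson inj_onD)
    \<comment> \<open>A backward arrow forces \<open>z\<close> to vanish on the bars ending at
      \<open>q\<close>, so no bar that carries a nonzero coordinate of \<open>x\<close> can end
      here.\<close>
    then have "z i = (if lo i \<le> q \<and> Suc q \<le> hi i then y i else 0)" by (simp add: bar_map_def)
    then show ?thesis using IH Suc.hyps bar_coordsD(2)[OF x, of i] by (auto split: if_splits)
  qed
qed

text \<open>Existence half: the section keeps each coordinate until its bar ends. At an end with a
  forward arrow the coordinate is mapped to 0; an end with a backward arrow is excluded by
  hypothesis, as the coordinate would have to come from beyond the bar.\<close>

lemma zrel_of_coords:
  assumes iso: "bar_iso scale Z I lo hi \<phi>" and "p \<le> q" "q < zlen Z"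
    and x: "x \<in> bar_coords I lo hi p"
    and "\<And>i. x i \<noteq> 0 \<Longrightarrow> q \<le> hi i \<or> hi i < q \<and> zfwd Z (hi i)"
  shows "zrel Z p (\<phi> p x) q (\<phi> q (\<lambda>i. if q \<le> hi i then x i else 0))"
  using assms(2,3,5)
proof (induction q rule: nat_induct_at_least)
  case base
  have "(\<lambda>i. if p \<le> hi i then x i else 0) = x"
    using bar_coordsD(2)[OF x] by (auto simp: fun_eq_iff)
  then show ?case
    using linear_betweenD(1)[OF bar_isoD(1)[OF iso base(1)] x] by (auto simp: zrel_refl_iff)
next
  case (Suc q)
  have q: "q < zlen Z" using Suc.prems(1) by simp
  let ?z = "\<lambda>i. if q \<le> hi i then x i else 0" and ?y = "\<lambda>i. if Suc q \<le> hi i then x i else 0"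
  have z: "?z \<in> bar_coords I lo hi q" and y: "?y \<in> bar_coords I lo hi (Suc q)"
    using bar_coords_restrict[OF x] Suc.hyps by auto
  have x0: "\<not> (lo i \<le> q) \<Longrightarrow> x i = 0" for i
    using bar_coordsD(2)[OF x, of i] Suc.hyps by auto
  have "zrel Z p (\<phi> p x) q (\<phi> q ?z)"
  proof (rule Suc.IH[OF q])
    show "q \<le> hi i \<or> hi i < q \<and> zfwd Z (hi i)" if "x i \<noteq> 0" for i
      using Suc.prems(2)[OF that] by auto
  qed
  moreover have "zstep Z q (\<phi> q ?z) (\<phi> (Suc q) ?y)"
  proof (cases "zfwd Z q")
    case True
    have "bar_map lo hi q ?z = ?y" using x0 by (auto simp: bar_map_def fun_eq_iff)
    then show ?thesis using bar_isoD(3)[OF iso Suc.prems(1) True z] True by (simp add: zstep_def)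
  next
    case False
    have "x i = 0" if "hi i = q" for i using Suc.prems(2)[of i] that False by auto
    then have "bar_map lo hi q ?y = ?z" using x0 by (auto simp: bar_map_def fun_eq_iff le_antisym not_less_eq_eq)
    then show ?thesis using bar_isoD(4)[OF iso Suc.prems(1) False y] False by (simp add: zstep_def)
  qed
  moreover have "\<phi> (Suc q) ?y \<in> zspace Z (Suc q)"
    using linear_betweenD(1)[OF bar_isoD(1)[OF iso Suc.prems(1)] y] .
  ultimately show ?case by (metis zrel.step)
qed

text \<open>On the coordinates of the full bars from \<open>p\<close> to \<open>q\<close>, the map
  \<Phi> after \<open>\<phi> p\<close> is an isomorphism onto the intersection of the images,
  because \<Phi> kills exactly the elements related to 0 at \<open>q\<close>.\<close>

theorem card_bars_over:
  fixes I :: "'i set"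
  assumes dec: "interval_decomposition scale Z I lo hi" and pq: "p \<le> q" "q < zlen Z"
    and \<Phi>: "linear_between scale scale (zspace Z p) UNIV \<Phi>"
    and \<Psi>: "linear_between scale scale (zspace Z q) UNIV \<Psi>"
    and rel: "\<And>u v. u \<in> zspace Z p \<Longrightarrow> v \<in> zspace Z q \<Longrightarrow> zrel Z p u q v \<longleftrightarrow> \<Phi> u = \<Psi> v"
  shows "finite {i \<in> I. lo i \<le> p \<and> q \<le> hi i} \<and>
    card {i \<in> I. lo i \<le> p \<and> q \<le> hi i} = dim (\<Phi> ` zspace Z p \<inter> \<Psi> ` zspace Z q)"
proof -
  let ?C = "{i \<in> I. lo i \<le> p \<and> q \<le> hi i}"
  let ?S = "{x :: 'i \<Rightarrow> 'k. finite {i. x i \<noteq> 0} \<and> {i. x i \<noteq> 0} \<subseteq> ?C}"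
  let ?W = "\<Phi> ` zspace Z p \<inter> \<Psi> ` zspace Z q"
  have p: "p < zlen Z" using pq by simp
  obtain \<phi> where iso: "bar_iso scale Z I lo hi \<phi>"
    using dec unfolding interval_decomposition_iff by blast
  have SS: "x \<in> bar_coords I lo hi p" if "x \<in> ?S" for x
    using that pq by (intro bar_coordsI) auto
  have V: "\<phi> j x \<in> zspace Z j" if "j < zlen Z" "x \<in> bar_coords I lo hi j" for j x
    using linear_betweenD(1)[OF bar_isoD(1)[OF iso that(1)] that(2)] .
  have \<Psi>0: "\<Psi> 0 = 0" by (rule linear_between_zero[OF subspace_zspace[OF pq(2)] vector_space_axioms \<Psi>])
  have bc0: "(\<lambda>i. 0) \<in> bar_coords I lo hi j" for j by (intro bar_coordsI) auto
  have \<phi>0: "\<phi> j (\<lambda>i. 0) = 0" if "j < zlen Z" for j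
    using linear_betweenD(3)[OF bar_isoD(1)[OF iso that] bc0, of 0] by simp
  have relD: "\<Phi> u = \<Psi> v" if "zrel Z p u q v" for u v
    using that zrel_mem[OF that] by (simp add: rel)
  have relI: "zrel Z p u q v" if "\<Phi> u = \<Psi> v" "u \<in> zspace Z p" "v \<in> zspace Z q" for u v
    using that by (simp add: rel)
  define g where "g = (\<lambda>x. \<Phi> (\<phi> p x))"
  have glin: "linear_between (\<lambda>c x i. c * x i) scale (bar_coords I lo hi p) UNIV g"
    unfolding g_def by (rule linear_between_compose[OF bar_isoD(1)[OF iso p] \<Phi>])
  have gW: "g x \<in> ?W" if "x \<in> ?S" for x
  proof -
    let ?y = "\<lambda>i. if q \<le> hi i then x i else 0"
    have "zrel Z p (\<phi> p x) q (\<phi> q ?y)"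
      using that by (intro zrel_of_coords[OF iso pq SS]) auto
    then have "g x = \<Psi> (\<phi> q ?y)"
      unfolding g_def by (rule relD)
    then show ?thesis
      using V[OF p SS[OF that]] V[OF pq(2) bar_coords_restrict[OF SS[OF that] pq(1)]]
      by (metis IntI g_def imageI)
  qed
  have "linear_between (\<lambda>c x i. c * x i) scale ?S ?W g"
    using glin SS gW unfolding linear_between_def by blast
  moreover have "bij_betw g ?S ?W"
    unfolding bij_betw_def
  proof (intro conjI equalityI subsetI)
    show "inj_on g ?S"
    proof (rule inj_onI)
      fix x x' assume x: "x \<in> ?S" "x' \<in> ?S" "g x = g x'"
      have d: "x - x' \<in> ?S"
      proof -
        have "{i. (x - x') i \<noteq> 0} \<subseteq> {i. x i \<noteq> 0} \<union> {i. x' i \<noteq> 0}" by auto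
        then show ?thesis using x(1,2) finite_subset by blast
      qed
      \<comment> \<open>Equal images mean that the difference is related to 0 at \<open>q\<close>,
        hence vanishes on the full bars, which carry its whole support.\<close>
      have "g (x - x' + x') = g (x - x') + g x'"
        using linear_betweenD(2)[OF glin SS[OF d] SS[OF x(2)]] .
      then have "\<Phi> (\<phi> p (x - x')) = \<Psi> (\<phi> q (\<lambda>i. 0))"
        using x(3) \<Psi>0 \<phi>0[OF pq(2)] by (simp add: g_def)
      then have "zrel Z p (\<phi> p (x - x')) q (\<phi> q (\<lambda>i. 0))"
        by (rule relI[OF _ V[OF p SS[OF d]] V[OF pq(2) bc0]])
      then have "lo i \<le> p \<and> q \<le> hi i \<longrightarrow> 0 = (x - x') i" for i
        using zrel_coords[OF iso pq SS[OF d] bc0, of i] by blast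
      then have "(x - x') i = 0" for i
        using d by (cases "(x - x') i = 0") auto
      then have "x i - x' i = 0" for i by simp
      then show "x = x'" by (simp add: fun_eq_iff)
    qed
  next
    fix w assume w: "w \<in> ?W"
    obtain u where u: "u \<in> zspace Z p" "w = \<Phi> u" using w by (elim IntE imageE)
    obtain v where v: "v \<in> zspace Z q" "w = \<Psi> v" using w by (elim IntE imageE)
    have "u \<in> \<phi> p ` bar_coords I lo hi p" "v \<in> \<phi> q ` bar_coords I lo hi q"
      using u(1) v(1) bij_betw_imp_surj_on[OF bar_isoD(2)[OF iso p]]
        bij_betw_imp_surj_on[OF bar_isoD(2)[OF iso pq(2)]] by simp_all
    then obtain x y where x: "x \<in> bar_coords I lo hi p" "u = \<phi> p x"
      and y: "y \<in> bar_coords I lo hi q" "v = \<phi> q y"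
      by (elim imageE)
    have "zrel Z p (\<phi> p x) q (\<phi> q y)" using u v x(2) y(2) by (intro relI) simp_all
    then have ends: "q \<le> hi i \<or> hi i < q \<and> zfwd Z (hi i)" if "x i \<noteq> 0" for i
      using zrel_coords[OF iso pq x(1) y(1)] that by blast
    \<comment> \<open>\<open>?x1\<close> lives on the full bars and \<open>?x2\<close> on those that
      end before \<open>q\<close>. The latter is related to 0, so \<Phi> does not see it.\<close>
    let ?x1 = "\<lambda>i. if q \<le> hi i then x i else 0" and ?x2 = "\<lambda>i. if q \<le> hi i then 0 else x i"
    have fin: "finite {i. ?x1 i \<noteq> 0}" "finite {i. ?x2 i \<noteq> 0}"
      using bar_coordsD(1)[OF x(1)] by (auto elim!: finite_subset[rotated])
    have x1: "?x1 \<in> ?S" using fin(1) bar_coordsD(2)[OF x(1)] by auto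
    have x2: "?x2 \<in> bar_coords I lo hi p"
      using fin(2) bar_coordsD(2)[OF x(1)] by (intro bar_coordsI) (auto split: if_splits)
    have "zrel Z p (\<phi> p ?x2) q (\<phi> q (\<lambda>i. if q \<le> hi i then ?x2 i else 0))"
      using ends by (intro zrel_of_coords[OF iso pq x2]) (auto split: if_splits)
    moreover have "(\<lambda>i. if q \<le> hi i then ?x2 i else 0) = (\<lambda>i. 0)" by auto
    ultimately have "zrel Z p (\<phi> p ?x2) q (\<phi> q (\<lambda>i. 0))" by simp
    then have "\<Phi> (\<phi> p ?x2) = \<Psi> (\<phi> q (\<lambda>i. 0))"
      by (rule relD)
    then have g2: "g ?x2 = 0" using \<Psi>0 \<phi>0[OF pq(2)] by (simp add: g_def)
    have "?x1 + ?x2 = x" by (auto simp: plus_fun_def)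
    then have "g x = g ?x1 + g ?x2"
      using linear_betweenD(2)[OF glin SS[OF x1] x2] by simp
    then have "w = g ?x1" using g2 u(2) x(2) by (simp add: g_def)
    then show "w \<in> g ` ?S" using x1 by blast
  qed (use gW in blast)
  moreover have "finite_dimensional_subspace scale ?W"
  proof (rule fin_dim_mono)
    show "finite_dimensional_subspace scale (\<Phi> ` zspace Z p)"
      by (rule fin_dim_image[OF fin_dim[OF p] \<Phi>])
    show "subspace ?W"
      using subspace_linear_between_image[OF subspace_zspace vector_space_axioms _ subspace_zspace order_refl] p pq(2) \<Phi> \<Psi>
      by (blast intro: subspace_inter)
  qed simp
  ultimately show ?thesis
    using card_eq_dim_coords[of ?C ?W g] by blast
qed

text \<open>Existence of one decomposition makes the definite description denote, and the same count
  in each makes its value unique.\<close>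

lemma interval_mult_eqI:
  fixes N :: nat
  assumes "\<And>(I :: (nat \<times> 'v) set) lo hi. interval_decomposition scale Z I lo hi \<Longrightarrow>
    finite {i \<in> I. lo i = p \<and> hi i = q} \<and> card {i \<in> I. lo i = p \<and> hi i = q} = N"
  shows "interval_mult scale Z p q = enat N"
proof -
  have "infinite (UNIV :: (nat \<times> 'v) set)" by (simp add: finite_prod)
  then obtain I :: "(nat \<times> 'v) set" and lo hi where dec: "interval_decomposition scale Z I lo hi"
    using interval_decomposition_exists[OF fin_dim_zigzag_axioms] by blast
  show ?thesis
    unfolding interval_mult_def
  proof (rule the_equality)
    show "\<exists>(I :: (nat \<times> 'v) set) lo hi. interval_decomposition scale Z I lo hi \<and>
      enat N = (let S = {i \<in> I. lo i = p \<and> hi i = q} in if finite S then enat (card S) else \<infinity>)"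
      using dec assms[OF dec] by (intro exI[of _ I] exI[of _ lo] exI[of _ hi]) (simp add: Let_def)
  next
    fix M
    assume "\<exists>(I :: (nat \<times> 'v) set) lo hi. interval_decomposition scale Z I lo hi \<and>
      M = (let S = {i \<in> I. lo i = p \<and> hi i = q} in if finite S then enat (card S) else \<infinity>)"
    then obtain J :: "(nat \<times> 'v) set" and lo' hi' where J: "interval_decomposition scale Z J lo' hi'"
      "M = (let S = {i \<in> J. lo' i = p \<and> hi' i = q} in if finite S then enat (card S) else \<infinity>)"
      by (elim exE conjE)
    then show "M = enat N"
      using assms[OF J(1)] by (simp add: Let_def)
  qed
qed

text \<open>Inclusion-exclusion: a bar over the positions from \<open>Suc p\<close> to
  \<open>q\<close> that is not exactly this interval also contains \<open>p\<close> or
  \<open>Suc q\<close>. The numbers \<open>R\<close> do not mention the decomposition, so the count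
  is the same for all.\<close>

theorem interval_mult_rank:
  fixes R :: "nat \<Rightarrow> nat \<Rightarrow> nat"
  assumes R: "\<And>(I :: (nat \<times> 'v) set) lo hi p q. interval_decomposition scale Z I lo hi \<Longrightarrow> p \<le> q \<Longrightarrow> q < zlen Z \<Longrightarrow>
      finite {i \<in> I. lo i \<le> p \<and> q \<le> hi i} \<and> card {i \<in> I. lo i \<le> p \<and> q \<le> hi i} = R p q"
    and pq: "Suc p \<le> q" "Suc q < zlen Z"
  shows "\<exists>N. interval_mult scale Z (Suc p) q = enat N \<and>
    int N = int (R (Suc p) q) - int (R p q) - int (R (Suc p) (Suc q)) + int (R p (Suc q))"
proof -
  define N where "N = nat (int (R (Suc p) q) - int (R p q) - int (R (Suc p) (Suc q)) + int (R p (Suc q)))"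
  have main: "finite {i \<in> I. lo i = Suc p \<and> hi i = q} \<and> int (card {i \<in> I. lo i = Suc p \<and> hi i = q}) =
      int (R (Suc p) q) - int (R p q) - int (R (Suc p) (Suc q)) + int (R p (Suc q))"
    if dec: "interval_decomposition scale Z I lo hi" for I :: "(nat \<times> 'v) set" and lo hi
  proof -
    let ?A = "\<lambda>p q. {i \<in> I. lo i \<le> p \<and> q \<le> hi i}"
    let ?X = "{i \<in> I. lo i = Suc p \<and> hi i = q}"
    have fin: "finite (?A p' q')" "card (?A p' q') = R p' q'" if "p' \<le> q'" "q' < zlen Z" for p' q'
      using R[OF dec that] by auto
    have f1: "finite (?A (Suc p) q)" "finite (?A p q)" "finite (?A (Suc p) (Suc q))" "finite (?A p (Suc q))"
      using fin(1) pq by auto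
    have "?A (Suc p) q = ?X \<union> (?A p q \<union> ?A (Suc p) (Suc q))"
      by (auto simp: le_Suc_eq not_less_eq_eq dest: le_antisym)
    moreover have "?X \<inter> (?A p q \<union> ?A (Suc p) (Suc q)) = {}" by auto
    moreover have finX: "finite ?X" using f1(1) by (rule finite_subset[rotated]) auto
    ultimately have 1: "card (?A (Suc p) q) = card ?X + card (?A p q \<union> ?A (Suc p) (Suc q))"
      using f1 by (simp add: card_Un_disjoint)
    have "?A p q \<inter> ?A (Suc p) (Suc q) = ?A p (Suc q)" by auto
    then have 2: "card (?A p q) + card (?A (Suc p) (Suc q)) =
        card (?A p q \<union> ?A (Suc p) (Suc q)) + card (?A p (Suc q))"
      using card_Un_Int[OF f1(2,3)] by simp
    from 1 2 show ?thesis
      using fin(2) pq finX by simp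
  qed
  have "infinite (UNIV :: (nat \<times> 'v) set)" by (simp add: finite_prod)
  then obtain I :: "(nat \<times> 'v) set" and lo hi where dec: "interval_decomposition scale Z I lo hi"
    using interval_decomposition_exists[OF fin_dim_zigzag_axioms] by blast
  have N: "int N = int (R (Suc p) q) - int (R p q) - int (R (Suc p) (Suc q)) + int (R p (Suc q))"
    using main[OF dec] unfolding N_def by linarith
  have "interval_mult scale Z (Suc p) q = enat N"
  proof (rule interval_mult_eqI)
    fix J :: "(nat \<times> 'v) set" and lo' hi'
    assume dec': "interval_decomposition scale Z J lo' hi'"
    show "finite {i \<in> J. lo' i = Suc p \<and> hi' i = q} \<and> card {i \<in> J. lo' i = Suc p \<and> hi' i = q} = N"
      using main[OF dec'] N by linarith
  qed
  then show ?thesis using N by blast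
qed

text \<open>Covers bars that end at the last position, where \<open>interval_mult_rank\<close> has
  no \<open>Suc q\<close> to compare with. The number of all bars through \<open>q\<close> is the
  dimension of the space there, obtained from \<open>card_bars_over\<close> with identity
  maps.\<close>

lemma interval_mult_zero_space:
  assumes "p \<le> q" "q < zlen Z" "zspace Z q = {0}"
  shows "interval_mult scale Z p q = 0"
proof -
  have "interval_mult scale Z p q = enat 0"
  proof (rule interval_mult_eqI)
    fix I :: "(nat \<times> 'v) set" and lo hi
    assume dec: "interval_decomposition scale Z I lo hi"
    have lin: "linear_between scale scale (zspace Z q) UNIV (\<lambda>v. v)" by (simp add: linear_between_def)
    have "finite {i \<in> I. lo i \<le> q \<and> q \<le> hi i} \<and> card {i \<in> I. lo i \<le> q \<and> q \<le> hi i} = dim {0 :: 'v}"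
      using card_bars_over[OF dec order_refl assms(2) lin lin] assms(3) by (auto simp: zrel_refl_iff)
    moreover have "dim {0 :: 'v} = 0" using dim_le_card[of "{0}" "{}"] by simp
    ultimately have "{i \<in> I. lo i \<le> q \<and> q \<le> hi i} = {}" by auto
    then have "{i \<in> I. lo i = p \<and> hi i = q} = {}" using assms(1) by auto
    then show "finite {i \<in> I. lo i = p \<and> hi i = q} \<and> card {i \<in> I. lo i = p \<and> hi i = q} = 0"
      by (metis card.empty finite.emptyI)
  qed
  then show ?thesis by (simp add: zero_enat_def)
qed

end

section \<open>Zigzags of interlevel homology\<close>

text \<open>For \<open>P \<subseteq> P'\<close> and \<open>Q \<subseteq> Q'\<close> of finite
  dimension, this is the dimension of \<open>P' \<inter> Q'\<close> modulo the sum of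
  \<open>P \<inter> Q'\<close> and \<open>P' \<inter> Q\<close>. It is an integer so that sums
  telescope without side conditions.\<close>

definition cross_dim ::
  "('k::field \<Rightarrow> 'v::ab_group_add \<Rightarrow> 'v) \<Rightarrow> 'v set \<Rightarrow> 'v set \<Rightarrow> 'v set \<Rightarrow> 'v set \<Rightarrow> int" where
  "cross_dim sc P' P Q' Q =
     int (vector_space.dim sc (P' \<inter> Q')) - int (vector_space.dim sc (P \<inter> Q'))
     - int (vector_space.dim sc (P' \<inter> Q)) + int (vector_space.dim sc (P \<inter> Q))"

context vector_space
begin

lemma cross_dim_nonneg:
  assumes "finite_dimensional_subspace scale P'" "finite_dimensional_subspace scale Q'"
    "subspace P" "subspace Q" "P \<subseteq> P'" "Q \<subseteq> Q'"
  shows "0 \<le> cross_dim scale P' P Q' Q"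
proof -
  note sub = fin_dim_subspace[OF assms(1)] fin_dim_subspace[OF assms(2)]
  have fd: "finite_dimensional_subspace scale (P' \<inter> Q')" "finite_dimensional_subspace scale (P \<inter> Q')"
    "finite_dimensional_subspace scale (P' \<inter> Q)"
    using assms sub by (auto intro!: fin_dim_mono[OF assms(1)] subspace_inter)
  let ?S = "{x + y | x y. x \<in> P \<inter> Q' \<and> y \<in> P' \<inter> Q}"
  have "?S \<subseteq> P' \<inter> Q'"
    using assms(5,6) sub by (auto intro!: subspace_add)
  then have "dim ?S \<le> dim (P' \<inter> Q')" by (rule dim_mono_fin_dim[OF fd(1)])
  moreover have "(P \<inter> Q') \<inter> (P' \<inter> Q) = P \<inter> Q" using assms(5,6) by blast
  ultimately show ?thesis
    using dim_sums_Int_fin_dim[OF fd(2,3)] by (simp add: cross_dim_def)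
qed

text \<open>\<open>cross_dim\<close> is additive when either chain is refined. Cutting the larger
  chains at \<open>P\<close>, \<open>P'\<close> and then at \<open>Q\<close>, \<open>Q'\<close>
  leaves, besides the smaller term, four terms of the same kind, which are nonnegative.\<close>

lemma cross_dim_mono:
  assumes fd: "finite_dimensional_subspace scale P1'" "finite_dimensional_subspace scale Q1'"
    and sub: "subspace P1" "subspace P" "subspace P'" "subspace Q1" "subspace Q" "subspace Q'"
    and P: "P1 \<subseteq> P" "P \<subseteq> P'" "P' \<subseteq> P1'" and Q: "Q1 \<subseteq> Q" "Q \<subseteq> Q'" "Q' \<subseteq> Q1'"
  shows "cross_dim scale P' P Q' Q \<le> cross_dim scale P1' P1 Q1' Q1"
proof -
  have P': "finite_dimensional_subspace scale P'" "finite_dimensional_subspace scale P"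
    using fin_dim_mono[OF fd(1)] sub P by auto
  have Q': "finite_dimensional_subspace scale Q'" "finite_dimensional_subspace scale Q"
    using fin_dim_mono[OF fd(2)] sub Q by auto
  have "0 \<le> cross_dim scale P1' P' Q1' Q1" "0 \<le> cross_dim scale P P1 Q1' Q1"
    "0 \<le> cross_dim scale P' P Q1' Q'" "0 \<le> cross_dim scale P' P Q Q1"
    using fd sub P Q P' Q' by (auto intro!: cross_dim_nonneg)
  then show ?thesis by (simp add: cross_dim_def)
qed

end

text \<open>
  The following subspaces of the homology of the levelset at \<open>m\<close>, for \<open>x \<le> m\<close>, consist of the classes which
  become homologous to a class at level \<open>x\<close>, respectively to zero, between \<open>x\<close> and \<open>m\<close>.
\<close>

definition reaching :: "(ereal \<Rightarrow> ereal \<Rightarrow> 'v set) \<Rightarrow> (ereal \<Rightarrow> ereal \<Rightarrow> ereal \<Rightarrow> ereal \<Rightarrow> 'v \<Rightarrow> 'v) \<Rightarrow>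
    ereal \<Rightarrow> ereal \<Rightarrow> 'v set" where
  "reaching G \<iota> m x = {y \<in> G m m. \<iota> m m x m y \<in> \<iota> x x x m ` G x x}"

definition dying :: "(ereal \<Rightarrow> ereal \<Rightarrow> 'v::zero set) \<Rightarrow> (ereal \<Rightarrow> ereal \<Rightarrow> ereal \<Rightarrow> ereal \<Rightarrow> 'v \<Rightarrow> 'v) \<Rightarrow>
    ereal \<Rightarrow> ereal \<Rightarrow> 'v set" where
  "dying G \<iota> m x = {y \<in> G m m. \<iota> m m x m y = 0}"

text \<open>What the algebra uses of homology: \<open>G a b\<close> stands for the homology of the
  interlevelset from \<open>a\<close> to \<open>b\<close>, \<open>\<iota> a b c d\<close> for the
  inclusion of \<open>[a,b]\<close> in \<open>[c,d]\<close>, and \<open>mayer_vietoris\<close> for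
  exactness of the sequence at the sum of the two pieces.\<close>

locale level_functor = vector_space scale
  for scale :: "'k::field \<Rightarrow> 'v::ab_group_add \<Rightarrow> 'v" +
  fixes G :: "ereal \<Rightarrow> ereal \<Rightarrow> 'v set"
    and \<iota> :: "ereal \<Rightarrow> ereal \<Rightarrow> ereal \<Rightarrow> ereal \<Rightarrow> 'v \<Rightarrow> 'v"
  assumes fin_dim_G: "a \<le> b \<Longrightarrow> finite_dimensional_subspace scale (G a b)"
    and linear_incl: "c \<le> a \<Longrightarrow> a \<le> b \<Longrightarrow> b \<le> d \<Longrightarrow>
      linear_between scale scale (G a b) (G c d) (\<iota> a b c d)"
    and incl_id: "a \<le> b \<Longrightarrow> x \<in> G a b \<Longrightarrow> \<iota> a b a b x = x"
    and incl_incl: "e \<le> c \<Longrightarrow> c \<le> a \<Longrightarrow> a \<le> b \<Longrightarrow> b \<le> d \<Longrightarrow> d \<le> f \<Longrightarrow> x \<in> G a b \<Longrightarrow>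
      \<iota> c d e f (\<iota> a b c d x) = \<iota> a b e f x"
    and mayer_vietoris: "a \<le> b \<Longrightarrow> b \<le> c \<Longrightarrow> u \<in> G a b \<Longrightarrow> v \<in> G b c \<Longrightarrow> \<iota> a b a c u = \<iota> b c a c v \<Longrightarrow>
      \<exists>z \<in> G b b. \<iota> b b a b z = u \<and> \<iota> b b b c z = v"

text \<open>The functor of \<open>-f\<close>: reflecting the levels turns statements about left
  sides into statements about right sides.\<close>

lemma level_functor_dual:
  assumes "level_functor sc G \<iota>"
  shows "level_functor sc (\<lambda>a b. G (- b) (- a)) (\<lambda>a b c d. \<iota> (- b) (- a) (- d) (- c))"
proof -
  interpret level_functor sc G \<iota> by fact
  show ?thesis
  proof
    fix a b c u v
    assume "a \<le> b" "b \<le> c" "u \<in> G (- b) (- a)" "v \<in> G (- c) (- b)"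
      "\<iota> (- b) (- a) (- c) (- a) u = \<iota> (- c) (- b) (- c) (- a) v"
    then show "\<exists>z\<in>G (- b) (- b). \<iota> (- b) (- b) (- b) (- a) z = u \<and> \<iota> (- b) (- b) (- c) (- b) z = v"
      using mayer_vietoris[of "- c" "- b" "- a" v u] by auto
  qed (simp_all add: fin_dim_G linear_incl incl_id incl_incl)
qed

context level_functor
begin

lemma subspace_G: "a \<le> b \<Longrightarrow> subspace (G a b)"
  using fin_dim_G fin_dim_subspace by blast

lemma incl_mem: "c \<le> a \<Longrightarrow> a \<le> b \<Longrightarrow> b \<le> d \<Longrightarrow> x \<in> G a b \<Longrightarrow> \<iota> a b c d x \<in> G c d"
  using linear_betweenD(1)[OF linear_incl] by blast

lemma incl_zero: "c \<le> a \<Longrightarrow> a \<le> b \<Longrightarrow> b \<le> d \<Longrightarrow> \<iota> a b c d 0 = 0"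
  using linear_between_zero[OF subspace_G vector_space_axioms linear_incl] by blast

lemma zero_mem_G: "a \<le> b \<Longrightarrow> 0 \<in> G a b"
  using subspace_0[OF subspace_G] .

abbreviation "G' \<equiv> \<lambda>a b. G (- b) (- a)"
abbreviation "\<iota>' \<equiv> \<lambda>a b c d. \<iota> (- b) (- a) (- d) (- c)"

text \<open>The right-hand notions are the left-hand ones of the reflected functor, so their lemmas
  are instances; \<open>reachR_eq\<close> and \<open>dieR_eq\<close> give the direct
  descriptions.\<close>

definition "reachR m y = reaching G' \<iota>' (- m) (- y)"
definition "dieR m y = dying G' \<iota>' (- m) (- y)"

abbreviation "reachL \<equiv> reaching G \<iota>"
abbreviation "dieL \<equiv> dying G \<iota>"

lemma reachR_eq: "reachR m y = {z \<in> G m m. \<iota> m m m y z \<in> \<iota> y y m y ` G y y}"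
  by (simp add: reachR_def reaching_def)

lemma dieR_eq: "dieR m y = {z \<in> G m m. \<iota> m m m y z = 0}"
  by (simp add: dieR_def dying_def)

lemma dual: "level_functor scale G' \<iota>'"
  by (rule level_functor_dual) (rule level_functor_axioms)

lemma fin_dim_reachL:
  assumes "x \<le> m"
  shows "finite_dimensional_subspace scale (reachL m x)"
proof (rule fin_dim_mono[OF fin_dim_G[OF order_refl]])
  show "subspace (reachL m x)"
    unfolding reaching_def
    using assms subspace_linear_between_image[OF subspace_G vector_space_axioms linear_incl subspace_G]
    by (intro subspace_linear_between_vimage[OF subspace_G vector_space_axioms linear_incl]) auto
qed (auto simp: reaching_def)

lemma fin_dim_dieL:
  assumes "x \<le> m"
  shows "finite_dimensional_subspace scale (dieL m x)"
proof (rule fin_dim_mono[OF fin_dim_G[OF order_refl]])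
  show "subspace (dieL m x)"
    unfolding dying_def
    using assms by (intro subspace_linear_between_kernel[OF subspace_G vector_space_axioms linear_incl]) auto
qed (auto simp: dying_def)

lemma dieL_antimono:
  assumes "a \<le> b" "b \<le> m"
  shows "dieL m b \<subseteq> dieL m a"
proof
  fix y assume y: "y \<in> dieL m b"
  have "\<iota> m m a m y = \<iota> b m a m (\<iota> m m b m y)"
    using assms y by (intro incl_incl[symmetric]) (auto simp: dying_def)
  then show "y \<in> dieL m a"
    using assms y by (auto simp: dying_def incl_zero)
qed

text \<open>Mayer-Vietoris at \<open>b\<close>: \<open>u\<close> and the image of \<open>y\<close>
  in \<open>G b m\<close> agree in \<open>G a m\<close>, so they come from a common class at level
  \<open>b\<close>. With \<open>u\<close> from level \<open>a\<close> this gives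
  \<open>reachL_mono\<close>, with \<open>u = 0\<close> it gives
  \<open>dieL_subset_reachL\<close>.\<close>

lemma reachL_iff:
  assumes "a \<le> b" "b \<le> m" "y \<in> G m m" "u \<in> G a b" "\<iota> m m a m y = \<iota> a b a m u"
  shows "y \<in> reachL m b"
proof -
  have "\<iota> a b a m u = \<iota> b m a m (\<iota> m m b m y)"
    using assms by (simp add: incl_incl)
  then obtain z where "z \<in> G b b" "\<iota> b b b m z = \<iota> m m b m y"
    using mayer_vietoris[OF assms(1,2,4) incl_mem[OF assms(2) order_refl order_refl assms(3)]] by blast
  then show ?thesis using assms(3) by (auto simp: reaching_def image_iff intro!: bexI[of _ z])
qed

lemma reachL_mono:
  assumes "a \<le> b" "b \<le> m"
  shows "reachL m a \<subseteq> reachL m b"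
proof
  fix y assume y: "y \<in> reachL m a"
  then obtain z where z: "z \<in> G a a" "\<iota> m m a m y = \<iota> a a a m z" "y \<in> G m m"
    by (auto simp: reaching_def)
  have "\<iota> a a a m z = \<iota> a b a m (\<iota> a a a b z)"
    using assms z by (simp add: incl_incl)
  then show "y \<in> reachL m b"
    using assms z incl_mem[of a a a b z] by (intro reachL_iff[of a b m y "\<iota> a a a b z"]) auto
qed

lemma dieL_subset_reachL:
  assumes "a \<le> b" "b \<le> m"
  shows "dieL m a \<subseteq> reachL m b"
proof
  fix y assume "y \<in> dieL m a"
  then show "y \<in> reachL m b"
    using assms zero_mem_G[OF assms(1)] by (intro reachL_iff[of a b m y 0]) (auto simp: dying_def incl_zero)
qed

lemmas fin_dim_reachR = level_functor.fin_dim_reachL[OF dual, of "- y" "- m", folded reachR_def, simplified] for y m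
lemmas fin_dim_dieR = level_functor.fin_dim_dieL[OF dual, of "- y" "- m", folded dieR_def, simplified] for y m
lemmas dieR_mono = level_functor.dieL_antimono[OF dual, of "- d" "- c" "- m", folded dieR_def, simplified] for c d m
lemmas reachR_antimono = level_functor.reachL_mono[OF dual, of "- d" "- c" "- m", folded reachR_def, simplified] for c d m
lemmas dieR_subset_reachR =
  level_functor.dieL_subset_reachL[OF dual, of "- d" "- c" "- m", folded dieR_def reachR_def, simplified] for c d m

definition level_rank :: "ereal \<Rightarrow> ereal \<Rightarrow> ereal \<Rightarrow> ereal \<Rightarrow> nat" where
  "level_rank a b c d = dim (\<iota> a b a d ` G a b \<inter> \<iota> c d a d ` G c d)"

text \<open>The levelset at \<open>m\<close> maps \<open>reachL m b \<inter> reachR m c\<close> onto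
  the intersection in \<open>level_rank\<close>. The kernel is the sum of the classes there that die
  to the left and those that die to the right; rank-nullity gives the formula.\<close>

lemma level_rank_eq:
  assumes ab: "a \<le> b" and bm: "b \<le> m" and mc: "m \<le> c" and cd: "c \<le> d"
  shows "int (level_rank a b c d) = cross_dim scale (reachL m b) (dieL m a) (reachR m c) (dieR m d)"
proof -
  have am: "a \<le> m" and md: "m \<le> d" and bc: "b \<le> c" and ad: "a \<le> d" and bd: "b \<le> d" and ac: "a \<le> c"
    using assms by auto
  let ?J = "\<iota> m m a d"
  let ?V = "reachL m b \<inter> reachR m c"
  have fV: "finite_dimensional_subspace scale ?V"
    using fin_dim_mono[OF fin_dim_reachL[OF bm]] fin_dim_subspace[OF fin_dim_reachL[OF bm]]
      fin_dim_subspace[OF fin_dim_reachR[OF mc]] by (simp add: subspace_inter)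
  have VG: "?V \<subseteq> G m m" by (auto simp: reaching_def)
  have linJ: "linear_between scale scale ?V UNIV ?J"
    using linear_incl[OF am order_refl md] VG unfolding linear_between_def by blast
  have img: "?J ` ?V = \<iota> a b a d ` G a b \<inter> \<iota> c d a d ` G c d"
  proof (intro equalityI subsetI)
    fix w assume "w \<in> ?J ` ?V"
    then obtain y where y: "y \<in> reachL m b" "y \<in> reachR m c" "w = ?J y" by blast
    have yG: "y \<in> G m m" using y(1) by (simp add: reaching_def)
    obtain z where z: "z \<in> G b b" "\<iota> m m b m y = \<iota> b b b m z" using y(1) by (auto simp: reaching_def)
    obtain z' where z': "z' \<in> G c c" "\<iota> m m m c y = \<iota> c c m c z'" using y(2) by (auto simp: reachR_eq)
    have "w = \<iota> b m a d (\<iota> m m b m y)" using incl_incl[OF ab bm order_refl order_refl md yG] y(3) by simp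
    also have "\<dots> = \<iota> b b a d z" using z incl_incl[OF ab order_refl order_refl bm md z(1)] by simp
    also have "\<dots> = \<iota> a b a d (\<iota> b b a b z)" using incl_incl[OF order_refl ab order_refl order_refl bd z(1)] by simp
    finally have 1: "w \<in> \<iota> a b a d ` G a b" using incl_mem[OF ab order_refl order_refl z(1)] by blast
    have "w = \<iota> m c a d (\<iota> m m m c y)" using incl_incl[OF am order_refl order_refl mc cd yG] y(3) by simp
    also have "\<dots> = \<iota> c c a d z'" using z' incl_incl[OF am mc order_refl order_refl cd z'(1)] by simp
    also have "\<dots> = \<iota> c d a d (\<iota> c c c d z')" using incl_incl[OF ac order_refl order_refl cd order_refl z'(1)] by simp
    finally have "w \<in> \<iota> c d a d ` G c d" using incl_mem[OF order_refl order_refl cd z'(1)] by blast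
    with 1 show "w \<in> \<iota> a b a d ` G a b \<inter> \<iota> c d a d ` G c d" by blast
  next
    fix w assume w: "w \<in> \<iota> a b a d ` G a b \<inter> \<iota> c d a d ` G c d"
    obtain u where u: "u \<in> G a b" "w = \<iota> a b a d u" using w by blast
    obtain v where v: "v \<in> G c d" "w = \<iota> c d a d v" using w by blast
    let ?u = "\<iota> a b a m u" and ?v = "\<iota> c d m d v"
    have uG: "?u \<in> G a m" using incl_mem[OF order_refl ab bm u(1)] .
    have vG: "?v \<in> G m d" using incl_mem[OF mc cd order_refl v(1)] .
    have "\<iota> a m a d ?u = \<iota> m d a d ?v"
      using incl_incl[OF order_refl order_refl ab bm md u(1)] incl_incl[OF am mc cd order_refl order_refl v(1)] u(2) v(2) by simp
    \<comment> \<open>Mayer-Vietoris at \<open>m\<close>: the two preimages agree between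
      \<open>a\<close> and \<open>d\<close>, so both come from the levelset at
      \<open>m\<close>.\<close>
    then obtain y where y: "y \<in> G m m" "\<iota> m m a m y = ?u" "\<iota> m m m d y = ?v"
      using mayer_vietoris[OF am md uG vG] by blast
    have "y \<in> reachL m b" using reachL_iff[OF ab bm y(1) u(1) y(2)] .
    moreover have "y \<in> reachR m c"
      unfolding reachR_def using mc cd y v
      by (intro level_functor.reachL_iff[OF dual, of "- d" "- c" "- m" y v]) auto
    moreover have "?J y = w"
      using incl_incl[OF order_refl am order_refl order_refl md y(1)] incl_incl[OF order_refl order_refl ab bm md u(1)] y(2) u(2) by simp
    ultimately show "w \<in> ?J ` ?V" by blast
  qed
  let ?S = "dieL m a \<inter> reachR m c" and ?T = "reachL m b \<inter> dieR m d"
  note sD = dieL_subset_reachL[OF ab bm] dieR_subset_reachR[OF cd mc]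
  have ker: "{y \<in> ?V. ?J y = 0} = {x + y | x y. x \<in> ?S \<and> y \<in> ?T}"
  proof (intro equalityI subsetI)
    fix y assume y: "y \<in> {y \<in> ?V. ?J y = 0}"
    then have yG: "y \<in> G m m" and J0: "?J y = 0" using VG by auto
    \<comment> \<open>Mayer-Vietoris for \<open>y\<close> on the left and 0 on the right splits
      \<open>y\<close> into \<open>y - z\<close>, which dies by \<open>a\<close>, and
      \<open>z\<close>, which dies by \<open>d\<close>.\<close>
    have "\<iota> a m a d (\<iota> m m a m y) = \<iota> m d a d 0"
      using incl_incl[OF order_refl am order_refl order_refl md yG] J0 incl_zero[OF am md order_refl] by simp
    then obtain z where z: "z \<in> G m m" "\<iota> m m a m z = \<iota> m m a m y" "\<iota> m m m d z = 0"
      using mayer_vietoris[OF am md incl_mem[OF am order_refl order_refl yG] zero_mem_G[OF md]] by blast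
    have "\<iota> m m a m (y - z) = 0"
      using linear_between_diff[OF subspace_G vector_space_axioms linear_incl[OF am order_refl order_refl] yG z(1)] z(2)
      by simp
    then have d1: "y - z \<in> dieL m a"
      using subspace_diff[OF subspace_G yG z(1)] by (simp add: dying_def)
    have d2: "z \<in> dieR m d" using z by (simp add: dieR_eq)
    have "y - z \<in> reachR m c"
      using y d2 sD(2) by (intro subspace_diff fin_dim_subspace[OF fin_dim_reachR[OF mc]]) auto
    moreover have "z \<in> reachL m b"
      using subspace_diff[OF fin_dim_subspace[OF fin_dim_reachL[OF bm]], of y "y - z"] y d1 sD(1) by auto
    ultimately have "y - z \<in> ?S" "z \<in> ?T" using d1 d2 by auto
    then show "y \<in> {x + y | x y. x \<in> ?S \<and> y \<in> ?T}"
      by (intro CollectI exI[of _ "y - z"] exI[of _ z]) auto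
  next
    fix w assume "w \<in> {x + y | x y. x \<in> ?S \<and> y \<in> ?T}"
    then obtain x y where xy: "w = x + y" "x \<in> ?S" "y \<in> ?T" by blast
    have x: "x \<in> ?V" and y: "y \<in> ?V" using xy(2,3) sD by auto
    have "?J x = \<iota> a m a d (\<iota> m m a m x)" "?J y = \<iota> m d a d (\<iota> m m m d y)"
      using incl_incl[OF order_refl am order_refl order_refl md, of x]
        incl_incl[OF am order_refl order_refl md order_refl, of y] x y VG by auto
    then have "?J x = 0" "?J y = 0"
      using xy(2,3) incl_zero[OF order_refl am md] incl_zero[OF am md order_refl] by (auto simp: dying_def dieR_eq)
    then show "w \<in> {y \<in> ?V. ?J y = 0}"
      using xy(1) linear_betweenD(2)[OF linJ x y] subspace_add[OF fin_dim_subspace[OF fV] x y] by simp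
  qed
  have fS: "finite_dimensional_subspace scale ?S" "finite_dimensional_subspace scale ?T"
    using fin_dim_mono[OF fV] sD fin_dim_subspace[OF fin_dim_dieL[OF am]] fin_dim_subspace[OF fin_dim_dieR[OF md]]
      fin_dim_subspace[OF fin_dim_reachR[OF mc]] fin_dim_subspace[OF fin_dim_reachL[OF bm]]
    by (auto intro!: subspace_inter fin_dim_mono[OF fV])
  have "?S \<inter> ?T = dieL m a \<inter> dieR m d" using sD by blast
  then have "dim ?V = level_rank a b c d + dim {x + y | x y. x \<in> ?S \<and> y \<in> ?T}"
    "dim {x + y | x y. x \<in> ?S \<and> y \<in> ?T} + dim (dieL m a \<inter> dieR m d) = dim ?S + dim ?T"
    using rank_nullity[OF fV linJ] dim_sums_Int_fin_dim[OF fS] ker img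
    by (simp_all add: level_rank_def)
  then show ?thesis by (simp add: cross_dim_def)
qed

section \<open>Zigzags on lists of levels and their multiplicities\<close>

definition level_zigzag :: "ereal list \<Rightarrow> 'v zigzag" where
  "level_zigzag s =
     \<lparr>zlen = 2 * length s - 1, zfwd = even,
      zspace = (\<lambda>j. G (s ! (j div 2)) (s ! (Suc j div 2))),
      zmap = (\<lambda>j. if even j
                   then \<iota> (s ! (j div 2)) (s ! (Suc j div 2)) (s ! (Suc j div 2)) (s ! (Suc (Suc j) div 2))
                   else \<iota> (s ! (Suc j div 2)) (s ! (Suc (Suc j) div 2)) (s ! (j div 2)) (s ! (Suc j div 2)))\<rparr>"

lemma fin_dim_level_zigzag:
  assumes "sorted s"
  shows "fin_dim_zigzag scale (level_zigzag s)"
proof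
  have le: "s ! (i div 2) \<le> s ! (j div 2)" if "i \<le> j" "j < 2 * length s" for i j
    using that by (intro sorted_nth_mono[OF assms]) auto
  show "finite_dimensional_subspace scale (zspace (level_zigzag s) j)"
    if "j < zlen (level_zigzag s)" for j
    using that by (auto simp: level_zigzag_def intro!: fin_dim_G le)
  show "linear_between scale scale (zspace (level_zigzag s) j) (zspace (level_zigzag s) (Suc j))
      (zmap (level_zigzag s) j)" if "Suc j < zlen (level_zigzag s)" "zfwd (level_zigzag s) j" for j
    using that sorted_nth_mono[OF assms] by (auto simp: level_zigzag_def elim!: evenE intro!: linear_incl)
  show "linear_between scale scale (zspace (level_zigzag s) (Suc j)) (zspace (level_zigzag s) j)
      (zmap (level_zigzag s) j)" if "Suc j < zlen (level_zigzag s)" "\<not> zfwd (level_zigzag s) j" for j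
    using that sorted_nth_mono[OF assms] by (auto simp: level_zigzag_def elim!: oddE intro!: linear_incl)
qed

text \<open>
  By exactness of the squares, relations between positions \<open>p\<close> and \<open>q\<close> of the zigzag are computed in the
  interlevelset spanned by them.
\<close>

lemma zrel_level_zigzag:
  assumes s: "sorted s" and "p \<le> q" "q < 2 * length s - 1"
    and u: "u \<in> G (s ! (p div 2)) (s ! (Suc p div 2))" and "v \<in> G (s ! (q div 2)) (s ! (Suc q div 2))"
  shows "zrel (level_zigzag s) p u q v \<longleftrightarrow>
    \<iota> (s ! (p div 2)) (s ! (Suc p div 2)) (s ! (p div 2)) (s ! (Suc q div 2)) u =
    \<iota> (s ! (q div 2)) (s ! (Suc q div 2)) (s ! (p div 2)) (s ! (Suc q div 2)) v"
  using assms(2,3,5)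
proof (induction q arbitrary: v rule: nat_induct_at_least)
  case base
  have "s ! (p div 2) \<le> s ! (Suc p div 2)"
    using base by (intro sorted_nth_mono[OF s]) auto
  then show ?case
    using u base(2) by (auto simp: zrel_refl_iff incl_id) (simp add: level_zigzag_def)
next
  case (Suc q)
  let ?a = "s ! (p div 2)" and ?h = "s ! (Suc p div 2)"
  have le: "s ! (i div 2) \<le> s ! (j div 2)" if "i \<le> j" "j < 2 * length s" for i j
    using that by (intro sorted_nth_mono[OF s]) auto
  have q: "q < 2 * length s - 1" and pq: "p \<le> q" using Suc by auto
  let ?V = "G (s ! (q div 2)) (s ! (Suc q div 2))"
  have ah: "?a \<le> ?h" using pq q by (intro le) auto
  have IH: "zrel (level_zigzag s) p u q w \<longleftrightarrow>
      w \<in> ?V \<and> \<iota> ?a ?h ?a (s ! (Suc q div 2)) u = \<iota> (s ! (q div 2)) (s ! (Suc q div 2)) ?a (s ! (Suc q div 2)) w" for w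
    using Suc.IH[OF q, of w] zrel_mem[of "level_zigzag s" p u q w] by (auto simp: level_zigzag_def)
  have zs: "zspace (level_zigzag s) (Suc q) = G (s ! (Suc q div 2)) (s ! (Suc (Suc q) div 2))"
    by (simp add: level_zigzag_def)
  have unf: "zrel (level_zigzag s) p u (Suc q) v \<longleftrightarrow>
      (\<exists>w. zrel (level_zigzag s) p u q w \<and> zstep (level_zigzag s) q w v)"
    unfolding zrel_Suc_iff[OF pq] zs using Suc.prems(2) by blast
  show ?case
  proof (cases "even q")
    case True
    then obtain i where i: "q = 2 * i" by (elim evenE)
    let ?b = "s ! i" and ?c = "s ! Suc i"
    have bc: "?b \<le> ?c" using le[of "2 * i" "2 * Suc i"] Suc.prems i by simp
    have hb: "?h \<le> ?b" using le[of "Suc p" "Suc q"] pq q i by simp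
    have ab: "?a \<le> ?b" and ac: "?a \<le> ?c" and hc: "?h \<le> ?c" using ah hb bc by auto
    have v: "v \<in> G ?b ?c" using Suc.prems(2) i by simp
    have step: "zstep (level_zigzag s) q w v \<longleftrightarrow> v = \<iota> ?b ?b ?b ?c w" for w
      using i by (simp add: zstep_def level_zigzag_def)
    have uc: "\<iota> ?a ?b ?a ?c (\<iota> ?a ?h ?a ?b u) = \<iota> ?a ?h ?a ?c u"
      using incl_incl[OF order_refl order_refl ah hb bc u] .
    \<comment> \<open>A forward step asks for a common preimage \<open>w\<close> at level
      \<open>?b\<close>; Mayer-Vietoris provides it when the two classes agree between
      \<open>?a\<close> and \<open>?c\<close>.\<close>
    have "(\<exists>w\<in>G ?b ?b. \<iota> ?a ?h ?a ?b u = \<iota> ?b ?b ?a ?b w \<and> v = \<iota> ?b ?b ?b ?c w) \<longleftrightarrow>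
        \<iota> ?a ?h ?a ?c u = \<iota> ?b ?c ?a ?c v"
    proof
      assume "\<exists>w\<in>G ?b ?b. \<iota> ?a ?h ?a ?b u = \<iota> ?b ?b ?a ?b w \<and> v = \<iota> ?b ?b ?b ?c w"
      then obtain w where w: "w \<in> G ?b ?b" "\<iota> ?a ?h ?a ?b u = \<iota> ?b ?b ?a ?b w" "v = \<iota> ?b ?b ?b ?c w" by blast
      have "\<iota> ?a ?b ?a ?c (\<iota> ?b ?b ?a ?b w) = \<iota> ?b ?b ?a ?c w"
        using incl_incl[OF order_refl ab order_refl order_refl bc w(1)] .
      moreover have "\<iota> ?b ?c ?a ?c (\<iota> ?b ?b ?b ?c w) = \<iota> ?b ?b ?a ?c w"
        using incl_incl[OF ab order_refl order_refl bc order_refl w(1)] .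
      ultimately show "\<iota> ?a ?h ?a ?c u = \<iota> ?b ?c ?a ?c v" using uc w by simp
    next
      assume "\<iota> ?a ?h ?a ?c u = \<iota> ?b ?c ?a ?c v"
      then have "\<iota> ?a ?b ?a ?c (\<iota> ?a ?h ?a ?b u) = \<iota> ?b ?c ?a ?c v" using uc by simp
      from mayer_vietoris[OF ab bc incl_mem[OF order_refl ah hb u] v this]
      obtain z where "z \<in> G ?b ?b" "\<iota> ?b ?b ?a ?b z = \<iota> ?a ?h ?a ?b u" "\<iota> ?b ?b ?b ?c z = v"
        by blast
      then show "\<exists>w\<in>G ?b ?b. \<iota> ?a ?h ?a ?b u = \<iota> ?b ?b ?a ?b w \<and> v = \<iota> ?b ?b ?b ?c w"
        by (intro bexI[of _ z]) simp_all
    qed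
    then show ?thesis unfolding unf IH step using i by (simp add: Bex_def conj_assoc)
  next
    case False
    then obtain i where i: "q = 2 * i + 1" by (elim oddE)
    let ?b = "s ! i" and ?c = "s ! Suc i"
    have bc: "?b \<le> ?c" using le[of "2 * i" "2 * Suc i"] Suc.prems i by simp
    have ab: "?a \<le> ?b" using le[of p q] pq q i by simp
    have v: "v \<in> G ?c ?c" using Suc.prems(2) i by simp
    have step: "zstep (level_zigzag s) q w v \<longleftrightarrow> w = \<iota> ?c ?c ?b ?c v" for w
      using i by (simp add: zstep_def level_zigzag_def)
    \<comment> \<open>A backward step determines \<open>w\<close> from \<open>v\<close>;
      functoriality suffices.\<close>
    show ?thesis
      unfolding unf IH step
      using i incl_incl[OF ab bc order_refl order_refl order_refl v] incl_mem[OF bc order_refl order_refl v]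
      by simp
  qed
qed

text \<open>A bar with a slash on the left is carried by classes that die between \<open>a\<close>
  and \<open>m\<close> but not between \<open>b\<close> and \<open>m\<close>; with a backslash, by
  classes that reach \<open>b\<close> but not \<open>a\<close>. \<open>right_pair\<close> is the
  mirror image, which also exchanges the two symbols.\<close>

definition left_pair :: "bool \<Rightarrow> ereal \<Rightarrow> ereal \<Rightarrow> ereal \<Rightarrow> 'v set \<times> 'v set" where
  "left_pair sl m a b = (if sl then (dieL m a, dieL m b) else (reachL m b, reachL m a))"

definition right_pair :: "bool \<Rightarrow> ereal \<Rightarrow> ereal \<Rightarrow> ereal \<Rightarrow> 'v set \<times> 'v set" where
  "right_pair sl m c d = (if sl then (reachR m c, reachR m d) else (dieR m d, dieR m c))"

text \<open>
  The measure of \<open>[a,b] \<times> [c,d]\<close>, computed at an intermediate level \<open>m\<close>. The flags \<open>sl\<close> and \<open>sr\<close> tell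
  whether the left and right symbols are slashes rather than backslashes.
\<close>

definition rect_mult :: "bool \<Rightarrow> bool \<Rightarrow> ereal \<Rightarrow> ereal \<Rightarrow> ereal \<Rightarrow> ereal \<Rightarrow> ereal \<Rightarrow> int" where
  "rect_mult sl sr m a b c d =
     cross_dim scale (fst (left_pair sl m a b)) (snd (left_pair sl m a b))
       (fst (right_pair sr m c d)) (snd (right_pair sr m c d))"

text \<open>By \<open>level_rank_eq\<close>, moving one end by one position changes only one of the
  two subspaces on that side, so the alternating sum of four ranks telescopes to one
  \<open>cross_dim\<close>. The multiplicity does not mention \<open>m\<close>, so all admissible
  \<open>m\<close> give the same value.\<close>

theorem interval_mult_level_zigzag:
  assumes s: "sorted s" and ij: "1 \<le> i" "i \<le> j" "Suc j < length s"
    and m: "s ! i \<le> m" "m \<le> s ! j"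
  shows "\<exists>N. interval_mult scale (level_zigzag s) (if sl then 2 * i else 2 * i - 1) (if sr then 2 * j + 1 else 2 * j) = enat N
    \<and> int N = rect_mult sl sr m (s ! (i - 1)) (s ! i) (s ! j) (s ! Suc j)"
proof -
  interpret zz: fin_dim_zigzag scale "level_zigzag s" by (rule fin_dim_level_zigzag[OF s])
  let ?R = "\<lambda>p q. level_rank (s ! (p div 2)) (s ! (Suc p div 2)) (s ! (q div 2)) (s ! (Suc q div 2))"
  have R: "finite {k \<in> I. lo k \<le> p \<and> q \<le> hi k} \<and> card {k \<in> I. lo k \<le> p \<and> q \<le> hi k} = ?R p q"
    if dec: "interval_decomposition scale (level_zigzag s) I lo hi" and pq: "p \<le> q" "q < zlen (level_zigzag s)"
    for I :: "(nat \<times> 'v) set" and lo hi p q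
  proof -
    have le: "s ! (i div 2) \<le> s ! (j div 2)" if "i \<le> j" "j < 2 * length s" for i j
      using that by (intro sorted_nth_mono[OF s]) auto
    let ?\<Phi> = "\<iota> (s ! (p div 2)) (s ! (Suc p div 2)) (s ! (p div 2)) (s ! (Suc q div 2))"
    let ?\<Psi> = "\<iota> (s ! (q div 2)) (s ! (Suc q div 2)) (s ! (p div 2)) (s ! (Suc q div 2))"
    have len: "q < 2 * length s - 1" using pq(2) by (simp add: level_zigzag_def)
    have lin: "linear_between scale scale (zspace (level_zigzag s) p) UNIV ?\<Phi>"
      "linear_between scale scale (zspace (level_zigzag s) q) UNIV ?\<Psi>"
      using linear_incl[of "s ! (p div 2)" "s ! (p div 2)" "s ! (Suc p div 2)" "s ! (Suc q div 2)"]
        linear_incl[of "s ! (p div 2)" "s ! (q div 2)" "s ! (Suc q div 2)" "s ! (Suc q div 2)"] pq(1) len le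
      by (auto simp: linear_between_def level_zigzag_def)
    show ?thesis
      unfolding level_rank_def
      using zz.card_bars_over[OF dec pq lin] zrel_level_zigzag[OF s pq(1) len] by (simp add: level_zigzag_def)
  qed
  define p where "p = (if sl then 2 * i else 2 * i - 1) - 1"
  define q where "q = (if sr then 2 * j + 1 else 2 * j)"
  have p: "(if sl then 2 * i else 2 * i - 1) = Suc p" using ij by (auto simp: p_def)
  have pq: "Suc p \<le> q" "Suc q < zlen (level_zigzag s)"
    using ij by (auto simp: p_def q_def level_zigzag_def)
  obtain N where N: "interval_mult scale (level_zigzag s) (Suc p) q = enat N"
    "int N = int (?R (Suc p) q) - int (?R p q) - int (?R (Suc p) (Suc q)) + int (?R p (Suc q))"
    using zz.interval_mult_rank[of ?R p q, OF R pq] by blast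
  obtain k where k: "i = Suc k" using ij by (cases i) auto
  let ?a = "s ! k" and ?b = "s ! Suc k" and ?c = "s ! j" and ?d = "s ! Suc j"
  have ab: "?a \<le> ?b" and cd: "?c \<le> ?d" using ij k by (auto intro!: sorted_nth_mono[OF s])
  have bm: "?b \<le> m" and mc: "m \<le> ?c" and am: "?a \<le> m" and md: "m \<le> ?d" using m k ab cd by auto
  \<comment> \<open>Three left ends \<open>(a,a)\<close>, \<open>(a,b)\<close>, \<open>(b,b)\<close>
    and three right ends \<open>(c,c)\<close>, \<open>(c,d)\<close>, \<open>(d,d)\<close> occur over
    the four choices of flags.\<close>
  note rk = level_rank_eq[OF order_refl am mc order_refl] level_rank_eq[OF ab bm mc order_refl]
    level_rank_eq[OF order_refl bm mc order_refl] level_rank_eq[OF order_refl am mc cd]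
    level_rank_eq[OF ab bm mc cd] level_rank_eq[OF order_refl bm mc cd]
    level_rank_eq[OF order_refl am md order_refl] level_rank_eq[OF ab bm md order_refl]
    level_rank_eq[OF order_refl bm md order_refl]
  have "int N = rect_mult sl sr m ?a ?b ?c ?d"
    unfolding N(2) rect_mult_def left_pair_def right_pair_def p_def q_def k
    by (cases sl; cases sr) (simp_all add: rk cross_dim_def)
  then show ?thesis using N(1) by (auto simp: p q_def k)
qed

lemma rect_mult_cong:
  assumes "left_pair sl m a b = left_pair sl m a' b'" "right_pair sr m c d = right_pair sr m c' d'"
  shows "rect_mult sl sr m a b c d = rect_mult sl sr m a' b' c' d'"
  using assms by (simp add: rect_mult_def)

text \<open>The dying subspaces shrink and the reaching ones grow as a level approaches
  \<open>m\<close>, so a larger rectangle has the wider chain on each side.\<close>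

lemma rect_mult_mono:
  assumes "a \<le> a'" "a' \<le> b'" "b' \<le> b" "b \<le> m" "m \<le> c" "c \<le> c'" "c' \<le> d'" "d' \<le> d"
  shows "rect_mult sl sr m a' b' c' d' \<le> rect_mult sl sr m a b c d"
proof -
  have fd: "finite_dimensional_subspace scale (reachL m x)" "finite_dimensional_subspace scale (dieL m x)"
    if "x \<le> b" for x
    using that assms fin_dim_reachL fin_dim_dieL by auto
  have fd': "finite_dimensional_subspace scale (reachR m x)" "finite_dimensional_subspace scale (dieR m x)"
    if "c \<le> x" for x
    using that assms fin_dim_reachR fin_dim_dieR by auto
  note sub = fd[THEN fin_dim_subspace] fd'[THEN fin_dim_subspace]
  have le: "a \<le> b" "a' \<le> b" "a' \<le> m" "b' \<le> m" "c \<le> d" "c \<le> d'" "m \<le> c'" "m \<le> d'" using assms by auto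
  have l: "dieL m b \<subseteq> dieL m b'" "dieL m b' \<subseteq> dieL m a'" "dieL m a' \<subseteq> dieL m a"
    "reachL m a \<subseteq> reachL m a'" "reachL m a' \<subseteq> reachL m b'" "reachL m b' \<subseteq> reachL m b"
    by (simp_all add: dieL_antimono reachL_mono assms le)
  have r: "dieR m c \<subseteq> dieR m c'" "dieR m c' \<subseteq> dieR m d'" "dieR m d' \<subseteq> dieR m d"
    "reachR m d \<subseteq> reachR m d'" "reachR m d' \<subseteq> reachR m c'" "reachR m c' \<subseteq> reachR m c"
    by (simp_all add: dieR_mono reachR_antimono assms le)
  show ?thesis
    unfolding rect_mult_def left_pair_def right_pair_def
    by (cases sl; cases sr) (simp_all, (rule cross_dim_mono; simp add: fd fd' sub assms le l r)+)
qed

lemma rect_mult_eq_zero: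
  assumes "fst (left_pair sl m a b) = snd (left_pair sl m a b) \<or> fst (right_pair sr m c d) = snd (right_pair sr m c d)"
  shows "rect_mult sl sr m a b c d = 0"
  using assms by (auto simp: rect_mult_def cross_dim_def)

lemma dieL_eq:
  assumes "a \<le> b" "b \<le> m" "inj_on (\<iota> b m a m) (G b m)"
  shows "dieL m a = dieL m b"
proof
  show "dieL m a \<subseteq> dieL m b"
  proof
    fix y assume y: "y \<in> dieL m a"
    then have yG: "y \<in> G m m" "\<iota> m m a m y = 0" by (auto simp: dying_def)
    have "\<iota> b m a m (\<iota> m m b m y) = \<iota> b m a m 0"
      using incl_incl[OF assms(1,2) order_refl order_refl order_refl yG(1)] yG(2) incl_zero[OF assms(1,2) order_refl] by simp
    then have "\<iota> m m b m y = 0"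
      by (rule inj_onD[OF assms(3) _ incl_mem[OF assms(2) order_refl order_refl yG(1)] zero_mem_G[OF assms(2)]])
    then show "y \<in> dieL m b" using yG by (simp add: dying_def)
  qed
qed (use assms dieL_antimono in auto)

lemma reachL_eq:
  assumes "a \<le> b" "b \<le> m" "G a b \<subseteq> \<iota> a a a b ` G a a"
  shows "reachL m a = reachL m b"
proof
  show "reachL m b \<subseteq> reachL m a"
  proof
    fix y assume "y \<in> reachL m b"
    then obtain z where y: "y \<in> G m m" and z: "z \<in> G b b" "\<iota> m m b m y = \<iota> b b b m z"
      by (auto simp: reaching_def)
    have "\<iota> b b a b z \<in> G a b" using incl_mem[OF assms(1) order_refl order_refl z(1)] .
    then obtain w where w: "w \<in> G a a" "\<iota> b b a b z = \<iota> a a a b w" using assms(3) by blast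
    have "\<iota> m m a m y = \<iota> b m a m (\<iota> m m b m y)"
      using incl_incl[OF assms(1,2) order_refl order_refl order_refl y] by simp
    also have "\<dots> = \<iota> b b a m z"
      using incl_incl[OF assms(1) order_refl order_refl assms(2) order_refl z(1)] z(2) by simp
    also have "\<dots> = \<iota> a b a m (\<iota> b b a b z)"
      using incl_incl[OF order_refl assms(1) order_refl order_refl assms(2) z(1)] by simp
    also have "\<dots> = \<iota> a a a m w"
      using incl_incl[OF order_refl order_refl order_refl assms(1,2) w(1)] w(2) by simp
    finally show "y \<in> reachL m a" using w(1) y by (auto simp: reaching_def)
  qed
qed (use assms reachL_mono in auto)

lemmas dieR_eq_dieR = level_functor.dieL_eq[OF dual, of "- d" "- c" "- m", folded dieR_def, simplified] for c d m
lemmas reachR_eq_reachR = level_functor.reachL_eq[OF dual, of "- d" "- c" "- m", folded reachR_def, simplified] for c d m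

end

section \<open>Homology of spaces of Morse type\<close>

text \<open>Writes both kinds of pieces as a base times a set of levels, so that the deformation can
  be defined and checked once for all of them.\<close>

lemma morse_pieces_eq:
  "morse_pieces n a V E = sum_topology
     (\<lambda>j. prod_topology (case_sum V E j) (top_of_set (case_sum (\<lambda>i. {a i}) (\<lambda>i. {a i..a (Suc i)}) j)))
     ({1..n} <+> {1..<n})"
proof -
  have "case_sum (\<lambda>i. prod_topology (V i) (top_of_set {a i}))
      (\<lambda>i. prod_topology (E i) (top_of_set {a i..a (Suc i)})) =
    (\<lambda>j. prod_topology (case_sum V E j) (top_of_set (case_sum (\<lambda>i. {a i}) (\<lambda>i. {a i..a (Suc i)}) j)))"
    by (rule ext) (simp split: sum.split)
  then show ?thesis by (simp add: morse_pieces_def)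
qed

lemma continuous_map_snd_sum_component:
  "continuous_map (subtopology (sum_topology X I) ({i} \<times> UNIV)) (X i) snd"
proof -
  have "openin (subtopology (sum_topology X I) ({i} \<times> UNIV))
      {z \<in> topspace (subtopology (sum_topology X I) ({i} \<times> UNIV)). snd z \<in> W}" if W: "openin (X i) W" for W
  proof (cases "i \<in> I")
    case True
    have "{z \<in> topspace (subtopology (sum_topology X I) ({i} \<times> UNIV)). snd z \<in> W} = ({i} \<times> W) \<inter> ({i} \<times> UNIV)"
      using True openin_subset[OF W] by auto
    moreover have "openin (sum_topology X I) ({i} \<times> W)"
    proof -
      have "openin (sum_topology X I) (Pair i ` W)"
        using open_map_component_injection[OF True, of X] W unfolding open_map_def by blast
      moreover have "Pair i ` W = {i} \<times> W" by auto
      ultimately show ?thesis by simp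
    qed
    ultimately show ?thesis unfolding openin_subtopology by blast
  next
    case False
    then have "topspace (subtopology (sum_topology X I) ({i} \<times> UNIV)) = {}" by auto
    then show ?thesis by simp
  qed
  then show ?thesis unfolding continuous_map_def by auto
qed

text \<open>Each elementary gluing preserves the level, which is a critical value. Equality of
  levels is carried through the induction to keep the second fact along a chain.\<close>

lemma equivclp_morse_glueD:
  assumes "equivclp (morse_glue n a E l r) u v"
  shows "u = v \<or> snd (snd u) \<in> a ` {1..n}"
proof -
  have "snd (snd u) = snd (snd v) \<and> (u = v \<or> snd (snd u) \<in> a ` {1..n})"
    using assms
  proof (induction rule: equivclp_induct)
    case (step y z)
    then show ?case by (auto simp: morse_glue_def)
  qed simp
  then show ?thesis by blast
qed

lemma topspace_interlevelset:
  "topspace (interlevelset X f b c) = {x \<in> topspace X. b \<le> ereal (f x) \<and> ereal (f x) \<le> c}"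
  by (auto simp: interlevelset_def)

lemma closedin_interlevelset:
  assumes "continuous_map X euclideanreal f"
  shows "closedin X (topspace (interlevelset X f b c))"
proof -
  have "closed (ereal -` {b..c})"
    by (intro closed_vimage continuous_on_ereal continuous_on_id) auto
  then have "closedin X {x \<in> topspace X. f x \<in> ereal -` {b..c}}"
    by (intro closedin_continuous_map_preimage[OF assms]) simp
  then show ?thesis by (simp add: topspace_interlevelset)
qed

lemma interlevelset_alt: "interlevelset X f b c = subtopology X (topspace (interlevelset X f b c))"
  by (simp only: interlevelset_def topspace_subtopology subtopology_restrict)

text \<open>
  A retraction \<open>\<rho>\<close> of intervals which does not cross a critical value is covered by a deformation retraction, which
  moves the points of each strip \<open>E i \<times> [a i, a (i+1)]\<close> vertically. It is continuous because the product of the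
  quotient map with the compact unit interval is again a quotient map.
\<close>

lemma morse_deformation:
  fixes V E :: "nat \<Rightarrow> 'b topology"
  assumes f: "continuous_map X euclideanreal f" and morse: "morse_type X f n a V E l r"
    and \<rho>: "continuous_on UNIV \<rho>"
    and b'b: "b' \<le> b" and cc': "c \<le> c'"
    and into: "\<And>t. b' \<le> ereal t \<Longrightarrow> ereal t \<le> c' \<Longrightarrow> b \<le> ereal (\<rho> t) \<and> ereal (\<rho> t) \<le> c"
    and fixed: "\<And>t. b \<le> ereal t \<Longrightarrow> ereal t \<le> c \<Longrightarrow> \<rho> t = t"
    and cross: "\<And>t i. b' \<le> ereal t \<Longrightarrow> ereal t \<le> c' \<Longrightarrow> i \<in> {1..n} \<Longrightarrow>
      t \<le> a i \<and> a i \<le> \<rho> t \<or> \<rho> t \<le> a i \<and> a i \<le> t \<Longrightarrow> a i = \<rho> t"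
  obtains R where "continuous_map (interlevelset X f b' c') (interlevelset X f b c) R"
    "\<And>x. x \<in> topspace (interlevelset X f b c) \<Longrightarrow> R x = x"
    "homotopic_with (\<lambda>_. True) (interlevelset X f b' c') (interlevelset X f b' c') id R"
proof -
  let ?X' = "interlevelset X f b' c'"
  let ?I = "top_of_set {0..1::real}"
  let ?B = "case_sum V E" and ?L = "case_sum (\<lambda>i. {a i}) (\<lambda>i. {a i..a (Suc i)})"
  let ?J = "{1..n} <+> {1..<n}"
  let ?D = "morse_pieces n a V E"
  obtain \<pi> where quo: "quotient_map ?D X \<pi>"
    and eqv: "\<And>u v. u \<in> topspace ?D \<Longrightarrow> v \<in> topspace ?D \<Longrightarrow> \<pi> u = \<pi> v \<Longrightarrow> equivclp (morse_glue n a E l r) u v"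
    and f\<pi>: "\<And>u. u \<in> topspace ?D \<Longrightarrow> f (\<pi> u) = snd (snd u)"
    using morse unfolding morse_type_def by blast
  have D: "?D = sum_topology (\<lambda>j. prod_topology (?B j) (top_of_set (?L j))) ?J"
    by (rule morse_pieces_eq)
  have topD: "u \<in> topspace ?D \<longleftrightarrow> (\<exists>j x t. u = (j, (x, t)) \<and> j \<in> ?J \<and> x \<in> topspace (?B j) \<and> t \<in> ?L j)" for u
    unfolding D by auto
  have \<pi>X: "\<pi> u \<in> topspace X" if "u \<in> topspace ?D" for u
    using quotient_imp_surjective_map[OF quo] that by blast
  \<comment> \<open>The full preimage of a closed set, so that the quotient map restricts to a
    quotient map.\<close>
  define U where "U = {u \<in> topspace ?D. \<pi> u \<in> topspace ?X'}"
  have UD: "u \<in> topspace ?D" "b' \<le> ereal (snd (snd u))" "ereal (snd (snd u)) \<le> c'" if "u \<in> U" for u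
    using that f\<pi>[of u] by (simp_all add: U_def topspace_interlevelset)
  have UI: "u \<in> U" if "u \<in> topspace ?D" "b' \<le> ereal (snd (snd u))" "ereal (snd (snd u)) \<le> c'" for u
    using that f\<pi>[of u] \<pi>X[of u] by (simp add: U_def topspace_interlevelset)
  have UsD: "U \<subseteq> topspace ?D" by (auto simp: U_def)
  have "quotient_map (subtopology ?D U) (subtopology X (topspace ?X')) \<pi>"
    by (rule quotient_map_restriction[OF quo U_def[symmetric]]) (simp add: closedin_interlevelset[OF f])
  then have quoU: "quotient_map (subtopology ?D U) ?X' \<pi>"
    by (simp only: interlevelset_alt[symmetric])
  let ?K = "prod_topology ?I (subtopology ?D U)"
  have quoK: "quotient_map ?K (prod_topology ?I ?X') (\<lambda>(\<tau>, u). (\<tau>, \<pi> u))"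
    by (rule quotient_map_prod_right[OF _ _ quoU])
      (auto intro: compact_imp_locally_compact_space Hausdorff_space_subtopology simp: compact_space_subtopology)
  have topK: "topspace ?K = {0..1} \<times> U" using UsD by auto
  \<comment> \<open>Straight-line motion of the level from \<open>t\<close> to
    \<open>\<rho> t\<close>; the base coordinate stays put.\<close>
  define h where "h = (\<lambda>\<tau> t. t + \<tau> * (\<rho> t - t))"
  define g where "g = (\<lambda>(\<tau>, u :: (nat + nat) \<times> ('b \<times> real)). (fst u, (fst (snd u), h \<tau> (snd (snd u)))))"
  have h_range: "min t (\<rho> t) \<le> h \<tau> t \<and> h \<tau> t \<le> max t (\<rho> t)" if "0 \<le> \<tau>" "\<tau> \<le> 1" for \<tau> t
  proof (cases "t \<le> \<rho> t")
    case True
    then have "0 \<le> \<tau> * (\<rho> t - t)" "\<tau> * (\<rho> t - t) \<le> 1 * (\<rho> t - t)"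
      using that by (simp, intro mult_right_mono) auto
    then show ?thesis using True by (auto simp: h_def)
  next
    case False
    then have "0 \<le> \<tau> * (t - \<rho> t)" "\<tau> * (t - \<rho> t) \<le> 1 * (t - \<rho> t)"
      using that by (simp, intro mult_right_mono) auto
    then show ?thesis using False by (auto simp: h_def algebra_simps)
  qed
  \<comment> \<open>Applied with \<open>t\<close> itself critical, \<open>cross\<close> says that
    \<rho> fixes it.\<close>
  have h_crit: "h \<tau> t = t" if "b' \<le> ereal t" "ereal t \<le> c'" "t \<in> a ` {1..n}" for \<tau> t
    using cross[OF that(1,2)] that(3) by (fastforce simp: h_def)
  have h_piece: "h \<tau> t \<in> ?L j" if "j \<in> ?J" "t \<in> ?L j" "b' \<le> ereal t" "ereal t \<le> c'" "0 \<le> \<tau>" "\<tau> \<le> 1" for \<tau> t j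
  proof (cases j)
    case (Inl i)
    then have "t \<in> a ` {1..n}" using that by auto
    then show ?thesis using h_crit[OF that(3,4)] that(2) by simp
  next
    case (Inr i)
    then have i: "i \<in> {1..n}" "Suc i \<in> {1..n}" "a i \<le> t" "t \<le> a (Suc i)" using that by auto
    \<comment> \<open>\<rho> may carry a level onto an end of its strip but not past it, so the
      whole motion stays in the strip.\<close>
    have "a i \<le> \<rho> t" using cross[OF that(3,4) i(1)] i(3) by (cases "\<rho> t \<le> a i") auto
    moreover have "\<rho> t \<le> a (Suc i)" using cross[OF that(3,4) i(2)] i(4) by (cases "a (Suc i) \<le> \<rho> t") auto
    ultimately show ?thesis using h_range[OF that(5,6), of t] i Inr by (auto simp: min_def max_def split: if_splits)
  qed
  have h_levels: "b' \<le> ereal (h \<tau> t) \<and> ereal (h \<tau> t) \<le> c'"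
    if "b' \<le> ereal t" "ereal t \<le> c'" "0 \<le> \<tau>" "\<tau> \<le> 1" for \<tau> t
  proof -
    have "b' \<le> ereal (\<rho> t)" "ereal (\<rho> t) \<le> c'"
      using into[OF that(1,2)] b'b cc' by (auto intro: order_trans)
    then have "b' \<le> ereal (min t (\<rho> t))" "ereal (max t (\<rho> t)) \<le> c'" using that by (auto simp: min_def max_def)
    then show ?thesis using h_range[OF that(3,4), of t] by (meson ereal_less_eq(3) order_trans)
  qed
  have gU: "g (\<tau>, u) \<in> U" if \<tau>: "\<tau> \<in> {0..1}" and u': "u \<in> U" for \<tau> u
  proof -
    obtain j x t where u: "u = (j, (x, t))" "j \<in> ?J" "x \<in> topspace (?B j)" "t \<in> ?L j"
      using UD(1)[OF u'] topD by blast
    have t: "b' \<le> ereal t" "ereal t \<le> c'" using UD(2,3)[OF u'] u(1) by auto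
    have "g (\<tau>, u) \<in> topspace ?D"
      using u h_piece[OF u(2,4) t] \<tau> unfolding topD by (simp add: g_def)
    then show ?thesis
      using h_levels[OF t, of \<tau>] \<tau> u(1) by (intro UI) (auto simp: g_def)
  qed
  \<comment> \<open>The pieces are open in the disjoint union, so continuity can be checked on
    each.\<close>
  have cont_g: "continuous_map ?K ?D g"
  proof (rule pasting_lemma[where I = ?J and T = "\<lambda>j. topspace ?I \<times> (U \<inter> ({j} \<times> UNIV))" and f = "\<lambda>_. g"])
    fix j assume j: "j \<in> ?J"
    let ?P = "prod_topology (?B j) (top_of_set (?L j))"
    have "openin ?D (Pair j ` topspace ?P)"
      using open_map_component_injection[OF j, of "\<lambda>j. prod_topology (?B j) (top_of_set (?L j))"]
      unfolding D open_map_def using openin_topspace by blast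
    moreover have "Pair j ` topspace ?P = {j} \<times> topspace ?P" by auto
    ultimately have "openin ?D ({j} \<times> topspace ?P)" by simp
    moreover have "U \<inter> ({j} \<times> UNIV) = U \<inter> ({j} \<times> topspace ?P)"
      using UsD unfolding D by auto
    ultimately have "openin (subtopology ?D U) (U \<inter> ({j} \<times> UNIV))"
      by (simp add: openin_subtopology_Int2)
    then show "openin ?K (topspace ?I \<times> (U \<inter> ({j} \<times> UNIV)))"
      using openin_prod_Times_iff openin_topspace by blast
    let ?K' = "subtopology ?K (topspace ?I \<times> (U \<inter> ({j} \<times> UNIV)))"
    have K': "?K' = prod_topology ?I (subtopology (subtopology ?D U) (U \<inter> ({j} \<times> UNIV)))"
      by (simp only: subtopology_Times subtopology_topspace)
    have "continuous_map (subtopology (subtopology ?D U) (U \<inter> ({j} \<times> UNIV))) ?P snd"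
      using continuous_map_from_subtopology_mono[OF continuous_map_snd_sum_component[of _ ?J j], of "U \<inter> ({j} \<times> UNIV)"
          "\<lambda>j. prod_topology (?B j) (top_of_set (?L j))"]
      unfolding subtopology_subtopology D by (simp add: Int_absorb1)
    then have c2: "continuous_map ?K' ?P (snd \<circ> snd)"
      unfolding K' by (intro continuous_map_compose[OF continuous_map_snd])
    have cB: "continuous_map ?K' (?B j) (\<lambda>z. fst (snd (snd z)))"
      using continuous_map_compose[OF c2 continuous_map_fst] by (simp add: comp_def)
    have ct: "continuous_map ?K' euclideanreal (\<lambda>z. snd (snd (snd z)))"
      using continuous_map_into_fulltopology[OF continuous_map_compose[OF c2 continuous_map_snd]] by (simp add: comp_def)
    have c\<tau>: "continuous_map ?K' euclideanreal fst"
      unfolding K' by (rule continuous_map_into_fulltopology[OF continuous_map_fst])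
    have "continuous_map ?K' euclideanreal (\<lambda>z. \<rho> (snd (snd (snd z))))"
      using continuous_map_compose[OF ct, of euclideanreal \<rho>] \<rho> by (simp add: comp_def)
    then have ch: "continuous_map ?K' euclideanreal (\<lambda>z. h (fst z) (snd (snd (snd z))))"
      unfolding h_def by (intro continuous_map_add continuous_map_real_mult continuous_map_diff ct c\<tau>)
    have "continuous_map ?K' (top_of_set (?L j)) (\<lambda>z. h (fst z) (snd (snd (snd z))))"
    proof (rule continuous_map_into_subtopology[OF ch], rule Pi_I)
      fix z assume "z \<in> topspace ?K'"
      then obtain \<tau> x t where z: "z = (\<tau>, (j, (x, t)))" "\<tau> \<in> {0..1}" "(j, (x, t)) \<in> U"
        using topK by auto
      then have "t \<in> ?L j" using UD(1)[OF z(3)] topD by auto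
      then show "h (fst z) (snd (snd (snd z))) \<in> ?L j"
        using h_piece[OF j _ ] UD(2,3)[OF z(3)] z by auto
    qed
    then have "continuous_map ?K' ?P (\<lambda>z. (fst (snd (snd z)), h (fst z) (snd (snd (snd z)))))"
      by (intro continuous_map_pairedI cB)
    then have "continuous_map ?K' ?D (Pair j \<circ> (\<lambda>z. (fst (snd (snd z)), h (fst z) (snd (snd (snd z))))))"
      unfolding D
      by (rule continuous_map_compose[OF _ continuous_map_component_injection[OF j]])
    then show "continuous_map ?K' ?D g"
      by (rule continuous_map_eq) (auto simp: g_def)
  next
    fix z assume "z \<in> topspace ?K"
    then obtain \<tau> u where z: "z = (\<tau>, u)" "\<tau> \<in> {0..1}" "u \<in> U" using topK by auto
    then show "\<exists>j. j \<in> ?J \<and> z \<in> topspace ?I \<times> (U \<inter> ({j} \<times> UNIV)) \<and> g z = g z"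
      using UD(1)[OF z(3)] topD[of u] by (intro exI[of _ "fst u"]) auto
  qed simp
  have "continuous_map ?K X (\<pi> \<circ> g)"
    using continuous_map_compose[OF cont_g quotient_imp_continuous_map[OF quo]] .
  then have cont: "continuous_map ?K ?X' (\<pi> \<circ> g)"
    unfolding interlevelset_def
    using gU topK by (intro continuous_map_into_subtopology) (auto simp: U_def topspace_interlevelset)
  \<comment> \<open>Distinct points that are identified lie over a critical level, where nothing
    moves, so the motion descends to the quotient.\<close>
  have compat: "(\<pi> \<circ> g) z = (\<pi> \<circ> g) z'"
    if zz: "z \<in> topspace ?K" "z' \<in> topspace ?K" "(\<lambda>(\<tau>, u). (\<tau>, \<pi> u)) z = (\<lambda>(\<tau>, u). (\<tau>, \<pi> u)) z'" for z z'
  proof -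
    obtain \<tau> u u' where z: "z = (\<tau>, u)" "z' = (\<tau>, u')" "u \<in> U" "u' \<in> U" "\<pi> u = \<pi> u'"
      using zz topK by auto
    have same: "snd (snd u) = snd (snd u')" using z(5) f\<pi>[OF UD(1)[OF z(3)]] f\<pi>[OF UD(1)[OF z(4)]] by simp
    have either: "u = u' \<or> snd (snd u) \<in> a ` {1..n}"
      using equivclp_morse_glueD eqv[OF UD(1)[OF z(3)] UD(1)[OF z(4)] z(5)] by blast
    have unmoved: "g (\<tau>, v) = v" if "v \<in> U" "snd (snd v) \<in> a ` {1..n}" for v
      using h_crit[OF UD(2,3)[OF that(1)] that(2)] by (simp add: g_def)
    show ?thesis
    proof (cases "u = u'")
      case False
      then show ?thesis using either same unmoved[OF z(3)] unmoved[OF z(4)] z(1,2,5) by simp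
    qed (simp add: z(1,2))
  qed
  show thesis
  proof (rule quotient_map_lift_exists[OF quoK cont compat])
  fix F
  assume F: "continuous_map (prod_topology ?I ?X') ?X' F"
    "\<And>z. z \<in> topspace ?K \<Longrightarrow> F ((\<lambda>(\<tau>, u). (\<tau>, \<pi> u)) z) = (\<pi> \<circ> g) z"
  have F': "F (\<tau>, \<pi> u) = \<pi> (g (\<tau>, u))" if "\<tau> \<in> {0..1}" "u \<in> U" for \<tau> u
    using F(2)[of "(\<tau>, u)"] that UD(1)[OF that(2)] by simp
  have surj: "\<exists>u\<in>U. x = \<pi> u" if "x \<in> topspace ?X'" for x
    using quotient_imp_surjective_map[OF quoU] that UsD by (auto simp: image_iff)
  define R where "R = (\<lambda>x. F (1, x))"
  have contR: "continuous_map ?X' ?X' R"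
    unfolding R_def using continuous_map_o_Pair[OF F(1), of 1] by (simp add: comp_def)
  have R\<pi>: "R (\<pi> u) = \<pi> (g (1, u))" "f (R (\<pi> u)) = \<rho> (snd (snd u))" if "u \<in> U" for u
    using F'[of 1 u] f\<pi>[OF UD(1)[OF gU[of 1 u]]] that by (auto simp: R_def g_def h_def)
  show ?thesis
  proof (rule that)
    have "continuous_map ?X' X R"
      using contR unfolding interlevelset_def by (rule continuous_map_into_fulltopology)
    moreover have "R x \<in> {x. b \<le> ereal (f x) \<and> ereal (f x) \<le> c}" if "x \<in> topspace ?X'" for x
      using surj[OF that] R\<pi>(2) into[OF UD(2,3)] by auto
    ultimately show "continuous_map ?X' (interlevelset X f b c) R"
      unfolding interlevelset_def[of X f b c] by (intro continuous_map_into_subtopology) auto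
  next
    fix x assume x: "x \<in> topspace (interlevelset X f b c)"
    then have "x \<in> topspace ?X'"
      using b'b cc' by (auto simp: topspace_interlevelset intro: order_trans)
    then obtain u where u: "u \<in> U" "x = \<pi> u" using surj by blast
    then have "\<rho> (snd (snd u)) = snd (snd u)"
      using x fixed f\<pi>[OF UD(1)] by (auto simp: topspace_interlevelset)
    then show "R x = x" using R\<pi>(1)[OF u(1)] u(2) by (simp add: g_def h_def)
  next
    have "F (0, x) = id x" if x: "x \<in> topspace ?X'" for x
      using surj[OF x] F'[of 0] by (auto simp: g_def h_def)
    then show "homotopic_with (\<lambda>_. True) ?X' ?X' id R"
      using F(1) by (auto simp: homotopic_with R_def intro!: exI[of _ F])
  qed
  qed
qed

lemma pair_map_interlevelset:
  assumes "c \<le> a" "b \<le> d"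
  shows "pair_map (interlevelset X f a b) {} (interlevelset X f c d) {} id"
proof -
  have "id \<in> topspace (interlevelset X f a b) \<rightarrow> {x. c \<le> ereal (f x) \<and> ereal (f x) \<le> d}"
    using assms by (auto simp: topspace_interlevelset intro: order_trans)
  moreover have "continuous_map (interlevelset X f a b) X id"
    unfolding interlevelset_def by (intro continuous_map_from_subtopology continuous_map_id)
  ultimately show ?thesis
    unfolding pair_map_def interlevelset_def[of X f c d] by (auto intro: continuous_map_into_subtopology)
qed

lemma subtopology_interlevelset:
  assumes "a \<le> b" "c \<le> d"
  shows "subtopology (interlevelset X f a d) (topspace (interlevelset X f b c)) = interlevelset X f b c"
proof -
  have "{x. a \<le> ereal (f x) \<and> ereal (f x) \<le> d} \<inter> topspace (interlevelset X f b c) = topspace (interlevelset X f b c)"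
    using assms by (auto simp: topspace_interlevelset intro: order_trans)
  then have "subtopology (interlevelset X f a d) (topspace (interlevelset X f b c)) =
      subtopology X (topspace (interlevelset X f b c))"
    unfolding interlevelset_def[of X f a d] subtopology_subtopology by simp
  then show ?thesis by (simp only: interlevelset_alt[symmetric])
qed

text \<open>Every piece of the gluing lies at or between critical values. Hence the space is empty
  beyond them, and empty altogether if \<open>n = 0\<close>.\<close>

lemma morse_type_bounds:
  assumes "morse_type X f n a V E l r" "x \<in> topspace X"
  shows "\<exists>i\<in>{1..n}. a i \<le> f x" "\<exists>i\<in>{1..n}. f x \<le> a i"
proof -
  obtain \<pi> where \<pi>: "quotient_map (morse_pieces n a V E) X \<pi>"
    "\<forall>u\<in>topspace (morse_pieces n a V E). f (\<pi> u) = snd (snd u)"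
    using assms(1) unfolding morse_type_def by (elim conjE exE)
  have "x \<in> \<pi> ` topspace (morse_pieces n a V E)"
    using quotient_imp_surjective_map[OF \<pi>(1)] assms(2) by simp
  then obtain u where u: "x = \<pi> u" "u \<in> topspace (morse_pieces n a V E)" by (elim imageE)
  obtain j y t where jyt: "u = (j, (y, t))" by (metis prod.exhaust)
  have "f x = t" using \<pi>(2) u jyt by simp
  moreover have "(\<exists>i\<in>{1..n}. a i \<le> t) \<and> (\<exists>i\<in>{1..n}. t \<le> a i)"
  proof (cases j)
    case (Inl i)
    then have "i \<in> {1..n}" "t = a i" using u(2) jyt by (auto simp: morse_pieces_def)
    then show ?thesis by blast
  next
    case (Inr i)
    then have "i \<in> {1..n}" "Suc i \<in> {1..n}" "a i \<le> t" "t \<le> a (Suc i)"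
      using u(2) jyt by (auto simp: morse_pieces_def)
    then show ?thesis by blast
  qed
  ultimately show "\<exists>i\<in>{1..n}. a i \<le> f x" "\<exists>i\<in>{1..n}. f x \<le> a i" by simp_all
qed

lemma morse_interlevelset_empty_above:
  assumes "morse_type X f n a V E l r" and "\<And>i. i \<in> {1..n} \<Longrightarrow> ereal (a i) < b"
  shows "topspace (interlevelset X f b c) = {}"
proof -
  have "ereal (f x) < b" if x: "x \<in> topspace X" for x
  proof -
    obtain k where k: "k \<in> {1..n}" "f x \<le> a k" using morse_type_bounds(2)[OF assms(1) x] ..
    show ?thesis using le_less_trans[OF _ assms(2)[OF k(1)], of "ereal (f x)"] k(2) by simp
  qed
  then show ?thesis by (auto simp: topspace_interlevelset not_le[symmetric])
qed

lemma morse_interlevelset_empty_below: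
  assumes "morse_type X f n a V E l r" and "\<And>i. i \<in> {1..n} \<Longrightarrow> c < ereal (a i)"
  shows "topspace (interlevelset X f b c) = {}"
proof -
  have "c < ereal (f x)" if x: "x \<in> topspace X" for x
  proof -
    obtain k where k: "k \<in> {1..n}" "a k \<le> f x" using morse_type_bounds(1)[OF assms(1) x] ..
    show ?thesis using less_le_trans[OF assms(2)[OF k(1)], of "ereal (f x)"] k(2) by simp
  qed
  then show ?thesis by (auto simp: topspace_interlevelset not_le[symmetric])
qed

section \<open>Consequences of the homology axioms for interlevelsets\<close>

context homology_theory
begin

text \<open>For the empty space and its empty subspace, both maps in \<open>exact_at_space\<close>
  are the identity, so every class lies in the kernel of the identity.\<close>

lemma hgrp_empty:
  assumes "topspace Y = {}"
  shows "hgrp T p Y {} = {0}"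
proof -
  interpret V: vector_space "hscale T" by (rule vector_space_hscale)
  have Y: "subtopology Y {} = Y" using assms subtopology_topspace[of Y] by simp
  have "hind T p Y {} Y {} id ` hgrp T p Y {} = {x \<in> hgrp T p Y {}. hind T p Y {} Y {} id x = 0}"
    using exact_at_space[of "{}" Y p] Y by simp
  moreover have "hind T p Y {} Y {} id x = x" if "x \<in> hgrp T p Y {}" for x
    using that by (intro hind_id) auto
  ultimately have "hgrp T p Y {} \<subseteq> {0}" by force
  moreover have "0 \<in> hgrp T p Y {}"
    using V.subspace_0[OF subspace_hgrp] by blast
  ultimately show ?thesis by blast
qed

text \<open>A HOL function also has values off the space; the homotopy axiom shows that they do not
  affect the induced map.\<close>

lemma hind_cong:
  assumes "continuous_map Y Z g" "\<And>x. x \<in> topspace Y \<Longrightarrow> g x = h x" "x \<in> hgrp T p Y {}"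
  shows "hind T p Y {} Z {} g x = hind T p Y {} Z {} h x"
  using assms by (intro homotopy_axiom) (auto intro: homotopic_with_equal)

lemma deformation_retract_bij:
  assumes incl: "pair_map A {} Y {} id" and R: "continuous_map Y A R"
    and fixed: "\<And>x. x \<in> topspace A \<Longrightarrow> R x = x" and hom: "homotopic_with (\<lambda>_. True) Y Y id R"
  shows "bij_betw (hind T p A {} Y {} id) (hgrp T p A {}) (hgrp T p Y {})"
proof -
  have R': "pair_map Y {} A {} R" using R by (simp add: pair_map_def)
  have cR: "continuous_map Y Y R" using homotopic_with_imp_continuous_maps[OF hom] by blast
  have left: "hind T p Y {} A {} R (hind T p A {} Y {} id x) = x" if "x \<in> hgrp T p A {}" for x
  proof -
    have "hind T p Y {} A {} R (hind T p A {} Y {} id x) = hind T p A {} A {} (R \<circ> id) x"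
      using hind_compose[OF incl R' that] by simp
    also have "\<dots> = hind T p A {} A {} id x"
    proof (rule hind_cong[OF _ _ that])
      show "continuous_map A A (R \<circ> id)"
        using incl by (intro continuous_map_compose[OF _ R]) (simp add: pair_map_def)
    qed (simp add: fixed)
    finally show ?thesis using hind_id[of "{}" A x p] that by simp
  qed
  have right: "hind T p A {} Y {} id (hind T p Y {} A {} R y) = y" if "y \<in> hgrp T p Y {}" for y
  proof -
    have "hind T p A {} Y {} id (hind T p Y {} A {} R y) = hind T p Y {} Y {} (id \<circ> R) y"
      using hind_compose[OF R' incl that] by simp
    also have "\<dots> = hind T p Y {} Y {} id y"
      using hom that by (intro homotopy_axiom[symmetric]) (auto elim: homotopic_with_mono)
    finally show ?thesis using hind_id[of "{}" Y y p] that by simp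
  qed
  show ?thesis
    using left right linear_betweenD(1)[OF linear_hind[OF incl, of p]] linear_betweenD(1)[OF linear_hind[OF R', of p]]
    by (intro bij_betw_byWitness[where f' = "hind T p Y {} A {} R"]) auto
qed

text \<open>Pushing levels up by \<open>max\<close> retracts onto \<open>[b,c]\<close>. The
  retraction may stop at a critical value \<open>b\<close> but not start from one at a lower
  \<open>b'\<close>; this half-open condition is the source of the one-sided jumps.\<close>

lemma interlevelset_bij:
  assumes f: "continuous_map X euclideanreal f" and morse: "morse_type X f n a V E l r"
    and "b' \<le> b" "b \<le> c"
    and crit: "\<And>i. i \<in> {1..n} \<Longrightarrow> \<not> (b' \<le> ereal (a i) \<and> ereal (a i) < b)"
  shows "bij_betw (hind T p (interlevelset X f b c) {} (interlevelset X f b' c) {} id)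
    (hgrp T p (interlevelset X f b c) {}) (hgrp T p (interlevelset X f b' c) {})"
proof -
  have same: ?thesis if "interlevelset X f b c = interlevelset X f b' c"
    using that hind_id[of "{}" "interlevelset X f b' c" _ p] by (simp add: bij_betw_def inj_on_def)
  show ?thesis
  proof (cases b)
    case (real \<beta>)
    show ?thesis
    proof (rule morse_deformation[OF f morse, of "max \<beta>" b' b c c])
      fix t i assume t: "b' \<le> ereal t" "ereal t \<le> c" and i: "i \<in> {1..n}"
        "t \<le> a i \<and> a i \<le> max \<beta> t \<or> max \<beta> t \<le> a i \<and> a i \<le> t"
      have "a i < \<beta> \<Longrightarrow> t \<le> a i \<Longrightarrow> False"
        using crit[OF i(1)] t(1) real by (auto intro: order_trans)
      then show "a i = max \<beta> t" using i(2) by (cases "a i < \<beta>") (auto simp: max_def split: if_splits)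
    next
      fix R
      assume "continuous_map (interlevelset X f b' c) (interlevelset X f b c) R"
        "\<And>x. x \<in> topspace (interlevelset X f b c) \<Longrightarrow> R x = x"
        "homotopic_with (\<lambda>_. True) (interlevelset X f b' c) (interlevelset X f b' c) id R"
      then show ?thesis
        using assms(3) by (intro deformation_retract_bij pair_map_interlevelset) auto
    next
      show "continuous_on UNIV (max \<beta>)" by (intro continuous_on_max continuous_on_const continuous_on_id)
    qed (use assms real in \<open>auto simp: max_def\<close>)
  next
    \<comment> \<open>With \<open>b = \<infinity>\<close> the condition puts all critical values
      below \<open>b'\<close>, so both spaces are empty.\<close>
    case PInf
    then have "ereal (a i) < b'" if "i \<in> {1..n}" for i using crit[OF that] by auto
    then have "topspace (interlevelset X f b c) = {}" "topspace (interlevelset X f b' c) = {}"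
      using morse_interlevelset_empty_above[OF morse] PInf by auto
    then show ?thesis by (intro same) simp
  next
    case MInf
    then show ?thesis using assms(3) by (intro same) simp
  qed
qed

lemma interlevelset_bij_right:
  assumes f: "continuous_map X euclideanreal f" and morse: "morse_type X f n a V E l r"
    and "b \<le> c" "c \<le> c'"
    and crit: "\<And>i. i \<in> {1..n} \<Longrightarrow> \<not> (c < ereal (a i) \<and> ereal (a i) \<le> c')"
  shows "bij_betw (hind T p (interlevelset X f b c) {} (interlevelset X f b c') {} id)
    (hgrp T p (interlevelset X f b c) {}) (hgrp T p (interlevelset X f b c') {})"
proof -
  have same: ?thesis if "interlevelset X f b c = interlevelset X f b c'"
    using that hind_id[of "{}" "interlevelset X f b c'" _ p] by (simp add: bij_betw_def inj_on_def)
  show ?thesis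
  proof (cases c)
    case (real \<gamma>)
    show ?thesis
    proof (rule morse_deformation[OF f morse, of "min \<gamma>" b b c c'])
      fix t i assume t: "b \<le> ereal t" "ereal t \<le> c'" and i: "i \<in> {1..n}"
        "t \<le> a i \<and> a i \<le> min \<gamma> t \<or> min \<gamma> t \<le> a i \<and> a i \<le> t"
      have "\<gamma> < a i \<Longrightarrow> a i \<le> t \<Longrightarrow> False"
        using crit[OF i(1)] order_trans[OF _ t(2), of "ereal (a i)"] real by simp
      then show "a i = min \<gamma> t" using i(2) by (cases "\<gamma> < a i") (auto simp: min_def split: if_splits)
    next
      fix R
      assume "continuous_map (interlevelset X f b c') (interlevelset X f b c) R"
        "\<And>x. x \<in> topspace (interlevelset X f b c) \<Longrightarrow> R x = x"
        "homotopic_with (\<lambda>_. True) (interlevelset X f b c') (interlevelset X f b c') id R"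
      then show ?thesis
        using assms(4) by (intro deformation_retract_bij pair_map_interlevelset) auto
    next
      show "continuous_on UNIV (min \<gamma>)" by (intro continuous_on_min continuous_on_const continuous_on_id)
    qed (use assms real in \<open>auto simp: min_def\<close>)
  next
    case MInf
    then have "c' < ereal (a i)" if "i \<in> {1..n}" for i using crit[OF that] by auto
    then have "topspace (interlevelset X f b c) = {}" "topspace (interlevelset X f b c') = {}"
      using morse_interlevelset_empty_below[OF morse] MInf by auto
    then show ?thesis by (intro same) simp
  next
    case PInf
    then show ?thesis using assms(4) by (intro same) simp
  qed
qed

text \<open>A chase in the exact sequences of the pairs \<open>(W, A)\<close> and
  \<open>(C, A \<inter> C)\<close>, whose relative groups excision identifies: first a class hitting
  \<open>v\<close>, then a correction by a boundary that changes only the component in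
  \<open>A\<close>.\<close>

lemma mayer_vietoris_exact:
  fixes W :: "'a topology"
  assumes A: "A \<subseteq> topspace W" and C: "C \<subseteq> topspace W"
    and exc: "\<And>p. bij_betw (hind T p (subtopology W C) (A \<inter> C) W A id)
      (hgrp T p (subtopology W C) (A \<inter> C)) (hgrp T p W A)"
    and u: "u \<in> hgrp T k (subtopology W A) {}" and v: "v \<in> hgrp T k (subtopology W C) {}"
    and eq: "hind T k (subtopology W A) {} W {} id u = hind T k (subtopology W C) {} W {} id v"
  shows "\<exists>z \<in> hgrp T k (subtopology W (A \<inter> C)) {}.
    hind T k (subtopology W (A \<inter> C)) {} (subtopology W A) {} id z = u \<and>
    hind T k (subtopology W (A \<inter> C)) {} (subtopology W C) {} id z = v"
proof -
  interpret V: vector_space "hscale T" by (rule vector_space_hscale)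
  let ?P = "subtopology W C" and ?Q = "subtopology W A" and ?N = "subtopology W (A \<inter> C)"
  have "C \<inter> (A \<inter> C) = A \<inter> C" by blast
  then have N: "subtopology ?P (A \<inter> C) = ?N" by (simp add: subtopology_subtopology)
  have topP: "topspace ?P = C" "topspace ?Q = A" "topspace ?N = A \<inter> C" using A C by auto
  have ACP: "A \<inter> C \<subseteq> topspace ?P" using topP by simp
  have cont: "continuous_map (subtopology W S) W id" for S
    by (intro continuous_map_from_subtopology continuous_map_id)
  have cont': "continuous_map (subtopology W S) (subtopology W S') id" if "S \<subseteq> S'" for S S'
    using that by (intro continuous_map_into_subtopology cont) auto
  have pm: "pair_map ?Q {} W {} id" "pair_map ?P {} W {} id" "pair_map W {} W A id"
    "pair_map ?P {} ?P (A \<inter> C) id" "pair_map ?P (A \<inter> C) W A id" "pair_map ?N {} ?Q {} id" "pair_map ?N {} ?P {} id"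
    using A C topP cont cont' by (auto simp: pair_map_def)
  have mem: "pair_map Y S Y' S' id \<Longrightarrow> x \<in> hgrp T p Y S \<Longrightarrow> hind T p Y S Y' S' id x \<in> hgrp T p Y' S'" for Y S Y' S' x p
    using linear_betweenD(1)[OF linear_hind] by blast
  have sub: "S \<subseteq> topspace Y \<Longrightarrow> V.subspace (hgrp T p Y S)" for S Y p by (rule subspace_hgrp)
  have add: "hind T p Y {} Y' {} id (x + y) = hind T p Y {} Y' {} id x + hind T p Y {} Y' {} id y"
    if "pair_map Y {} Y' {} id" "x \<in> hgrp T p Y {}" "y \<in> hgrp T p Y {}" for Y Y' x y p
    using linear_betweenD(2)[OF linear_hind[OF that(1)] that(2,3)] .
  have diff: "hind T p Y {} Y' {} id (x - y) = hind T p Y {} Y' {} id x - hind T p Y {} Y' {} id y"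
    if "pair_map Y {} Y' {} id" "x \<in> hgrp T p Y {}" "y \<in> hgrp T p Y {}" for Y Y' x y p
    using V.linear_between_diff[OF sub vector_space_hscale linear_hind[OF that(1)] that(2,3)] by simp
  \<comment> \<open>The common image vanishes modulo \<open>A\<close>, so by excision
    \<open>v\<close> vanishes modulo \<open>A \<inter> C\<close> and comes from the
    intersection.\<close>
  have "hind T k ?Q {} W {} id u \<in> {x \<in> hgrp T k W {}. hind T k W {} W A id x = 0}"
    using exact_at_space[OF A, of k] u by blast
  then have "hind T k W {} W A id (hind T k ?P {} W {} id v) = 0" using eq by simp
  then have "hind T k ?P (A \<inter> C) W A id (hind T k ?P {} ?P (A \<inter> C) id v) = 0"
    using hind_compose[OF pm(2,3) v] hind_compose[OF pm(4,5) v] by simp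
  moreover have "hind T k ?P (A \<inter> C) W A id 0 = 0"
    using V.linear_between_zero[OF sub[OF ACP] vector_space_hscale linear_hind[OF pm(5)]] .
  ultimately have "hind T k ?P {} ?P (A \<inter> C) id v = 0"
    by (intro inj_onD[OF bij_betw_imp_inj_on[OF exc[of k]] _ mem[OF pm(4) v] V.subspace_0[OF sub[OF ACP]]]) simp
  then have "v \<in> hind T k ?N {} ?P {} id ` hgrp T k ?N {}"
    using exact_at_space[OF ACP, of k] v unfolding N by simp
  then obtain z0 where z0: "v = hind T k ?N {} ?P {} id z0" "z0 \<in> hgrp T k ?N {}" by (elim imageE)
  note z0 = z0(2) z0(1)[symmetric]
  let ?u0 = "hind T k ?N {} ?Q {} id z0"
  have u0: "?u0 \<in> hgrp T k ?Q {}" using mem[OF pm(6) z0(1)] .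
  have "hind T k ?Q {} W {} id ?u0 = hind T k ?P {} W {} id v"
    using hind_compose[OF pm(6,1) z0(1)] hind_compose[OF pm(7,2) z0(1)] z0(2) by simp
  then have "hind T k ?Q {} W {} id (u - ?u0) = 0"
    using diff[OF pm(1) u u0] eq by simp
  moreover have "u - ?u0 \<in> hgrp T k ?Q {}"
    using V.subspace_diff[OF sub u u0] by simp
  \<comment> \<open>The error \<open>u - ?u0\<close> becomes 0 in \<open>W\<close>, hence is the
    boundary of a relative class; degree \<open>k + 1\<close> appears because the connecting map
    lowers degrees by one.\<close>
  ultimately have "u - ?u0 \<in> hbd T (k + 1) W A ` hgrp T (k + 1) W A"
    using exact_at_subspace[OF A, of "k + 1"] by simp
  then obtain w where w: "u - ?u0 = hbd T (k + 1) W A w" "w \<in> hgrp T (k + 1) W A" by (elim imageE)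
  \<comment> \<open>Excision moves the relative class to \<open>C\<close>, so its boundary lies in
    the intersection and dies in \<open>C\<close>: adding it repairs \<open>u\<close> and leaves
    \<open>v\<close> alone.\<close>
  have "w \<in> hind T (k + 1) ?P (A \<inter> C) W A id ` hgrp T (k + 1) ?P (A \<inter> C)"
    using bij_betw_imp_surj_on[OF exc[of "k + 1"]] w(2) by simp
  then obtain w' where w': "w = hind T (k + 1) ?P (A \<inter> C) W A id w'" "w' \<in> hgrp T (k + 1) ?P (A \<inter> C)"
    by (elim imageE)
  let ?e = "hbd T (k + 1) ?P (A \<inter> C) w'"
  have "?e \<in> {x \<in> hgrp T k ?N {}. hind T k ?N {} ?P {} id x = 0}"
    using exact_at_subspace[OF ACP, of "k + 1", unfolded N] imageI[OF w'(2), of "hbd T (k + 1) ?P (A \<inter> C)"]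
    by (simp only: add_diff_cancel_right')
  then have e: "?e \<in> hgrp T k ?N {}" "hind T k ?N {} ?P {} id ?e = 0" by auto
  have "hind T k ?N {} ?Q {} id ?e = u - ?u0"
    using hbd_natural[OF pm(5) w'(2), unfolded N] w(1) w'(1) by simp
  then have "hind T k ?N {} ?Q {} id (z0 + ?e) = u" "hind T k ?N {} ?P {} id (z0 + ?e) = v"
    using add[OF pm(6) z0(1) e(1)] add[OF pm(7) z0(1) e(1)] z0(2) e(2) by auto
  moreover have "z0 + ?e \<in> hgrp T k ?N {}"
    using V.subspace_add[OF sub z0(1) e(1)] by simp
  ultimately show ?thesis by blast
qed

text \<open>
  The excision axiom needs an open overlap, so the two pieces are first made to overlap in a collar
  \<open>[b, b']\<close> without critical values above \<open>b\<close>, onto whose bottom everything retracts.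
\<close>

lemma interlevelset_mayer_vietoris:
  assumes f: "continuous_map X euclideanreal f" and morse: "morse_type X f n a V E l r"
    and ab: "\<alpha> \<le> b" and bc: "b \<le> c"
    and u: "u \<in> hgrp T k (interlevelset X f \<alpha> b) {}" and v: "v \<in> hgrp T k (interlevelset X f b c) {}"
    and eq: "hind T k (interlevelset X f \<alpha> b) {} (interlevelset X f \<alpha> c) {} id u =
      hind T k (interlevelset X f b c) {} (interlevelset X f \<alpha> c) {} id v"
  shows "\<exists>z \<in> hgrp T k (interlevelset X f b b) {}.
    hind T k (interlevelset X f b b) {} (interlevelset X f \<alpha> b) {} id z = u \<and>
    hind T k (interlevelset X f b b) {} (interlevelset X f b c) {} id z = v"
proof -
  let ?G = "\<lambda>a b. interlevelset X f a b"
  have comp: "hind T k (?G c' d') {} (?G e g) {} id (hind T k (?G a' b') {} (?G c' d') {} id x) =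
      hind T k (?G a' b') {} (?G e g) {} id x"
    if "e \<le> c'" "c' \<le> a'" "b' \<le> d'" "d' \<le> g" "x \<in> hgrp T k (?G a' b') {}" for a' b' c' d' e g x
    using hind_compose[OF pair_map_interlevelset[OF that(2,3)] pair_map_interlevelset[OF that(1,4)] that(5)] by simp
  consider "\<alpha> = b" | "b = c" | "\<alpha> < b" "b < c" using ab bc by fastforce
  then show ?thesis
  proof cases
    case 1
    then show ?thesis using u eq hind_id[of "{}" _ _ k] v by (intro bexI[of _ u]) auto
  next
    case 2
    then show ?thesis using v eq hind_id[of "{}" _ _ k] u by (intro bexI[of _ v]) auto
  next
    case 3
    \<comment> \<open>The next critical value above \<open>b\<close>, or \<open>c\<close> if that is
      lower. Any \<open>b'\<close> strictly between is the top of a collar without critical values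
      above \<open>b\<close>.\<close>
    define M where "M = Min (insert c (ereal ` a ` {i \<in> {1..n}. b < ereal (a i)}))"
    have fin: "finite (insert c (ereal ` a ` {i \<in> {1..n}. b < ereal (a i)}))" by simp
    have "b < M" unfolding M_def using 3 by (subst Min_gr_iff[OF fin]) auto
    then obtain b' where b': "b < b'" "b' < M" using dense by blast
    have b'c: "b' \<le> c" using b'(2) Min_le[OF fin, of c] unfolding M_def by auto
    have nocrit: "\<not> (b < ereal (a i) \<and> ereal (a i) \<le> b')" if "i \<in> {1..n}" for i
      using b'(2) Min_le[OF fin, of "ereal (a i)"] that unfolding M_def by (auto simp: not_le)
    let ?W = "?G \<alpha> c" and ?A = "topspace (?G \<alpha> b')" and ?C = "topspace (?G b c)"
    have A: "?A \<subseteq> topspace ?W" and C: "?C \<subseteq> topspace ?W"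
      using 3 b' b'c by (auto simp: topspace_interlevelset intro: order_trans)
    have AC: "?A \<inter> ?C = topspace (?G b b')"
      using 3 b' b'c by (auto simp: topspace_interlevelset intro: order_trans)
    have sW: "subtopology ?W ?A = ?G \<alpha> b'" "subtopology ?W ?C = ?G b c" "subtopology ?W (?A \<inter> ?C) = ?G b b'"
      unfolding AC using 3 b'c by (auto intro!: subtopology_interlevelset)
    have fW: "continuous_map ?W euclideanreal f"
      unfolding interlevelset_def by (intro continuous_map_from_subtopology f)
    \<comment> \<open>The part below \<open>b\<close> is excised. Its closure stays in the levels up
      to \<open>b\<close>, which lie in the interior of the lower piece thanks to the
      collar.\<close>
    define U where "U = {x \<in> topspace ?W. f x \<in> ereal -` {..<b}}"
    have oU: "openin ?W U"
      unfolding U_def by (intro openin_continuous_map_preimage[OF fW]) (simp add: open_vimage continuous_on_ereal)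
    have "U \<subseteq> {x \<in> topspace ?W. f x \<in> ereal -` {..b}}" by (auto simp: U_def)
    moreover have "closedin ?W {x \<in> topspace ?W. f x \<in> ereal -` {..b}}"
      by (intro closedin_continuous_map_preimage[OF fW]) (simp add: closed_vimage continuous_on_ereal)
    ultimately have "?W closure_of U \<subseteq> {x \<in> topspace ?W. f x \<in> ereal -` {..b}}"
      by (rule closure_of_minimal)
    also have "\<dots> \<subseteq> {x \<in> topspace ?W. f x \<in> ereal -` {..<b'}}" using b' by auto
    also have "\<dots> \<subseteq> ?W interior_of ?A"
    proof (rule interior_of_maximal)
      show "openin ?W {x \<in> topspace ?W. f x \<in> ereal -` {..<b'}}"
        by (intro openin_continuous_map_preimage[OF fW]) (simp add: open_vimage continuous_on_ereal)
    qed (auto simp: topspace_interlevelset)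
    finally have clo: "?W closure_of U \<subseteq> ?W interior_of ?A" .
    have WU: "topspace ?W - U = ?C" "?A - U = ?A \<inter> ?C"
      using 3 b' b'c unfolding AC by (auto simp: U_def topspace_interlevelset not_less intro: order_trans)
    have exc: "bij_betw (hind T p (subtopology ?W ?C) (?A \<inter> ?C) ?W ?A id)
        (hgrp T p (subtopology ?W ?C) (?A \<inter> ?C)) (hgrp T p ?W ?A)" for p
      using excision_axiom[OF A oU clo, of p] unfolding WU .
    let ?u = "hind T k (?G \<alpha> b) {} (?G \<alpha> b') {} id u"
    have u': "?u \<in> hgrp T k (subtopology ?W ?A) {}"
      unfolding sW using linear_betweenD(1)[OF linear_hind[OF pair_map_interlevelset] u] b' by auto
    have v': "v \<in> hgrp T k (subtopology ?W ?C) {}" unfolding sW by (rule v)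
    have eq': "hind T k (subtopology ?W ?A) {} ?W {} id ?u = hind T k (subtopology ?W ?C) {} ?W {} id v"
      unfolding sW using comp[of \<alpha> \<alpha> \<alpha> b b' c u] u eq b' b'c by simp
    obtain z' where z': "z' \<in> hgrp T k (?G b b') {}" "hind T k (?G b b') {} (?G \<alpha> b') {} id z' = ?u"
      "hind T k (?G b b') {} (?G b c) {} id z' = v"
      using mayer_vietoris_exact[OF A C exc u' v' eq'] unfolding sW by blast
    \<comment> \<open>The collar retracts onto level \<open>b\<close>, which brings the class on the
      overlap down to the levelset and cancels the enlargement of \<open>u\<close>.\<close>
    have bij: "bij_betw (hind T k (?G b b) {} (?G b b') {} id) (hgrp T k (?G b b) {}) (hgrp T k (?G b b') {})"
      "bij_betw (hind T k (?G \<alpha> b) {} (?G \<alpha> b') {} id) (hgrp T k (?G \<alpha> b) {}) (hgrp T k (?G \<alpha> b') {})"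
      using interlevelset_bij_right[OF f morse _ _ nocrit] b' ab by auto
    have "z' \<in> hind T k (?G b b) {} (?G b b') {} id ` hgrp T k (?G b b) {}"
      using bij_betw_imp_surj_on[OF bij(1)] z'(1) by simp
    then obtain z where z: "z' = hind T k (?G b b) {} (?G b b') {} id z" "z \<in> hgrp T k (?G b b) {}"
      by (elim imageE)
    note z = z(2) z(1)[symmetric]
    have "hind T k (?G b b) {} (?G b c) {} id z = v"
      using comp[of b b b b b' c z] z z'(3) b' b'c by simp
    moreover have "hind T k (?G b b) {} (?G \<alpha> b) {} id z = u"
    proof (rule inj_onD[OF bij_betw_imp_inj_on[OF bij(2)]])
      show "hind T k (?G \<alpha> b) {} (?G \<alpha> b') {} id (hind T k (?G b b) {} (?G \<alpha> b) {} id z) = ?u"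
        using comp[of \<alpha> \<alpha> b b b b' z] comp[of \<alpha> b b b b' b' z] z z'(2) b' ab by simp
      show "hind T k (?G b b) {} (?G \<alpha> b) {} id z \<in> hgrp T k (?G \<alpha> b) {}"
        using linear_betweenD(1)[OF linear_hind[OF pair_map_interlevelset] z(1)] ab by auto
    qed (rule u)
    ultimately show ?thesis using z(1) by (intro bexI[of _ z]) simp_all
  qed
qed

lemma level_functor_morse:
  assumes f: "continuous_map X euclideanreal f" and morse: "morse_type X f n a V E l r"
    and fd: "\<And>b c :: ereal. b \<le> c \<Longrightarrow> finite_dimensional_subspace (hscale T) (hgrp T k (interlevelset X f b c) {})"
  shows "level_functor (hscale T) (\<lambda>b c. hgrp T k (interlevelset X f b c) {})
    (\<lambda>b c b' c'. hind T k (interlevelset X f b c) {} (interlevelset X f b' c') {} id)"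
proof -
  interpret V: vector_space "hscale T" by (rule vector_space_hscale)
  show ?thesis
  proof (unfold_locales, goal_cases)
    case (1 b c)
    then show ?case by (rule fd)
  next
    case (2 c b b' d)
    then show ?case by (intro linear_hind pair_map_interlevelset)
  next
    case (3 b c x)
    then show ?case by (intro hind_id) auto
  next
    case (4 e c b b' d g x)
    then show ?case
      using hind_compose[OF pair_map_interlevelset[OF 4(2,4)] pair_map_interlevelset[OF 4(1,5)] 4(6)] by simp
  next
    case (5 b c d u v)
    then show ?case by (intro interlevelset_mayer_vietoris[OF f morse])
  qed
qed

end

section \<open>Diagrams\<close>

text \<open>One form for the four kinds of intervals: a slash on the left means an open end, a slash
  on the right a closed one.\<close>

definition zz_interval :: "nat \<Rightarrow> (nat \<Rightarrow> real) \<Rightarrow> bool \<Rightarrow> bool \<Rightarrow> nat \<Rightarrow> nat \<Rightarrow> real set" where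
  "zz_interval n a sl sr i j = {x. (if sl then crit n a i < ereal x else crit n a i \<le> ereal x) \<and>
     (if sr then ereal x \<le> crit n a j else ereal x < crit n a j)}"

text \<open>The ends are the infimum and supremum, and the flags say whether they are attained. An
  infinite right end would hide its flag, so a closed end is required to be finite.\<close>

lemma interval_ends_unique:
  fixes l l' :: real and y y' :: ereal
  defines "J \<equiv> \<lambda>sl sr l y. {x. (if sl then ereal l < ereal x else ereal l \<le> ereal x) \<and>
     (if sr then ereal x \<le> y else ereal x < y)}"
  assumes eq: "J sl sr l y = J sl' sr' l' y'"
    and ly: "ereal l < y \<or> ereal l = y \<and> \<not> sl \<and> sr" and ly': "ereal l' < y' \<or> ereal l' = y' \<and> \<not> sl' \<and> sr'"
    and sr: "sr \<Longrightarrow> y \<noteq> \<infinity>" and sr': "sr' \<Longrightarrow> y' \<noteq> \<infinity>"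
  shows "sl = sl' \<and> sr = sr' \<and> l = l' \<and> y = y'"
proof -
  have low: "\<exists>z\<in>J sl sr l y. z < w"
    if ly: "ereal l < y \<or> ereal l = y \<and> \<not> sl \<and> sr" and w: "l < w" for sl sr l y w
  proof (cases "ereal l < y")
    case True
    then obtain z where z: "ereal l < z" "z < min y (ereal w)" using dense[of "ereal l" "min y (ereal w)"] w by auto
    then obtain r where "z = ereal r" by (cases z) auto
    then show ?thesis using z by (intro bexI[of _ r]) (auto simp: J_def)
  next
    case False
    then show ?thesis using ly w by (intro bexI[of _ l]) (auto simp: J_def)
  qed
  have high: "\<exists>z\<in>J sl sr l y. w < ereal z"
    if ly: "ereal l < y \<or> ereal l = y \<and> \<not> sl \<and> sr" and w: "w < y" for sl sr l y w
  proof (cases "ereal l < y")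
    case True
    then obtain z where z: "max (ereal l) w < z" "z < y" using dense[of "max (ereal l) w" y] w by auto
    then obtain r where "z = ereal r" by (cases z) auto
    then show ?thesis using z by (intro bexI[of _ r]) (auto simp: J_def)
  next
    case False
    then show ?thesis using ly w by (intro bexI[of _ l]) (auto simp: J_def)
  qed
  have lower: "l \<le> z" "ereal z \<le> y" if "z \<in> J sl sr l y" for z sl sr l y
    using that by (auto simp: J_def split: if_splits)
  have "\<not> l < l'" using low[OF ly, of l'] lower(1)[of _ sl' sr' l' y'] eq by fastforce
  moreover have "\<not> l' < l" using low[OF ly', of l] lower(1)[of _ sl sr l y] eq by fastforce
  ultimately have l: "l = l'" by simp
  have "\<not> y < y'" using high[OF ly', of y] lower(2)[of _ sl sr l y] eq by fastforce
  moreover have "\<not> y' < y" using high[OF ly, of y'] lower(2)[of _ sl' sr' l' y'] eq by fastforce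
  ultimately have y: "y = y'" by simp
  have "l \<in> J sl sr l y \<longleftrightarrow> \<not> sl" "l \<in> J sl' sr' l y \<longleftrightarrow> \<not> sl'"
    using ly ly' l y by (auto simp: J_def)
  then have 1: "sl = sl'" using eq l y by auto
  have 2: "sr = sr'"
  proof (cases y)
    case (real r)
    then have "r \<in> J sl sr l y \<longleftrightarrow> sr" "r \<in> J sl' sr' l y \<longleftrightarrow> sr'"
      using ly ly' l y by (auto simp: J_def)
    then show ?thesis using eq l y by auto
  qed (use sr sr' y ly in auto)
  show ?thesis using 1 2 l y by simp
qed

lemma vimage_eq_zz_interval:
  "ereal -` {crit n a i..crit n a j} = zz_interval n a False True i j"
  "ereal -` {crit n a i..<crit n a j} = zz_interval n a False False i j"
  "ereal -` {crit n a i<..crit n a j} = zz_interval n a True True i j"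
  "ereal -` {crit n a i<..<crit n a j} = zz_interval n a True False i j"
  by (auto simp: zz_interval_def)

lemma zz_translation_iff:
  "((p, q), J) \<in> zz_translation n a \<longleftrightarrow>
    (\<exists>sl sr i j. p = (if sl then 2 * i else 2 * i - 1) \<and> q = (if sr then 2 * j - 1 else 2 * (j - 1)) \<and>
       J = zz_interval n a sl sr i j \<and> 1 \<le> i \<and> (i < j \<or> \<not> sl \<and> sr \<and> i = j) \<and> j \<le> (if sr then n else n + 1))"
  unfolding zz_translation_def vimage_eq_zz_interval ex_bool_eq by (auto simp: le_less)

text \<open>\<open>dgm_ZZ\<close> sums over all position pairs that translate to the given set of
  reals; this leaves a single term.\<close>

lemma zz_translation_unique:
  assumes a: "strict_mono_on {1..n} a" and ij: "1 \<le> i" "i < j" "j \<le> (if sr then n else n + 1)"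
  shows "{pq. (pq, zz_interval n a sl sr i j) \<in> zz_translation n a} =
    {(if sl then 2 * i else 2 * i - 1, if sr then 2 * j - 1 else 2 * (j - 1))}"
proof -
  have less: "crit n a i < crit n a j" if "1 \<le> i" "i < j" "j \<le> n + 1" for i j
    using that strict_mono_onD[OF a, of i j] by (auto simp: crit_def)
  have inj: "i = j" if "crit n a i = crit n a j" "1 \<le> i" "i \<le> n + 1" "1 \<le> j" "j \<le> n + 1" for i j
    using that less[of i j] less[of j i] by (cases i j rule: linorder_cases) auto
  have "sl' = sl \<and> sr' = sr \<and> i' = i \<and> j' = j"
    if eq: "zz_interval n a sl sr i j = zz_interval n a sl' sr' i' j'"
      and v: "1 \<le> i'" "i' < j' \<or> \<not> sl' \<and> sr' \<and> i' = j'" "j' \<le> (if sr' then n else n + 1)" for sl' sr' i' j'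
  proof -
    have n: "i \<le> n" "i' \<le> n" "j \<le> n + 1" "j' \<le> n + 1" using ij v by (auto split: if_splits)
    then have c: "crit n a i = ereal (a i)" "crit n a i' = ereal (a i')" by (auto simp: crit_def)
    have "sl = sl' \<and> sr = sr' \<and> a i = a i' \<and> crit n a j = crit n a j'"
    proof (rule interval_ends_unique)
      show "{x. (if sl then ereal (a i) < ereal x else ereal (a i) \<le> ereal x) \<and>
          (if sr then ereal x \<le> crit n a j else ereal x < crit n a j)} =
        {x. (if sl' then ereal (a i') < ereal x else ereal (a i') \<le> ereal x) \<and>
          (if sr' then ereal x \<le> crit n a j' else ereal x < crit n a j')}"
        using eq unfolding zz_interval_def c .
      show "ereal (a i) < crit n a j \<or> ereal (a i) = crit n a j \<and> \<not> sl \<and> sr"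
        using less[OF ij(1,2)] n c by simp
      show "ereal (a i') < crit n a j' \<or> ereal (a i') = crit n a j' \<and> \<not> sl' \<and> sr'"
        using less[OF v(1)] v(2) n c by auto
    qed (use ij v in \<open>auto simp: crit_def\<close>)
    then show ?thesis using inj[of i i'] inj[of j j'] n ij v c by auto
  qed
  note unique = this
  show ?thesis
  proof (intro equalityI subsetI)
    fix pq assume "pq \<in> {pq. (pq, zz_interval n a sl sr i j) \<in> zz_translation n a}"
    then obtain p q where pq: "pq = (p, q)" "((p, q), zz_interval n a sl sr i j) \<in> zz_translation n a"
      by (cases pq) auto
    then obtain sl' sr' i' j' where "p = (if sl' then 2 * i' else 2 * i' - 1)" "q = (if sr' then 2 * j' - 1 else 2 * (j' - 1))"
      "zz_interval n a sl sr i j = zz_interval n a sl' sr' i' j'"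
      "1 \<le> i'" "i' < j' \<or> \<not> sl' \<and> sr' \<and> i' = j'" "j' \<le> (if sr' then n else n + 1)"
      unfolding zz_translation_iff by blast
    then show "pq \<in> {(if sl then 2 * i else 2 * i - 1, if sr then 2 * j - 1 else 2 * (j - 1))}"
      using unique[of sl' sr' i' j'] pq(1) by simp
  next
    fix pq assume "pq \<in> {(if sl then 2 * i else 2 * i - 1, if sr then 2 * j - 1 else 2 * (j - 1))}"
    then have "pq = (if sl then 2 * i else 2 * i - 1, if sr then 2 * j - 1 else 2 * (j - 1))" by simp
    then show "pq \<in> {pq. (pq, zz_interval n a sl sr i j) \<in> zz_translation n a}"
      using ij unfolding mem_Collect_eq zz_translation_iff by (simp only: zz_translation_iff) blast
  qed
qed

section \<open>Sides of rectangles and one-sided jumps\<close>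

abbreviation sign :: "bool \<Rightarrow> decoration" where
  "sign sl \<equiv> if sl then Plus else Minus"

text \<open>
  Whether a pair of subspaces which jumps at \<open>x\<close> sees the jump on the side \<open>[b1, b2]\<close> of a rectangle. Slashes jump
  to the right of \<open>x\<close> and backslashes to the left.
\<close>

definition jumps :: "bool \<Rightarrow> ereal \<Rightarrow> ereal \<Rightarrow> ereal \<Rightarrow> bool" where
  "jumps sl x b1 b2 \<longleftrightarrow> (if sl then b1 \<le> x \<and> x < b2 else b1 < x \<and> x \<le> b2)"

text \<open>The endpoint rules for a sign that matches the symbol turn each closed side into the
  half-open one of \<open>jumps\<close>, by the same rule on the left and on the right.\<close>

lemma in_rectangle_sign:
  "in_rectangle ((p, sign sl), (q, sign sr)) b1 b2 b3 b4 \<longleftrightarrow> jumps sl p b1 b2 \<and> jumps sr q b3 b4"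
  by (cases sl; cases sr) (auto simp: in_rectangle_def jumps_def less_le)

lemma jumps_imp_le: "jumps sl x b1 b2 \<Longrightarrow> b1 \<le> x \<and> x \<le> b2"
  by (auto simp: jumps_def split: if_splits)

text \<open>Adjacent sides, being half-open in the same direction, do not overlap, so a jump at
  \<open>p\<close> seen between \<open>b1\<close> and \<open>b2\<close> is not seen again
  beyond.\<close>

lemma not_jumps_outside:
  assumes "jumps sl p b1 b2" "s1 \<le> p" "p \<le> s2" "s1 \<le> x \<Longrightarrow> x \<le> s2 \<Longrightarrow> x = p"
  shows "\<not> jumps sl x s1 b1" "\<not> jumps sl x b2 s2"
proof -
  note le = jumps_imp_le[OF assms(1)]
  show "\<not> jumps sl x s1 b1"
  proof
    assume H: "jumps sl x s1 b1"
    then have "s1 \<le> x" "x \<le> s2"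
      using le assms(3) jumps_imp_le[OF H] by (blast intro: order_trans)+
    then show False using H assms(1,4) by (cases sl) (auto simp: jumps_def)
  qed
  show "\<not> jumps sl x b2 s2"
  proof
    assume H: "jumps sl x b2 s2"
    then have "s1 \<le> x" "x \<le> s2"
      using le assms(2) jumps_imp_le[OF H] by (blast intro: order_trans)+
    then show False using H assms(1,4) by (cases sl) (auto simp: jumps_def)
  qed
qed

text \<open>\<open>p\<close> is made the endpoint of the side that its sign permits, and the other
  end lies before the next element of \<open>F\<close> and the bound \<open>B1\<close> or
  \<open>B2\<close>. Such a side sees at most the jump at \<open>p\<close>, and only with the
  matching symbol.\<close>

lemma isolate_jump:
  fixes p B1 B2 :: ereal
  assumes F: "finite F" and B2: "u = Plus \<Longrightarrow> p < B2" and B1: "u = Minus \<Longrightarrow> B1 < p"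
  obtains b1 b2 where "b1 < b2" "b1 \<le> p" "p \<le> b2" "p = b1 \<longrightarrow> u = Plus" "p = b2 \<longrightarrow> u = Minus"
    "B1 < p \<longrightarrow> B1 < b1" "p < B2 \<longrightarrow> b2 < B2" "\<forall>x\<in>F. \<forall>sl. jumps sl x b1 b2 \<longrightarrow> x = p \<and> u = sign sl"
proof (cases u)
  case Plus
  let ?S = "insert B2 {x \<in> F. p < x}"
  have fin: "finite ?S" using F by simp
  have "p < Min ?S" using B2[OF Plus] by (subst Min_gr_iff[OF fin]) auto
  then obtain b where b: "p < b" "b < Min ?S" using dense by blast
  have lt: "b < x" if "x \<in> ?S" for x using b(2) Min_le[OF fin that] by (rule less_le_trans)
  have "x = p \<and> sl" if "x \<in> F" "jumps sl x p b" for x sl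
    using lt[of x] that by (cases sl; cases "p < x") (auto simp: jumps_def)
  then show ?thesis using b(1) lt[of B2] Plus by (intro that[of p b]) auto
next
  case Minus
  let ?S = "insert B1 {x \<in> F. x < p}"
  have fin: "finite ?S" using F by simp
  have "Max ?S < p" using B1[OF Minus] by (subst Max_less_iff[OF fin]) auto
  then obtain b where b: "Max ?S < b" "b < p" using dense by blast
  have lt: "x < b" if "x \<in> ?S" for x using Max_ge[OF fin that] b(1) by (rule le_less_trans)
  have "x = p \<and> \<not> sl" if "x \<in> F" "jumps sl x b p" for x sl
    using lt[of x] that by (cases sl; cases "x < p") (auto simp: jumps_def)
  then show ?thesis using b(2) lt[of B1] Minus by (intro that[of b p]) auto
qed

lemma dgm_le:
  assumes "in_rectangle P b1 b2 b3 b4" "b1 < b2" "b2 < b3" "b3 < b4"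
  shows "dgm \<mu> P \<le> \<mu> b1 b2 b3 b4"
proof -
  have "\<mu> b1 b2 b3 b4 \<in> {\<mu> a b c d | a b c d. a < b \<and> b < c \<and> c < d \<and> in_rectangle P a b c d}"
    using assms by blast
  then have "Inf {\<mu> a b c d | a b c d. a < b \<and> b < c \<and> c < d \<and> in_rectangle P a b c d} \<le> \<mu> b1 b2 b3 b4"
    by (rule Inf_lower)
  then show ?thesis by (simp add: dgm_def)
qed

lemma dgm_ge:
  assumes "decorated_point P"
    and "\<And>b1 b2 b3 b4. in_rectangle P b1 b2 b3 b4 \<Longrightarrow> b1 < b2 \<Longrightarrow> b2 < b3 \<Longrightarrow> b3 < b4 \<Longrightarrow> N \<le> \<mu> b1 b2 b3 b4"
  shows "N \<le> dgm \<mu> P"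
  using assms by (auto simp: dgm_def intro!: Inf_greatest)

section \<open>Measures and diagrams of a space of Morse type\<close>

locale morse_homology = homology_theory T
  for T :: "('k::field, 'a, 'v::ab_group_add) homology_data" +
  fixes k :: int and X :: "'a topology" and f :: "'a \<Rightarrow> real" and n :: nat and a :: "nat \<Rightarrow> real"
    and V E :: "nat \<Rightarrow> 'b topology" and l r :: "nat \<Rightarrow> 'b \<Rightarrow> 'b"
  assumes R_space: "R_space X f"
    and morse: "morse_type X f n a V E l r"
    and fin_dim_homology: "\<And>b c :: ereal. b \<le> c \<Longrightarrow>
      finite_dimensional_subspace (hscale T) (hgrp T k (interlevelset X f b c) {})"
begin

lemma continuous_f: "continuous_map X euclideanreal f"
  using R_space by (simp add: R_space_def)

lemma strict_mono_a: "strict_mono_on {1..n} a"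
  using morse by (simp add: morse_type_def)

sublocale lf: level_functor "hscale T" "\<lambda>b c. hgrp T k (interlevelset X f b c) {}"
  "\<lambda>b c b' c'. hind T k (interlevelset X f b c) {} (interlevelset X f b' c') {} id"
  by (rule level_functor_morse[OF continuous_f morse fin_dim_homology])

lemma levelset_zigzag_eq: "levelset_zigzag T k X f s = lf.level_zigzag s"
  by (simp add: levelset_zigzag_def lf.level_zigzag_def level_space_def cong: if_cong)

abbreviation "mu_type sl sr \<equiv> mu T k X f (if sl then 2 else 1) (if sr then 5 else 4)"

text \<open>The freedom in \<open>m\<close> matters: evaluating one rectangle at two levels links
  subspaces of different levelsets.\<close>

lemma mu_eq_rect_mult:
  assumes "b1 \<le> b2" "b2 \<le> m" "m \<le> b3" "b3 \<le> b4"
  shows "\<exists>N. mu_type sl sr b1 b2 b3 b4 = enat N \<and> int N = lf.rect_mult sl sr m b1 b2 b3 b4"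
proof -
  have s: "sorted [b1, b2, b3, b4]" using assms by (auto intro: order_trans)
  have e: "(if sl then 2 * 1 else 2 * 1 - 1) = (if sl then 2 else 1 :: nat)"
    "(if sr then 2 * 2 + 1 else 2 * 2) = (if sr then 5 else 4 :: nat)" by auto
  show ?thesis
    using lf.interval_mult_level_zigzag[OF s, of 1 2 m sl sr, unfolded e] assms
    by (simp add: mu_def levelset_zigzag_eq)
qed

text \<open>\<open>dieL\<close> is kept if the upper part includes injectively, by the upward
  retraction, and \<open>reachL\<close> if the bottom levelset carries all classes, by the downward
  one. These tolerate critical values at opposite ends, as \<open>jumps\<close> records.\<close>

lemma left_pair_const:
  assumes "b1 \<le> b1'" "b1' \<le> m" "b2 \<le> m" "b2' \<le> m" "b2' \<le> b2"
    and "\<And>i. i \<in> {1..n} \<Longrightarrow> \<not> jumps sl (ereal (a i)) b1 b1'"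
    and "\<And>i. i \<in> {1..n} \<Longrightarrow> \<not> jumps sl (ereal (a i)) b2' b2"
  shows "lf.left_pair sl m b1' b2' = lf.left_pair sl m b1 b2"
proof -
  have die: "lf.dieL m x = lf.dieL m y"
    if "x \<le> y" "y \<le> m" "\<And>i. i \<in> {1..n} \<Longrightarrow> \<not> (x \<le> ereal (a i) \<and> ereal (a i) < y)" for x y
    using bij_betw_imp_inj_on[OF interlevelset_bij[OF continuous_f morse that]] by (rule lf.dieL_eq[OF that(1,2)])
  have reach: "lf.reachL m x = lf.reachL m y"
    if "x \<le> y" "y \<le> m" "\<And>i. i \<in> {1..n} \<Longrightarrow> \<not> (x < ereal (a i) \<and> ereal (a i) \<le> y)" for x y
    using bij_betw_imp_surj_on[OF interlevelset_bij_right[OF continuous_f morse order_refl that(1,3)]]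
    by (intro lf.reachL_eq[OF that(1,2)]) simp
  show ?thesis
    using assms die[of b1 b1'] die[of b2' b2] reach[of b1 b1'] reach[of b2' b2]
    by (cases sl) (simp_all add: lf.left_pair_def jumps_def)
qed

lemma right_pair_const:
  assumes "b3' \<le> b3" "m \<le> b3'" "m \<le> b4" "m \<le> b4'" "b4 \<le> b4'"
    and "\<And>i. i \<in> {1..n} \<Longrightarrow> \<not> jumps sr (ereal (a i)) b3' b3"
    and "\<And>i. i \<in> {1..n} \<Longrightarrow> \<not> jumps sr (ereal (a i)) b4 b4'"
  shows "lf.right_pair sr m b3 b4 = lf.right_pair sr m b3' b4'"
proof -
  have die: "lf.dieR m y = lf.dieR m x"
    if "x \<le> y" "m \<le> x" "\<And>i. i \<in> {1..n} \<Longrightarrow> \<not> (x < ereal (a i) \<and> ereal (a i) \<le> y)" for x y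
    using bij_betw_imp_inj_on[OF interlevelset_bij_right[OF continuous_f morse that(2,1,3)]]
    by (rule lf.dieR_eq_dieR[OF that(1,2)])
  have reach: "lf.reachR m y = lf.reachR m x"
    if "x \<le> y" "m \<le> x" "\<And>i. i \<in> {1..n} \<Longrightarrow> \<not> (x \<le> ereal (a i) \<and> ereal (a i) < y)" for x y
    using bij_betw_imp_surj_on[OF interlevelset_bij[OF continuous_f morse that(1) order_refl that(3)]]
    by (intro lf.reachR_eq_reachR[OF that(1,2)]) simp
  show ?thesis
    using assms die[of b3' b3] die[of b4 b4'] reach[of b3' b3] reach[of b4 b4']
    by (cases sr) (simp_all add: lf.right_pair_def jumps_def)
qed

text \<open>A side without jumps may be shrunk to the point \<open>b2\<close>, where the two
  subspaces coincide.\<close>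

lemma left_pair_degenerate:
  assumes "b1 \<le> b2" "b2 \<le> m"
    and "\<And>i. i \<in> {1..n} \<Longrightarrow> \<not> jumps sl (ereal (a i)) b1 b2"
  shows "fst (lf.left_pair sl m b1 b2) = snd (lf.left_pair sl m b1 b2)"
proof -
  have "lf.left_pair sl m b2 b2 = lf.left_pair sl m b1 b2"
    using assms by (intro left_pair_const) (auto simp: jumps_def)
  then show ?thesis by (metis lf.left_pair_def fst_conv snd_conv)
qed

lemma right_pair_degenerate:
  assumes "b3 \<le> b4" "m \<le> b3"
    and "\<And>i. i \<in> {1..n} \<Longrightarrow> \<not> jumps sr (ereal (a i)) b3 b4"
  shows "fst (lf.right_pair sr m b3 b4) = snd (lf.right_pair sr m b3 b4)"
proof -
  have "lf.right_pair sr m b4 b4 = lf.right_pair sr m b3 b4"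
    using assms by (intro right_pair_const) (auto simp: jumps_def)
  then show ?thesis by (metis lf.right_pair_def fst_conv snd_conv)
qed

text \<open>A small rectangle around the point has a side that sees no jump of its type, since the
  coordinate there is not critical or has the wrong sign. Its measure is 0 and bounds the
  diagram.\<close>

lemma dgm_eq_zero:
  assumes P: "decorated_point ((p, u), (q, v))"
    and not: "\<not> ((\<exists>i\<in>{1..n}. p = ereal (a i) \<and> u = sign sl) \<and> (\<exists>j\<in>{1..n}. q = ereal (a j) \<and> v = sign sr))"
  shows "dgm (mu_type sl sr) ((p, u), (q, v)) = 0"
proof -
  have pq: "p < q" "u = Minus \<Longrightarrow> -\<infinity> < p" "v = Plus \<Longrightarrow> q < \<infinity>"
    using P by (auto simp: decorated_point_def)
  let ?F = "(\<lambda>i. ereal (a i)) ` {1..n}"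
  have F: "finite ?F" by simp
  \<comment> \<open>Keeps the two isolated sides apart and serves as the intermediate level.\<close>
  obtain m where m: "p < m" "m < q" using dense pq(1) by blast
  show ?thesis
  proof (rule isolate_jump[OF F m(1) pq(2)], assumption, rule isolate_jump[OF F pq(3) m(2)], assumption)
    fix b1 b2 b3 b4
    assume b12: "b1 < b2" "b1 \<le> p" "p \<le> b2" "p = b1 \<longrightarrow> u = Plus" "p = b2 \<longrightarrow> u = Minus" "p < m \<longrightarrow> b2 < m"
      and left: "\<forall>x\<in>?F. \<forall>sl. jumps sl x b1 b2 \<longrightarrow> x = p \<and> u = sign sl"
      and b34: "b3 < b4" "b3 \<le> q" "q \<le> b4" "q = b3 \<longrightarrow> v = Plus" "q = b4 \<longrightarrow> v = Minus" "m < q \<longrightarrow> m < b3"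
      and right: "\<forall>x\<in>?F. \<forall>sl. jumps sl x b3 b4 \<longrightarrow> x = q \<and> v = sign sl"
    have le: "b1 \<le> b2" "b2 \<le> m" "m \<le> b3" "b3 \<le> b4" and b23: "b2 < b3" using b12 b34 m by auto
    have "fst (lf.left_pair sl m b1 b2) = snd (lf.left_pair sl m b1 b2) \<or>
        fst (lf.right_pair sr m b3 b4) = snd (lf.right_pair sr m b3 b4)"
    proof (cases "\<exists>i\<in>{1..n}. p = ereal (a i) \<and> u = sign sl")
      case False
      then have "\<not> jumps sl (ereal (a i)) b1 b2" if "i \<in> {1..n}" for i
        using bspec[OF left imageI[OF that]] that by metis
      then show ?thesis using left_pair_degenerate[OF le(1,2)] by blast
    next
      case True
      then have "\<not> (\<exists>j\<in>{1..n}. q = ereal (a j) \<and> v = sign sr)" using not by blast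
      then have "\<not> jumps sr (ereal (a i)) b3 b4" if "i \<in> {1..n}" for i
        using bspec[OF right imageI[OF that]] that by metis
      then show ?thesis using right_pair_degenerate[OF le(4,3)] by blast
    qed
    then have zero: "lf.rect_mult sl sr m b1 b2 b3 b4 = 0" by (rule lf.rect_mult_eq_zero)
    from mu_eq_rect_mult[OF le]
    obtain N where "mu_type sl sr b1 b2 b3 b4 = enat N \<and> int N = lf.rect_mult sl sr m b1 b2 b3 b4" ..
    then have "mu_type sl sr b1 b2 b3 b4 = 0" using zero by (simp add: zero_enat_def)
    moreover have "in_rectangle ((p, u), (q, v)) b1 b2 b3 b4"
      using b12 b34 by (simp add: in_rectangle_def)
    ultimately have "dgm (mu_type sl sr) ((p, u), (q, v)) \<le> 0"
      using dgm_le[of "((p, u), (q, v))" b1 b2 b3 b4 "mu_type sl sr"] b12(1) b23 b34(1) by simp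
    then show ?thesis by simp
  qed
qed

end

section \<open>Comparison with the zigzag on interleaved levels\<close>

locale morse_levels = morse_homology T k X f n a V E l r
  for T :: "('k::field, 'a, 'v::ab_group_add) homology_data" and k X f n a
    and V E :: "nat \<Rightarrow> 'b topology" and l r +
  fixes s :: "nat \<Rightarrow> real"
  assumes interleaved: "\<And>i. i \<in> {1..n} \<Longrightarrow> s (i - 1) < a i \<and> a i < s i"
begin

lemma s_mono: "i \<le> j \<Longrightarrow> j \<le> n \<Longrightarrow> s i \<le> s j"
proof (induction j rule: nat_induct_at_least)
  case (Suc j)
  then show ?case using interleaved[of "Suc j"] by auto
qed simp

lemma crit_between:
  assumes "i \<in> {1..n}" "i' \<in> {1..n}" "s (i - 1) \<le> a i'" "a i' \<le> s i"
  shows "i' = i"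
proof (cases i' i rule: linorder_cases)
  case less
  then have "s i' \<le> s (i - 1)" using assms by (intro s_mono) auto
  then show ?thesis using interleaved[OF assms(2)] assms(3) by simp
next
  case greater
  then have "s i \<le> s (i' - 1)" using assms by (intro s_mono) auto
  then show ?thesis using interleaved[OF assms(2)] assms(4) by simp
qed simp

abbreviation "levels \<equiv> map (\<lambda>i. ereal (s i)) [0..<Suc n]"

lemma sorted_levels: "sorted levels"
  by (auto simp: sorted_iff_nth_mono intro!: s_mono simp del: upt_Suc)

lemma levels_nth: "i \<le> n \<Longrightarrow> levels ! i = ereal (s i)"
  by (simp del: upt_Suc)

text \<open>The zigzag multiplicity is \<open>rect_mult\<close> of the reference rectangle
  \<open>[s (i - 1), s i]\<close> times \<open>[s (j - 1), s j]\<close>. Every rectangle inside it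
  that contains the point has the same value, and any other around the point has at least the value
  of its intersection with it.\<close>

lemma dgm_eq_interval_mult:
  assumes ij: "1 \<le> i" "i < j" "j \<le> n"
  shows "dgm (mu_type sl sr) ((ereal (a i), sign sl), (ereal (a j), sign sr)) =
    interval_mult (hscale T) (levelset_zigzag T k X f levels)
      (if sl then 2 * i else 2 * i - 1) (if sr then 2 * j - 1 else 2 * (j - 1))"
proof -
  let ?P = "((ereal (a i), sign sl), (ereal (a j), sign sr))"
  let ?s1 = "ereal (s (i - 1))" and ?s2 = "ereal (s i)" and ?s3 = "ereal (s (j - 1))" and ?s4 = "ereal (s j)"
  have i: "i \<in> {1..n}" and j: "j \<in> {1..n}" using ij by auto
  have s12: "?s1 < ereal (a i)" "ereal (a i) < ?s2" using interleaved[OF i] by auto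
  have s34: "?s3 < ereal (a j)" "ereal (a j) < ?s4" using interleaved[OF j] by auto
  have s23: "?s2 \<le> ?s3" using s_mono[of i "j - 1"] ij by simp
  have aij: "ereal (a i) < ereal (a j)" using s12 s34 s23 by (meson less_le_trans less_trans)
  have P: "decorated_point ?P" using aij by (simp add: decorated_point_def)
  have ci: "ereal (a i') = ereal (a i)" if "i' \<in> {1..n}" "?s1 \<le> ereal (a i')" "ereal (a i') \<le> ?s2" for i'
    using crit_between[OF i that(1)] that by simp
  have cj: "ereal (a j') = ereal (a j)" if "j' \<in> {1..n}" "?s3 \<le> ereal (a j')" "ereal (a j') \<le> ?s4" for j'
    using crit_between[OF j that(1)] that by simp
  have q: "(if sr then 2 * (j - 1) + 1 else 2 * (j - 1)) = (if sr then 2 * j - 1 else 2 * (j - 1))"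
    using ij by auto
  have ij': "i \<le> j - 1" "Suc (j - 1) < length levels" "Suc (j - 1) = j" using ij by auto
  have nth: "levels ! (i - 1) = ?s1" "levels ! i = ?s2" "levels ! (j - 1) = ?s3" "levels ! j = ?s4"
    using ij by (auto simp: levels_nth simp del: upt_Suc)
  from lf.interval_mult_level_zigzag[where sl = sl and sr = sr,
      OF sorted_levels ij(1) ij'(1,2), unfolded q ij'(3) nth, OF order_refl s23]
  obtain N where N': "interval_mult (hscale T) (lf.level_zigzag levels)
      (if sl then 2 * i else 2 * i - 1) (if sr then 2 * j - 1 else 2 * (j - 1)) = enat N \<and>
    int N = lf.rect_mult sl sr ?s2 ?s1 ?s2 ?s3 ?s4" ..
  have N: "interval_mult (hscale T) (levelset_zigzag T k X f levels)
      (if sl then 2 * i else 2 * i - 1) (if sr then 2 * j - 1 else 2 * (j - 1)) = enat N"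
    "int N = lf.rect_mult sl sr ?s2 ?s1 ?s2 ?s3 ?s4"
    using N' by (simp_all only: levelset_zigzag_eq)
  have inner: "lf.rect_mult sl sr ?s2 b1 b2 b3 b4 = int N"
    if R: "jumps sl (ereal (a i)) b1 b2" "jumps sr (ereal (a j)) b3 b4"
      and b: "?s1 \<le> b1" "b2 \<le> ?s2" "?s3 \<le> b3" "b4 \<le> ?s4" for b1 b2 b3 b4
  proof -
    have le: "b1 \<le> ?s2" "?s3 \<le> b4"
      using R[THEN jumps_imp_le] s12 s34 by (meson less_imp_le order_trans)+
    have "lf.left_pair sl ?s2 b1 b2 = lf.left_pair sl ?s2 ?s1 ?s2"
      using not_jumps_outside[OF R(1) s12[THEN less_imp_le] ci]
      by (rule left_pair_const[OF b(1) le(1) order_refl b(2) b(2)])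
    moreover have "lf.right_pair sr ?s2 b3 b4 = lf.right_pair sr ?s2 ?s3 ?s4"
      using order_trans[OF s23 le(2)] order_trans[OF s23 less_imp_le[OF less_trans[OF s34]]] b(4)
        not_jumps_outside[OF R(2) s34[THEN less_imp_le] cj]
      by (rule right_pair_const[OF b(3) s23])
    ultimately show ?thesis unfolding N(2) by (rule lf.rect_mult_cong)
  qed
  have lower: "enat N \<le> mu_type sl sr b1 b2 b3 b4"
    if R: "b1 < b2" "b2 < b3" "b3 < b4" "in_rectangle ?P b1 b2 b3 b4" for b1 b2 b3 b4
  proof -
    \<comment> \<open>Clipping to the reference rectangle. The given measure is compared at level
      \<open>b2\<close>, the reference value is known at \<open>?s2\<close>, and the clipped
      rectangle admits both as intermediate levels.\<close>
    let ?c1 = "max b1 ?s1" and ?c2 = "min b2 ?s2" and ?c3 = "max b3 ?s3" and ?c4 = "min b4 ?s4"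
    have in': "jumps sl (ereal (a i)) ?c1 ?c2" "jumps sr (ereal (a j)) ?c3 ?c4"
      using R(4) s12 s34 unfolding in_rectangle_sign by (auto simp: jumps_def)
    have c: "?c1 \<le> ?c2" "?c3 \<le> ?c4" using in'[THEN jumps_imp_le] by (blast intro: order_trans)+
    have le: "b2 \<le> ?c3" "?s2 \<le> ?c3" using R(2) s23 by (auto simp: le_max_iff_disj)
    from mu_eq_rect_mult[OF less_imp_le[OF R(1)] order_refl R(2,3)[THEN less_imp_le]]
    obtain M where M: "mu_type sl sr b1 b2 b3 b4 = enat M \<and> int M = lf.rect_mult sl sr b2 b1 b2 b3 b4" ..
    from mu_eq_rect_mult[OF c(1) min.cobounded1 le(1) c(2)]
    obtain K where K: "mu_type sl sr ?c1 ?c2 ?c3 ?c4 = enat K \<and> int K = lf.rect_mult sl sr b2 ?c1 ?c2 ?c3 ?c4" ..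
    from mu_eq_rect_mult[OF c(1) min.cobounded2 le(2) c(2)]
    obtain K' where K': "mu_type sl sr ?c1 ?c2 ?c3 ?c4 = enat K' \<and> int K' = lf.rect_mult sl sr ?s2 ?c1 ?c2 ?c3 ?c4" ..
    have "lf.rect_mult sl sr b2 ?c1 ?c2 ?c3 ?c4 \<le> lf.rect_mult sl sr b2 b1 b2 b3 b4"
      by (rule lf.rect_mult_mono[OF max.cobounded1 c(1) min.cobounded1 order_refl less_imp_le[OF R(2)]
            max.cobounded1 c(2) min.cobounded1])
    moreover have "lf.rect_mult sl sr ?s2 ?c1 ?c2 ?c3 ?c4 = int N"
      by (rule inner[OF in' max.cobounded2 min.cobounded2 max.cobounded2 min.cobounded2])
    moreover have "K = K'" using K K' by simp
    ultimately have "int N \<le> int M" using M K K' by simp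
    then show ?thesis using M by simp
  qed
  \<comment> \<open>For \<open>j = i + 1\<close> the reference rectangle has
    \<open>?s2 = ?s3\<close>, which \<open>dgm\<close> does not admit, so its left side is cut at
    some \<open>b\<close> below \<open>?s2\<close>.\<close>
  obtain b where b: "ereal (a i) < b" "b < ?s2" using dense[OF s12(2)] by blast
  have R0: "jumps sl (ereal (a i)) ?s1 b" "jumps sr (ereal (a j)) ?s3 ?s4"
    using s12 s34 b by (auto simp: jumps_def)
  have bs: "?s1 < b" "b < ?s3" "?s3 < ?s4"
    by (rule less_trans[OF s12(1) b(1)], rule less_le_trans[OF b(2) s23], rule less_trans[OF s34])
  from mu_eq_rect_mult[OF less_imp_le[OF bs(1)] less_imp_le[OF b(2)] s23 less_imp_le[OF bs(3)]]
  obtain M where "mu_type sl sr ?s1 b ?s3 ?s4 = enat M \<and> int M = lf.rect_mult sl sr ?s2 ?s1 b ?s3 ?s4" ..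
  then have attained: "mu_type sl sr ?s1 b ?s3 ?s4 = enat N"
    using inner[OF R0] b by simp
  have "dgm (mu_type sl sr) ?P = enat N"
  proof (rule antisym)
    show "dgm (mu_type sl sr) ?P \<le> enat N"
      using dgm_le[OF in_rectangle_sign[THEN iffD2, OF conjI[OF R0]] bs, of "mu_type sl sr"] attained by simp
    show "enat N \<le> dgm (mu_type sl sr) ?P"
      by (rule dgm_ge[OF P], rule lower)
  qed
  then show ?thesis unfolding N(1) .
qed

text \<open>Nothing lies above the last critical value, so the space at the last position
  \<open>2 * n\<close> is zero.\<close>

lemma interval_mult_at_infinity:
  assumes "p \<le> 2 * n" "1 \<le> n"
  shows "interval_mult (hscale T) (levelset_zigzag T k X f levels) p (2 * n) = 0"
proof -
  interpret zz: fin_dim_zigzag "hscale T" "levelset_zigzag T k X f levels"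
    unfolding levelset_zigzag_eq by (rule lf.fin_dim_level_zigzag[OF sorted_levels])
  have "ereal (a i) < ereal (s n)" if "i \<in> {1..n}" for i
    using interleaved[OF that] s_mono[of i n] that by auto
  then have "topspace (interlevelset X f (ereal (s n)) (ereal (s n))) = {}"
    by (rule morse_interlevelset_empty_above[OF morse])
  then have "zspace (levelset_zigzag T k X f levels) (2 * n) = {0}"
    using hgrp_empty by (simp add: levelset_zigzag_def level_space_def levels_nth del: upt_Suc)
  then show ?thesis
    using assms by (intro zz.interval_mult_zero_space) (auto simp: levelset_zigzag_def)
qed

lemma dgm_ZZ_eq:
  assumes "1 \<le> i" "i < j" "j \<le> (if sr then n else n + 1)"
  shows "dgm_ZZ T k X f n a s (zz_interval n a sl sr i j) =
    interval_mult (hscale T) (levelset_zigzag T k X f levels)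
      (if sl then 2 * i else 2 * i - 1) (if sr then 2 * j - 1 else 2 * (j - 1))"
  unfolding dgm_ZZ_def zz_translation_unique[OF strict_mono_a assms] by simp

theorem dgm_eq_dgm_ZZ:
  assumes "1 \<le> i" "i < j" "j \<le> (if sr then n else n + 1)"
  shows "dgm (mu_type sl sr) ((crit n a i, sign sl), (crit n a j, sign sr)) =
    dgm_ZZ T k X f n a s (zz_interval n a sl sr i j)"
proof (cases "j \<le> n")
  case True
  then show ?thesis
    unfolding dgm_ZZ_eq[OF assms] using dgm_eq_interval_mult[OF assms(1,2) True] assms by (simp add: crit_def)
next
  case False
  \<comment> \<open>The right end is \<open>+\<infinity>\<close>: it is no critical value, so the
    diagram vanishes there, and no bar of the zigzag ends at its last, zero space.\<close>
  then have j: "j = n + 1" "\<not> sr" using assms by (auto split: if_splits)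
  have "dgm (mu_type sl sr) ((crit n a i, sign sl), (crit n a j, sign sr)) = 0"
    using j assms by (intro dgm_eq_zero) (auto simp: crit_def decorated_point_def)
  moreover have "interval_mult (hscale T) (levelset_zigzag T k X f levels) (if sl then 2 * i else 2 * i - 1) (2 * n) = 0"
    using j assms by (intro interval_mult_at_infinity) auto
  ultimately show ?thesis
    unfolding dgm_ZZ_eq[OF assms] using j by simp
qed

theorem dgm_nonzeroD:
  assumes "decorated_point P" "dgm (mu_type sl sr) P \<noteq> 0"
  shows "\<exists>i j. 1 \<le> i \<and> i < j \<and> j \<le> (if sr then n else n + 1) \<and>
    P = ((crit n a i, sign sl), (crit n a j, sign sr))"
proof -
  obtain p u q v where P: "P = ((p, u), (q, v))" by (metis prod.exhaust)
  obtain i j where ij: "i \<in> {1..n}" "p = ereal (a i)" "u = (if sl then Plus else Minus)"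
    "j \<in> {1..n}" "q = ereal (a j)" "v = (if sr then Plus else Minus)"
    using dgm_eq_zero[of p u q v sl sr] assms P by blast
  have "a i < a j" using assms(1) P ij by (simp add: decorated_point_def)
  then have "i < j"
    using strict_mono_on_leD[OF strict_mono_a ij(4,1)] by (cases "i < j") auto
  then show ?thesis using ij P by (rule_tac exI[of _ i], rule_tac exI[of _ j]) (auto simp: crit_def)
qed

end

theorem theorem3p12:
  fixes T :: "('k::field, 'a, 'v::ab_group_add) homology_data"
    and k :: int
    and X :: "'a topology" and f :: "'a \<Rightarrow> real"
    and n :: nat and a s :: "nat \<Rightarrow> real"
    and V E :: "nat \<Rightarrow> 'b topology" and l r :: "nat \<Rightarrow> 'b \<Rightarrow> 'b"
  assumes "homology_theory T"
    and "R_space X f"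
    and "morse_type X f n a V E l r"
    and "\<And>b c :: ereal. b \<le> c \<Longrightarrow>
           finite_dimensional_subspace (hscale T) (hgrp T k (interlevelset X f b c) {})"
    and "\<And>i. i \<in> {1..n} \<Longrightarrow> s (i - 1) < a i \<and> a i < s i"
  shows
    "(\<forall>i j. 1 \<le> i \<and> i < j \<and> j \<le> n + 1 \<longrightarrow>
        dgm_sb T k X f ((crit n a i, Plus), (crit n a j, Minus)) =
        dgm_ZZ T k X f n a s (ereal -` {crit n a i<..<crit n a j})) \<and>
     (\<forall>i j. 1 \<le> i \<and> i < j \<and> j \<le> n + 1 \<longrightarrow>
        dgm_bb T k X f ((crit n a i, Minus), (crit n a j, Minus)) =
        dgm_ZZ T k X f n a s (ereal -` {crit n a i..<crit n a j})) \<and>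
     (\<forall>i j. 1 \<le> i \<and> i < j \<and> j \<le> n \<longrightarrow>
        dgm_ss T k X f ((crit n a i, Plus), (crit n a j, Plus)) =
        dgm_ZZ T k X f n a s (ereal -` {crit n a i<..crit n a j})) \<and>
     (\<forall>i j. 1 \<le> i \<and> i < j \<and> j \<le> n \<longrightarrow>
        dgm_bs T k X f ((crit n a i, Minus), (crit n a j, Plus)) =
        dgm_ZZ T k X f n a s (ereal -` {crit n a i..crit n a j})) \<and>
     (\<forall>P. decorated_point P \<and> dgm_sb T k X f P \<noteq> 0 \<longrightarrow>
        (\<exists>i j. 1 \<le> i \<and> i < j \<and> j \<le> n + 1 \<and> P = ((crit n a i, Plus), (crit n a j, Minus)))) \<and>
     (\<forall>P. decorated_point P \<and> dgm_bb T k X f P \<noteq> 0 \<longrightarrow>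
        (\<exists>i j. 1 \<le> i \<and> i < j \<and> j \<le> n + 1 \<and> P = ((crit n a i, Minus), (crit n a j, Minus)))) \<and>
     (\<forall>P. decorated_point P \<and> dgm_ss T k X f P \<noteq> 0 \<longrightarrow>
        (\<exists>i j. 1 \<le> i \<and> i < j \<and> j \<le> n \<and> P = ((crit n a i, Plus), (crit n a j, Plus)))) \<and>
     (\<forall>P. decorated_point P \<and> dgm_bs T k X f P \<noteq> 0 \<longrightarrow>
        (\<exists>i j. 1 \<le> i \<and> i < j \<and> j \<le> n \<and> P = ((crit n a i, Minus), (crit n a j, Plus))))"
proof -
  interpret homology_theory T by fact
  interpret morse_levels T k X f n a V E l r s
    by unfold_locales (use assms in auto)
  have mus: "mu_sb T k X f = mu_type True False" "mu_bb T k X f = mu_type False False"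
    "mu_ss T k X f = mu_type True True" "mu_bs T k X f = mu_type False True"
    by (simp_all add: mu_sb_def mu_bb_def mu_ss_def mu_bs_def)
  note dgms = dgm_sb_def dgm_bb_def dgm_ss_def dgm_bs_def
  show ?thesis
    unfolding vimage_eq_zz_interval dgms mus
  proof (intro conjI allI impI, goal_cases)
    case (1 i j)
    then show ?case using dgm_eq_dgm_ZZ[of i j, where sl = True and sr = False] by simp
  next
    case (2 i j)
    then show ?case using dgm_eq_dgm_ZZ[of i j, where sl = False and sr = False] by simp
  next
    case (3 i j)
    then show ?case using dgm_eq_dgm_ZZ[of i j, where sl = True and sr = True] by simp
  next
    case (4 i j)
    then show ?case using dgm_eq_dgm_ZZ[of i j, where sl = False and sr = True] by simp
  next
    case (5 P)
    then show ?case using dgm_nonzeroD[of P, where sl = True and sr = False] by simp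
  next
    case (6 P)
    then show ?case using dgm_nonzeroD[of P, where sl = False and sr = False] by simp
  next
    case (7 P)
    then show ?case using dgm_nonzeroD[of P, where sl = True and sr = True] by simp
  next
    case (8 P)
    then show ?case using dgm_nonzeroD[of P, where sl = False and sr = True] by simp
  qed
qed

end
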